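(* Let $X_t$, $t\in[0,+\infty)$, be a real process on a probability space $(\Omega,\mathcal{F},\mathbb{P})$ which is self-similar with index $\beta>0$, has stationary increments and càdlàg trajectories. Assume that $\mathbb{E}\,\mathrm{TV}^{c_0}(X,[0,1])<+\infty$ for some $c_0>0$, and that for any $k\in\{1,2,3,\dots\}$ the stationary sequence $\left(\mathrm{TV}^{1}(X,[0,k]),\mathrm{TV}^{1}(X,[k,2k]),\mathrm{TV}^{1}(X,[2k,3k]),\ldots\right)$ is ergodic. Assume moreover that $X$ possesses a local time $L$ relative to the Lebesgue measure $\mathrm{d}y$ on $\mathbb{R}$ and the constant mapping $\Xi(\omega)\equiv\mathrm{d}u$ (the Lebesgue measure on $[0,+\infty)$). Then there exist a sequence $(c_n)_{n\ge1}$ of positive reals with $c_n\to 0+$ as $n\to+\infty$ and a measurable set $\Omega_X\subset\Omega$ with $\mathbb{P}(\Omega_X)=1$ such that for each $\omega\in\Omega_X$ and each $t\in[0,+\infty)$ the measures $$c_n^{1/\beta-1}\,\mathrm{n}^{y,c_n}(X(\omega),[0,t])\,\mathrm{d}y$$ converge weakly to $C\cdot L^y_t(\omega)\,\mathrm{d}y$ as $n\to+\infty$, where $C=\lim_{n\to+\infty}\frac{1}{n}\mathbb{E}\,\mathrm{TV}^{1}(X,[0,n])$.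
   Context: Truncated variation: for $x:[0,+\infty)\to\mathbb{R}$, $c\ge 0$ and $0\le s<t$, $$\mathrm{TV}^{c}(x,[s,t])=\sup_{\pi}\sum_{[u,v]\in\pi}\max(|x_v-x_u|-c,0),$$ the supremum being over all finite partitions $\pi$ of $[s,t]$ into subintervals with disjoint interiors (it is $0$ on $[0,0]$). $X$ is self-similar with index $\beta>0$ if for any $A>0$ the processes $(A^{-\beta}X_{At})_{t\ge 0}$ and $(X_t)_{t\ge 0}$ have the same distribution. $X$ has stationary increments if for all $0\le t_1<\dots<t_n$ and $h>0$ the vectors $(X_{t_2}-X_{t_1},\dots,X_{t_n}-X_{t_{n-1}})$ and $(X_{t_2+h}-X_{t_1+h},\dots,X_{t_n+h}-X_{t_{n-1}+h})$ have the same distribution. Numbers of interval crossings of a càdlàg path $x$: for $y\in\mathbb{R}$, $c>0$, put $\sigma^c_0=s$ and for $n=0,1,2,\dots$ $$\rho^c_n=\inf\{u\in[\sigma^c_n,t]: x_u\ge y+c/2\},\qquad \sigma^c_{n+1}=\inf\{u\in[\rho^c_n,t]: x_u<y-c/2\},$$ with $\inf\emptyset=+\infty$ and $[+\infty,t]=\emptyset$. Then $\mathrm{d}^{y,c}(x,[s,t])=\max\{n:\sigma^c_n\le t\}$, $\mathrm{u}^{y,c}(x,[s,t])=\mathrm{d}^{-y,c}(-x,[s,t])$ and $\mathrm{n}^{y,c}(x,[s,t])=\mathrm{u}^{y,c}(x,[s,t])+\mathrm{d}^{y,c}(x,[s,t])$. Local time: for $\omega\in\Omega$ and $t\ge0$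 let $\mu_t$ be the occupation measure $\mu_t(\Gamma)=\int_{[0,t]}\mathbf{1}_\Gamma(X_s(\omega))\,\mathrm{d}s$, $\Gamma\subset\mathbb{R}$ Borel. $X$ possesses a local time relative to $\mathrm{d}y$ and the constant mapping $\Xi(\omega)\equiv\mathrm{d}u$ if for each $t\ge 0$, $\mu_t$ is $\mathbb{P}$-a.s. absolutely continuous with respect to $\mathrm{d}y$; the local time is the density $L^y_t(\omega)=(\mathrm{d}\mu_t/\mathrm{d}y)(y)$ (defined $\mathbb{P}$-a.s.). *)

theory Defs
  imports "HOL-Probability.Probability"
begin

text \<open>
  Paths are functions \<^typ>\<open>real \<Rightarrow> real\<close> and processes functions \<^typ>\<open>real \<Rightarrow> 'w \<Rightarrow> real\<close>; in both cases
  only the times in \<open>[0, \<infinity>)\<close> are ever used.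
\<close>

definition cadlag :: "(real \<Rightarrow> real) \<Rightarrow> bool" where
  "cadlag x \<longleftrightarrow>
    (\<forall>t\<ge>0. continuous (at_right t) x) \<and> (\<forall>t>0. \<exists>l. (x \<longlongrightarrow> l) (at_left t))"

text \<open>
  A library division of \<open>[s, t]\<close> may contain one-point intervals; they contribute \<open>0\<close> for \<open>c \<ge> 0\<close>.
\<close>

definition truncated_variation :: "real \<Rightarrow> (real \<Rightarrow> real) \<Rightarrow> real \<Rightarrow> real \<Rightarrow> ennreal" where
  "truncated_variation c x s t =
    (SUP \<pi>\<in>{\<pi>. \<pi> division_of {s..t}}. ennreal (\<Sum>I\<in>\<pi>. max (\<bar>x (Sup I) - x (Inf I)\<bar> - c) 0))"


subsection \<open>Crossings\<close>

text \<open>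
  Infima are taken in \<^typ>\<open>ereal\<close>, so that \<open>Inf {} = \<infinity>\<close>; no real \<open>u\<close> satisfies \<open>\<infinity> \<le> ereal u\<close>, so a
  search started at \<open>\<infinity>\<close> returns \<open>\<infinity>\<close>. In the notation of the paper, \<open>\<rho>_n = hit_above x y c t \<sigma>_n\<close>
  and \<open>\<sigma>_(n+1) = hit_below x y c t \<rho>_n\<close>.
\<close>

definition hit_above :: "(real \<Rightarrow> real) \<Rightarrow> real \<Rightarrow> real \<Rightarrow> real \<Rightarrow> ereal \<Rightarrow> ereal" where
  "hit_above x y c t a = Inf (ereal ` {u. a \<le> ereal u \<and> u \<le> t \<and> x u \<ge> y + c / 2})"

definition hit_below :: "(real \<Rightarrow> real) \<Rightarrow> real \<Rightarrow> real \<Rightarrow> real \<Rightarrow> ereal \<Rightarrow> ereal" where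
  "hit_below x y c t a = Inf (ereal ` {u. a \<le> ereal u \<and> u \<le> t \<and> x u < y - c / 2})"

primrec downcrossing_time ::
    "(real \<Rightarrow> real) \<Rightarrow> real \<Rightarrow> real \<Rightarrow> real \<Rightarrow> real \<Rightarrow> nat \<Rightarrow> ereal" where
  "downcrossing_time x y c s t 0 = ereal s"
| "downcrossing_time x y c s t (Suc n) =
     hit_below x y c t (hit_above x y c t (downcrossing_time x y c s t n))"

text \<open>
  For \<open>s \<le> t\<close> the set below contains \<open>0\<close>; it is finite if the path is cadlag and \<open>c > 0\<close>.
\<close>

definition downcrossings :: "real \<Rightarrow> real \<Rightarrow> (real \<Rightarrow> real) \<Rightarrow> real \<Rightarrow> real \<Rightarrow> nat" where
  "downcrossings y c x s t = Max {n. downcrossing_time x y c s t n \<le> ereal t}"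

definition upcrossings :: "real \<Rightarrow> real \<Rightarrow> (real \<Rightarrow> real) \<Rightarrow> real \<Rightarrow> real \<Rightarrow> nat" where
  "upcrossings y c x s t = downcrossings (- y) c (\<lambda>u. - x u) s t"

definition crossings :: "real \<Rightarrow> real \<Rightarrow> (real \<Rightarrow> real) \<Rightarrow> real \<Rightarrow> real \<Rightarrow> nat" where
  "crossings y c x s t = upcrossings y c x s t + downcrossings y c x s t"


subsection \<open>Processes\<close>

text \<open>Equality of distributions is equality of the laws on the product space of \<open>[0, \<infinity>)\<close>.\<close>

definition self_similar :: "'w measure \<Rightarrow> (real \<Rightarrow> 'w \<Rightarrow> real) \<Rightarrow> real \<Rightarrow> bool" where
  "self_similar M X \<beta> \<longleftrightarrow> (\<forall>A>0.
     distr M (\<Pi>\<^sub>M t\<in>{0..}. borel) (\<lambda>\<omega>. \<lambda>t\<in>{0..}. A powr (- \<beta>) * X (A * t) \<omega>) =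
     distr M (\<Pi>\<^sub>M t\<in>{0..}. borel) (\<lambda>\<omega>. \<lambda>t\<in>{0..}. X t \<omega>))"

definition stationary_increments :: "'w measure \<Rightarrow> (real \<Rightarrow> 'w \<Rightarrow> real) \<Rightarrow> bool" where
  "stationary_increments M X \<longleftrightarrow>
     (\<forall>(n::nat) (t :: nat \<Rightarrow> real) h. n \<ge> 1 \<and> 0 \<le> t 1 \<and> (\<forall>i\<in>{1..<n}. t i < t (i + 1)) \<and> h > 0 \<longrightarrow>
       distr M (\<Pi>\<^sub>M i\<in>{1..<n}. borel)
         (\<lambda>\<omega>. \<lambda>i\<in>{1..<n}. X (t (i + 1)) \<omega> - X (t i) \<omega>) =
       distr M (\<Pi>\<^sub>M i\<in>{1..<n}. borel)
         (\<lambda>\<omega>. \<lambda>i\<in>{1..<n}. X (t (i + 1) + h) \<omega> - X (t i + h) \<omega>))"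

text \<open>
  Ergodicity of a stationary sequence: shift-invariant events of the sequence space are trivial.
  Stationarity itself is not part of the definition.
\<close>

definition ergodic_sequence ::
    "'w measure \<Rightarrow> 'a measure \<Rightarrow> (nat \<Rightarrow> 'w \<Rightarrow> 'a) \<Rightarrow> bool" where
  "ergodic_sequence M N Y \<longleftrightarrow>
     (\<forall>A\<in>sets (\<Pi>\<^sub>M i\<in>UNIV. N).
        {z \<in> space (\<Pi>\<^sub>M i\<in>UNIV. N). (\<lambda>i. z (Suc i)) \<in> A} = A \<longrightarrow>
        measure M {\<omega> \<in> space M. (\<lambda>i. Y i \<omega>) \<in> A} \<in> {0, 1})"


subsection \<open>Local time\<close>

definition occupation_measure :: "(real \<Rightarrow> 'w \<Rightarrow> real) \<Rightarrow> real \<Rightarrow> 'w \<Rightarrow> real measure" where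
  "occupation_measure X t \<omega> = distr (restrict_space lborel {0..t}) borel (\<lambda>s. X s \<omega>)"

lemma emeasure_occupation_measure:
  assumes "(\<lambda>s. X s \<omega>) \<in> borel_measurable (restrict_space lborel {0..t})" "\<Gamma> \<in> sets borel"
  shows "emeasure (occupation_measure X t \<omega>) \<Gamma> = (\<integral>\<^sup>+s\<in>{0..t}. indicator \<Gamma> (X s \<omega>) \<partial>lborel)"
proof -
  have "emeasure (occupation_measure X t \<omega>) \<Gamma> =
      (\<integral>\<^sup>+z. indicator \<Gamma> z \<partial>occupation_measure X t \<omega>)"
    using assms(2) by (simp add: occupation_measure_def)
  also have "\<dots> = (\<integral>\<^sup>+s. indicator \<Gamma> (X s \<omega>) \<partial>restrict_space lborel {0..t})"
    unfolding occupation_measure_def using assms by (intro nn_integral_distr) auto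
  also have "\<dots> = (\<integral>\<^sup>+s\<in>{0..t}. indicator \<Gamma> (X s \<omega>) \<partial>lborel)"
    by (simp add: nn_integral_restrict_space)
  finally show ?thesis .
qed

definition has_local_time :: "'w measure \<Rightarrow> (real \<Rightarrow> 'w \<Rightarrow> real) \<Rightarrow> bool" where
  "has_local_time M X \<longleftrightarrow>
     (\<forall>t\<ge>0. AE \<omega> in M. absolutely_continuous lborel (occupation_measure X t \<omega>))"

text \<open>
  Determined up to Lebesgue-null sets of levels \<open>y\<close>, and meaningful only if the occupation measure
  is absolutely continuous.
\<close>

definition local_time :: "(real \<Rightarrow> 'w \<Rightarrow> real) \<Rightarrow> real \<Rightarrow> 'w \<Rightarrow> real \<Rightarrow> ennreal" where
  "local_time X t \<omega> = RN_deriv lborel (occupation_measure X t \<omega>)"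


text \<open>
  Weak convergence of finite, not necessarily normalised, measures. The library's \<^const>\<open>weak_conv_m\<close>
  compares distribution functions only at their continuity points and so, without a common total
  mass, would not detect mass escaping to infinity.
\<close>

definition weakly_converges :: "(nat \<Rightarrow> real measure) \<Rightarrow> real measure \<Rightarrow> bool" where
  "weakly_converges \<mu> \<nu> \<longleftrightarrow>
     (\<forall>n. finite_measure (\<mu> n)) \<and> finite_measure \<nu> \<and>
     (\<forall>f :: real \<Rightarrow> real. continuous_on UNIV f \<and> bounded (range f) \<longrightarrow>
        (\<lambda>n. \<integral>y. f y \<partial>\<mu> n) \<longlonglongrightarrow> (\<integral>y. f y \<partial>\<nu>))"

end

theory Submission
  imports Defs
begin

text \<open>
  The number of crossings satisfies the Banach indicatrix formula
  \<open>\<integral> n\<^sup>y\<^sup>,\<^sup>c(x, [s, t]) dy = TV\<^sup>c(x, [s, t])\<close>: crossings are superadditive in the interval, which gives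
  \<open>\<ge>\<close>, and \<open>\<le>\<close> follows by counting level crossings of a path of variation at most \<open>TV\<^sup>c\<close> that stays
  within \<open>c/2\<close> of (a step approximation of) \<open>x\<close>.

  Since \<open>TV\<^sup>1(X, [0, T])\<close> differs from a sum over blocks of length \<open>k\<close> by at most the number of blocks,
  the ergodic theorem for the block sequences gives \<open>TV\<^sup>1(X, [0, T])/T \<rightarrow> C\<close> almost surely. By
  self-similarity \<open>c\<^bsup>1/\<beta>-1\<^esup> TV\<^sup>c(X, [0, t])\<close> has the law of \<open>TV\<^sup>1(X, [0, At])/A\<close> with \<open>A = c\<^bsup>-1/\<beta>\<^esup>\<close>,
  hence tends to \<open>C t\<close> in probability, and almost surely along a sequence \<open>c\<^sub>n\<close>, for all \<open>t\<close> at once.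

  It remains to localise. In the limit the total mass \<open>c\<^bsup>1/\<beta>-1\<^esup> TV\<^sup>c\<close> is additive in the interval, so
  splitting an interval loses no crossings in the limit, and on a short interval where the path is
  close to \<open>a\<close> all crossings have level close to \<open>a\<close>. Thus the limit measure is \<open>C\<close> times the occupation
  measure.
\<close>

section \<open>Truncated variation\<close>

text \<open>Three obstacles shape the proof. A cadlag path has no modulus of continuity, so it is
  first replaced by a step function with error \<open>\<epsilon>\<close>; the counting bound then
  concerns crossings of width \<open>c + 2 * \<epsilon>\<close>, and convexity of the truncated
  variation in \<open>c\<close> removes the \<open>\<epsilon>\<close>. Jumps return in the
  localisation: just before a jump the path is near its left limit, but not at the jump itself, so a
  short piece is cut off there and paid for by a bound proportional to its length.

  Blocks of one length \<open>k\<close> determine the growth rate only up to \<open>1 / k\<close>,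
  because each cut costs up to the threshold 1. Hence ergodicity is used for every \<open>k\<close>,
  and the rate is identified through the expectations.

  Self-similarity equates laws for one threshold at a time and so cannot carry over an almost sure
  limit. It does carry over convergence in probability to a constant, which is why a sequence has to
  be chosen. It is chosen once for all rational times; monotonicity in \<open>t\<close> and
  additivity up to \<open>c\<close> do the rest.\<close>

lemma SUP_add_le_ennreal:
  fixes f :: "'i \<Rightarrow> ennreal" and g :: "'j \<Rightarrow> ennreal"
  assumes "I \<noteq> {}" "J \<noteq> {}" "\<And>i j. i \<in> I \<Longrightarrow> j \<in> J \<Longrightarrow> f i + g j \<le> B"
  shows "(SUP i\<in>I. f i) + (SUP j\<in>J. g j) \<le> B"
  using assms
  by (auto simp: ennreal_SUP_add_right ennreal_SUP_add_left[symmetric] intro!: SUP_least)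

text \<open>Lists of times replace divisions because they can be concatenated, extended point by
  point and mapped along a change of time. The entries have an arbitrary type since chains of grid
  indices occur as well.\<close>

fun truncated_sum :: "real \<Rightarrow> ('a \<Rightarrow> real) \<Rightarrow> 'a list \<Rightarrow> real" where
  "truncated_sum c x (a # b # ts) = max (\<bar>x b - x a\<bar> - c) 0 + truncated_sum c x (b # ts)"
| "truncated_sum c x _ = 0"

lemma truncated_sum_nonneg: "truncated_sum c x ts \<ge> 0"
  by (induction c x ts rule: truncated_sum.induct) auto

lemma truncated_sum_snoc: "truncated_sum c x (ts @ [a, b]) = truncated_sum c x (ts @ [a]) + max (\<bar>x b - x a\<bar> - c) 0"
  by (induction c x ts rule: truncated_sum.induct) auto

text \<open>Joining two nonempty lists adds one nonnegative term, the increment across the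
  junction.\<close>

lemma truncated_sum_append_ge: "truncated_sum c x (xs @ ys) \<ge> truncated_sum c x xs + truncated_sum c x ys"
proof (induction c x xs rule: truncated_sum.induct)
  case ("2_2" c x v)
  then show ?case by (cases ys) auto
qed auto

lemma truncated_sum_map: "truncated_sum c x (map p ts) = truncated_sum c (\<lambda>k. x (p k)) ts"
  by (induction c "\<lambda>k. x (p k)" ts rule: truncated_sum.induct) auto

lemma truncated_sum_cong: "(\<And>u. u \<in> set ts \<Longrightarrow> x u = y u) \<Longrightarrow> truncated_sum c x ts = truncated_sum c y ts"
  by (induction c x ts rule: truncated_sum.induct) auto

lemma truncated_sum_scale:
  assumes "A \<ge> 0"
  shows "truncated_sum (A * c) (\<lambda>u. A * x u) ts = A * truncated_sum c x ts"
proof (induction c x ts rule: truncated_sum.induct)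
  case (1 c x a b ts)
  have "\<bar>A * x b - A * x a\<bar> - A * c = A * (\<bar>x b - x a\<bar> - c)"
    using assms by (metis abs_mult abs_of_nonneg right_diff_distrib)
  then have "max (\<bar>A * x b - A * x a\<bar> - A * c) 0 = A * max (\<bar>x b - x a\<bar> - c) 0"
    using assms by (simp add: max_mult_distrib_left)
  with 1 show ?case by (simp add: distrib_left)
qed auto

text \<open>Every summand \<open>max (d - c) 0\<close> is convex in \<open>c\<close>. Convexity will
  stand in for continuity of the truncated variation in the threshold.\<close>

lemma truncated_sum_convex:
  assumes "0 \<le> l" "l \<le> 1"
  shows "truncated_sum (l * a + (1 - l) * b) x ts \<le> l * truncated_sum a x ts + (1 - l) * truncated_sum b x ts"
proof (induction ts rule: induct_list012)
  case (3 u v ts)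
  let ?d = "\<bar>x v - x u\<bar>"
  have "?d - (l * a + (1 - l) * b) = l * (?d - a) + (1 - l) * (?d - b)"
    by (simp add: algebra_simps)
  also have "\<dots> \<le> l * max (?d - a) 0 + (1 - l) * max (?d - b) 0"
    using assms by (intro add_mono mult_left_mono) auto
  finally have "max (?d - (l * a + (1 - l) * b)) 0
      \<le> l * max (?d - a) 0 + (1 - l) * max (?d - b) 0"
    using assms by simp
  with 3(2) show ?case by (simp add: distrib_left algebra_simps)
qed auto

definition time_chains :: "real \<Rightarrow> real \<Rightarrow> real list set" where
  "time_chains s t = {ts. sorted ts \<and> (\<forall>u\<in>set ts. s \<le> u \<and> u \<le> t)}"

text \<open>A division is an unordered set, so the order has to be recovered: the interval with the
  largest right end point is split off, the others lie to its left, and gaps are filled for free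
  because \<open>N\<close> takes values in \<open>ennreal\<close>.\<close>

lemma superadditive_division_sum_le:
  fixes N :: "real \<Rightarrow> real \<Rightarrow> ennreal"
  assumes "finite \<I>"
    and "\<And>a b d. s \<le> a \<Longrightarrow> a \<le> b \<Longrightarrow> b \<le> d \<Longrightarrow> N a b + N b d \<le> N a d"
    and "\<And>I. I \<in> \<I> \<Longrightarrow> \<exists>a b. a < b \<and> I = {a..b} \<and> s \<le> a \<and> b \<le> t"
    and "\<And>I J. I \<in> \<I> \<Longrightarrow> J \<in> \<I> \<Longrightarrow> I \<noteq> J \<Longrightarrow> interior I \<inter> interior J = {}"
    and "s \<le> t"
  shows "(\<Sum>I\<in>\<I>. N (Inf I) (Sup I)) \<le> N s t"
  using assms
proof (induction "card \<I>" arbitrary: \<I> t)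
  case 0
  then show ?case by simp
next
  case (Suc n)
  from Suc have ne: "\<I> \<noteq> {}" by auto
  have "Max (Sup ` \<I>) \<in> Sup ` \<I>"
    using ne Suc by (intro Max_in) auto
  then obtain I where I: "I \<in> \<I>" "Sup I = Max (Sup ` \<I>)" by auto
  have max: "Sup J \<le> Sup I" if "J \<in> \<I>" for J
    using that Suc I by auto
  obtain a b where ab: "a < b" "I = {a..b}" "s \<le> a" "b \<le> t"
    using Suc.prems(3)[OF I(1)] by blast
  have left: "\<exists>a' b'. a' < b' \<and> J = {a'..b'} \<and> s \<le> a' \<and> b' \<le> a" if J: "J \<in> \<I> - {I}" for J
  proof -
    obtain a' b' where ab': "a' < b'" "J = {a'..b'}" "s \<le> a'" "b' \<le> t"
      using Suc.prems(3)[of J] J by blast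
    have "b' \<le> b" using max[of J] J ab ab' by simp
    have "interior I \<inter> interior J = {}"
      using Suc.prems(4)[of I J] J I by blast
    then have "{a<..<b} \<inter> {a'<..<b'} = {}"
      unfolding ab(2) ab'(2) interior_atLeastAtMost_real .
    \<comment> \<open>The midpoint of an overlap would be interior to both intervals.\<close>
    moreover have "(max a a' + b') / 2 \<in> {a<..<b} \<inter> {a'<..<b'}" if "b' > a"
      using that \<open>b' \<le> b\<close> ab ab' by auto
    ultimately have "b' \<le> a" by (metis empty_iff not_le)
    with ab' show ?thesis by blast
  qed
  have "(\<Sum>J\<in>\<I> - {I}. N (Inf J) (Sup J)) \<le> N s a"
  proof (rule Suc.hyps(1))
    show "n = card (\<I> - {I})" using Suc I by simp
  qed (use Suc.prems left ab in auto)
  then have "(\<Sum>J\<in>\<I>. N (Inf J) (Sup J)) \<le> N s a + N a b"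
    using I Suc ab by (subst sum.remove[of _ I]) (auto simp: add.commute)
  also have "\<dots> \<le> N s b"
    using ab by (intro Suc.prems(2)) auto
  also have "\<dots> \<le> N s b + N b t" by simp
  also have "\<dots> \<le> N s t"
    using ab by (intro Suc.prems(2)) auto
  finally show ?case .
qed

lemma truncated_variation_lower:
  assumes "c \<ge> 0" "s \<le> t"
  shows "ennreal (max (\<bar>x t - x s\<bar> - c) 0) \<le> truncated_variation c x s t"
  unfolding truncated_variation_def
proof (rule SUP_upper2)
  show "{{s..t}} \<in> {\<pi>. \<pi> division_of {s..t}}"
    using assms division_of_self[of s t] by auto
qed (use assms in auto)

lemma truncated_variation_superadd:
  assumes "c \<ge> 0" "s \<le> r" "r \<le> t"
  shows "truncated_variation c x s r + truncated_variation c x r t \<le> truncated_variation c x s t"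
proof -
  let ?g = "\<lambda>I. max (\<bar>x (Sup I) - x (Inf I)\<bar> - c) 0"
  have "ennreal (sum ?g p) + ennreal (sum ?g q) \<le> truncated_variation c x s t"
    if p: "p division_of {s..r}" and q: "q division_of {r..t}" for p q
  proof -
    have fin: "finite p" "finite q" using p q by (auto dest: division_ofD)
    have "interior {s..r} \<inter> interior {r..t} = {}" by (simp add: interior_atLeastAtMost_real)
    then have "(p \<union> q) division_of ({s..r} \<union> {r..t})"
      by (rule division_disjoint_union[OF p q])
    moreover have "{s..r} \<union> {r..t} = {s..t}" using assms by auto
    ultimately have pq: "(p \<union> q) division_of {s..t}" by simp
    \<comment> \<open>Both divisions may contain the one-point interval \<open>{r}\<close>, which
      the union counts only once; its term is 0 because \<open>c \<ge> 0\<close>.\<close>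
    have "?g I = 0" if "I \<in> p \<inter> q" for I
    proof -
      have "I \<subseteq> {r}" "I \<noteq> {}"
        using that p q division_ofD(2,3)[OF p, of I] division_ofD(2,3)[OF q, of I] by fastforce+
      then have "I = {r}" by auto
      then show ?thesis using assms by simp
    qed
    then have "sum ?g p + sum ?g q = sum ?g (p \<union> q)"
      using sum.union_inter[OF fin, of ?g] by simp
    then show ?thesis
      using pq unfolding truncated_variation_def
      by (subst ennreal_plus[symmetric]) (auto intro!: sum_nonneg SUP_upper2[of "p \<union> q"])
  qed
  moreover have "{\<pi>. \<pi> division_of {a..b}} \<noteq> {}" if "a \<le> b" for a b :: real
    using that division_of_self[of a b] by auto
  ultimately show ?thesis
    using assms unfolding truncated_variation_def[of c x s r] truncated_variation_def[of c x r t]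
    by (intro SUP_add_le_ennreal) auto
qed

lemma truncated_variation_mono:
  assumes "c \<ge> 0" "s \<le> s'" "s' \<le> t'" "t' \<le> t"
  shows "truncated_variation c x s' t' \<le> truncated_variation c x s t"
proof -
  have "truncated_variation c x s' t' \<le> truncated_variation c x s s' + truncated_variation c x s' t'"
    by simp
  also have "\<dots> \<le> truncated_variation c x s t'"
    using assms by (intro truncated_variation_superadd) auto
  also have "\<dots> \<le> truncated_variation c x s t' + truncated_variation c x t' t" by simp
  also have "\<dots> \<le> truncated_variation c x s t"
    using assms by (intro truncated_variation_superadd) auto
  finally show ?thesis .
qed

lemma truncated_sum_le_superadditive:
  fixes N :: "real \<Rightarrow> real \<Rightarrow> ennreal"
  assumes "\<And>a b d. s \<le> a \<Longrightarrow> a \<le> b \<Longrightarrow> b \<le> d \<Longrightarrow> N a b + N b d \<le> N a d"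
    and "\<And>a b. s \<le> a \<Longrightarrow> a \<le> b \<Longrightarrow> b \<le> t \<Longrightarrow> ennreal (max (\<bar>x b - x a\<bar> - c) 0) \<le> N a b"
    and "ts \<in> time_chains s t"
  shows "ennreal (truncated_sum c x ts) \<le> N s t"
  using assms
proof (induction c x ts arbitrary: s rule: truncated_sum.induct)
  case (1 c x a b ts)
  have sab: "s \<le> a" "a \<le> b" "b \<le> t" and b: "b # ts \<in> time_chains b t"
    using "1.prems"(3) by (auto simp: time_chains_def)
  have *: "ennreal (truncated_sum c x (b # ts)) \<le> N b t"
    using 1(1)[of b] sab b 1(2,3) by simp
  have "ennreal (truncated_sum c x (a # b # ts)) = ennreal (max (\<bar>x b - x a\<bar> - c) 0) + ennreal (truncated_sum c x (b # ts))"
    by (simp add: truncated_sum_nonneg)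
  also have "\<dots> \<le> N a b + N b t"
    using sab by (intro add_mono * 1) auto
  also have "\<dots> \<le> N a t" using sab by (intro 1) auto
  also have "\<dots> \<le> N s a + N a t" by simp
  also have "\<dots> \<le> N s t" using sab by (intro 1) auto
  finally show ?case .
qed auto

lemma truncated_sum_le_truncated_variation:
  assumes "c \<ge> 0" "ts \<in> time_chains s t"
  shows "ennreal (truncated_sum c x ts) \<le> truncated_variation c x s t"
  using assms
  by (intro truncated_sum_le_superadditive[where s=s and t=t] truncated_variation_superadd truncated_variation_lower) auto

text \<open>Together with \<open>truncated_variation_superadd\<close> and
  \<open>truncated_variation_lower\<close> this makes the truncated variation the least
  superadditive interval function above the truncated single increments. It is applied to suprema
  over chains and to the mass of crossings.\<close>

lemma truncated_variation_le_superadditive: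
  fixes N :: "real \<Rightarrow> real \<Rightarrow> ennreal"
  assumes "c \<ge> 0" "s \<le> t"
    and "\<And>a b d. s \<le> a \<Longrightarrow> a \<le> b \<Longrightarrow> b \<le> d \<Longrightarrow> N a b + N b d \<le> N a d"
    and "\<And>a b. s \<le> a \<Longrightarrow> a \<le> b \<Longrightarrow> b \<le> t \<Longrightarrow> ennreal (max (\<bar>x b - x a\<bar> - c) 0) \<le> N a b"
  shows "truncated_variation c x s t \<le> N s t"
  unfolding truncated_variation_def
proof (rule SUP_least)
  fix \<pi> assume "\<pi> \<in> {\<pi>. \<pi> division_of {s..t}}"
  then have \<pi>: "\<pi> division_of {s..t}" by simp
  note d = division_ofD[OF \<pi>]
  \<comment> \<open>One-point intervals have to go, since the ordering argument needs nondegenerate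
    ones; their terms vanish.\<close>
  define \<I> where "\<I> = {I \<in> \<pi>. Inf I < Sup I}"
  have shape: "\<exists>a b. a \<le> b \<and> I = {a..b} \<and> s \<le> a \<and> b \<le> t" if "I \<in> \<pi>" for I
  proof -
    obtain a b where "I = {a..b}" using d(4)[OF \<open>I \<in> \<pi>\<close>] by auto
    with d(2,3)[OF \<open>I \<in> \<pi>\<close>] show ?thesis by (auto simp: atLeastatMost_subset_iff)
  qed
  have "ennreal (\<Sum>I\<in>\<pi>. max (\<bar>x (Sup I) - x (Inf I)\<bar> - c) 0)
      = ennreal (\<Sum>I\<in>\<I>. max (\<bar>x (Sup I) - x (Inf I)\<bar> - c) 0)"
    using d(1) assms(1)
  proof (intro arg_cong[where f=ennreal] sum.mono_neutral_right ballI)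
    fix I assume "I \<in> \<pi> - \<I>"
    with shape[of I] show "max (\<bar>x (Sup I) - x (Inf I)\<bar> - c) 0 = 0"
      using assms(1) by (auto simp: \<I>_def)
  qed (auto simp: \<I>_def)
  also have "\<dots> = (\<Sum>I\<in>\<I>. ennreal (max (\<bar>x (Sup I) - x (Inf I)\<bar> - c) 0))"
    by (subst sum_ennreal) auto
  also have "\<dots> \<le> (\<Sum>I\<in>\<I>. N (Inf I) (Sup I))"
  proof (rule sum_mono)
    fix I assume "I \<in> \<I>"
    then obtain a b where "a \<le> b" "I = {a..b}" "s \<le> a" "b \<le> t"
      using shape[of I] by (auto simp: \<I>_def)
    then show "ennreal (max (\<bar>x (Sup I) - x (Inf I)\<bar> - c) 0) \<le> N (Inf I) (Sup I)"
      using assms(4) by simp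
  qed
  also have "\<dots> \<le> N s t"
  proof (rule superadditive_division_sum_le[where t=t])
    show "finite \<I>" using d(1) by (simp add: \<I>_def)
    show "\<exists>a b. a < b \<and> I = {a..b} \<and> s \<le> a \<and> b \<le> t" if I: "I \<in> \<I>" for I
    proof -
      from I shape[of I] obtain a b where "a \<le> b" "I = {a..b}" "s \<le> a" "b \<le> t"
        by (auto simp: \<I>_def)
      with I show ?thesis by (auto simp: \<I>_def)
    qed
    show "interior I \<inter> interior J = {}" if "I \<in> \<I>" "J \<in> \<I>" "I \<noteq> J" for I J
      using that d(5) by (auto simp: \<I>_def)
  qed (use assms in auto)
  finally show "ennreal (\<Sum>I\<in>\<pi>. max (\<bar>x (Sup I) - x (Inf I)\<bar> - c) 0) \<le> N s t" .
qed

lemma truncated_variation_eq_chains: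
  assumes "c \<ge> 0" "s \<le> t"
  shows "truncated_variation c x s t = (SUP ts\<in>time_chains s t. ennreal (truncated_sum c x ts))"
proof (rule antisym)
  let ?N = "\<lambda>s t. SUP ts\<in>time_chains s t. ennreal (truncated_sum c x ts)"
  have ne: "time_chains a b \<noteq> {}" for a b by (auto simp: time_chains_def intro!: exI[of _ "[]"])
  show "truncated_variation c x s t \<le> ?N s t"
  proof (rule truncated_variation_le_superadditive[OF assms])
    fix a b d :: real assume abd: "a \<le> b" "b \<le> d"
    have "ennreal (truncated_sum c x ts) + ennreal (truncated_sum c x us) \<le> ?N a d"
      if "ts \<in> time_chains a b" "us \<in> time_chains b d" for ts us
    proof -
      have "ts @ us \<in> time_chains a d"
        using that abd by (fastforce simp: time_chains_def sorted_append)
      moreover have "ennreal (truncated_sum c x ts) + ennreal (truncated_sum c x us) \<le> ennreal (truncated_sum c x (ts @ us))"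
        by (subst ennreal_plus[symmetric]) (auto intro: truncated_sum_nonneg truncated_sum_append_ge ennreal_leI)
      ultimately show ?thesis by (rule SUP_upper2)
    qed
    then show "?N a b + ?N b d \<le> ?N a d"
      using ne by (intro SUP_add_le_ennreal) auto
  next
    fix a b :: real assume "a \<le> b"
    then show "ennreal (max (\<bar>x b - x a\<bar> - c) 0) \<le> ?N a b"
      by (intro SUP_upper2[of "[a, b]"]) (auto simp: time_chains_def)
  qed
  show "?N s t \<le> truncated_variation c x s t"
    using assms by (intro SUP_least truncated_sum_le_truncated_variation)
qed

text \<open>At most one step of a chain jumps over \<open>r\<close>. Inserting \<open>r\<close>
  there splits its increment by the triangle inequality and subtracts the threshold twice instead of
  once, which costs at most \<open>c\<close>.\<close>

lemma truncated_variation_subadd: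
  assumes "c \<ge> 0" "s \<le> r" "r \<le> t"
  shows "truncated_variation c x s t
    \<le> truncated_variation c x s r + truncated_variation c x r t + ennreal c"
proof -
  let ?T = "truncated_variation c x"
  have cons: "ennreal (truncated_sum c x (a # ts)) \<le> ?T a r + ?T r t + ennreal c"
    if "a # ts \<in> time_chains s t" "a \<le> r" for a ts
    using that
  proof (induction ts arbitrary: a)
    case (Cons b ts)
    let ?g = "\<lambda>u v. max (\<bar>x v - x u\<bar> - c) 0"
    have ab: "a \<le> b" "b \<le> t" "b # ts \<in> time_chains s t"
      using Cons.prems by (auto simp: time_chains_def)
    have eq: "ennreal (truncated_sum c x (a # b # ts)) = ennreal (?g a b) + ennreal (truncated_sum c x (b # ts))"
      by (simp add: truncated_sum_nonneg)
    show ?case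
    proof (cases "b \<le> r")
      case True
      have "ennreal (truncated_sum c x (a # b # ts)) \<le> ?T a b + (?T b r + ?T r t + ennreal c)"
        unfolding eq using Cons.IH[OF ab(3) True] ab assms
        by (intro add_mono truncated_variation_lower) auto
      also have "\<dots> = (?T a b + ?T b r) + ?T r t + ennreal c" by (simp add: add.assoc)
      also have "\<dots> \<le> ?T a r + ?T r t + ennreal c"
        using True ab assms by (intro add_mono truncated_variation_superadd) auto
      finally show ?thesis .
    next
      case False
      have "truncated_sum c x (a # b # ts) \<le> ?g a r + truncated_sum c x (r # b # ts) + c"
        using assms by auto
      then have "ennreal (truncated_sum c x (a # b # ts)) \<le> ennreal (?g a r + truncated_sum c x (r # b # ts) + c)"
        by (rule ennreal_leI)
      also have "\<dots> = ennreal (?g a r) + ennreal (truncated_sum c x (r # b # ts)) + ennreal c"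
        using assms truncated_sum_nonneg[of c x "r # b # ts"] by (subst ennreal_plus, simp, simp, subst ennreal_plus) auto
      also have "r # b # ts \<in> time_chains r t"
        using ab False assms by (auto simp: time_chains_def)
      then have "ennreal (?g a r) + ennreal (truncated_sum c x (r # b # ts)) + ennreal c \<le> ?T a r + ?T r t + ennreal c"
        using Cons.prems assms
        by (intro add_mono truncated_variation_lower truncated_sum_le_truncated_variation) auto
      finally show ?thesis .
    qed
  qed auto
  then have *: "ennreal (truncated_sum c x ts) \<le> ?T s r + ?T r t + ennreal c" if "ts \<in> time_chains s t" for ts
  proof -
    \<comment> \<open>Prepending \<open>s\<close> loses nothing and provides a head that is at most
      \<open>r\<close>.\<close>
    have "ennreal (truncated_sum c x ts) \<le> ennreal (truncated_sum c x ([s] @ ts))"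
      using truncated_sum_append_ge[of c x "[s]" ts] by (intro ennreal_leI) simp
    also have "\<dots> \<le> ?T s r + ?T r t + ennreal c"
      using that assms cons[of s ts] by (auto simp: time_chains_def)
    finally show ?thesis .
  qed
  show ?thesis
    using assms by (subst truncated_variation_eq_chains) (auto intro!: SUP_least *)
qed

lemma truncated_variation_self:
  assumes "c \<ge> 0"
  shows "truncated_variation c x s s = 0"
proof -
  have "truncated_sum c x ts = 0" if "\<forall>u\<in>set ts. s \<le> u \<and> u \<le> s" for ts
    using that by (induction ts rule: induct_list012) (auto simp: assms)
  then have "ennreal (truncated_sum c x ts) = 0" if "ts \<in> time_chains s s" for ts
    using that by (simp add: time_chains_def)
  then have "(SUP ts\<in>time_chains s s. ennreal (truncated_sum c x ts)) \<le> 0"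
    by (intro SUP_least) simp
  then show ?thesis
    unfolding truncated_variation_eq_chains[OF assms order_refl] by simp
qed

section \<open>Scaling, time shift and convexity in the threshold\<close>

lemma truncated_variation_scale:
  assumes "c \<ge> 0" "s \<le> t" "A > 0" "B > 0"
  shows "truncated_variation (A * c) (\<lambda>u. A * x (B * u)) s t
    = ennreal A * truncated_variation c x (B * s) (B * t)"
proof -
  have bij: "(\<lambda>ts. map ((*) B) ts) ` time_chains s t = time_chains (B * s) (B * t)"
  proof (intro antisym subsetI)
    fix us assume "us \<in> time_chains (B * s) (B * t)"
    then have "map ((*) (1 / B)) us \<in> time_chains s t"
      using \<open>B > 0\<close> unfolding time_chains_def
      by (auto simp: sorted_map field_simps intro: sorted_wrt_mono_rel)
    moreover have "us = map ((*) B) (map ((*) (1 / B)) us)"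
      using \<open>B > 0\<close> by (simp add: o_def)
    ultimately show "us \<in> map ((*) B) ` time_chains s t" by blast
  next
    fix us assume "us \<in> map ((*) B) ` time_chains s t"
    then show "us \<in> time_chains (B * s) (B * t)"
      using \<open>B > 0\<close> unfolding time_chains_def by (auto simp: sorted_map intro: sorted_wrt_mono_rel)
  qed
  have "truncated_variation (A * c) (\<lambda>u. A * x (B * u)) s t
      = (SUP ts\<in>time_chains s t. ennreal A * ennreal (truncated_sum c x (map ((*) B) ts)))"
    using assms truncated_sum_scale[of A c "\<lambda>u. x (B * u)"]
    by (subst truncated_variation_eq_chains) (auto simp: truncated_sum_map ennreal_mult truncated_sum_nonneg)
  also have "\<dots> = ennreal A * (SUP ts\<in>time_chains s t. ennreal (truncated_sum c x (map ((*) B) ts)))"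
    by (simp add: SUP_mult_left_ennreal)
  also have "(SUP ts\<in>time_chains s t. ennreal (truncated_sum c x (map ((*) B) ts)))
      = (SUP us\<in>time_chains (B * s) (B * t). ennreal (truncated_sum c x us))"
    by (simp add: bij[symmetric] image_comp)
  also have "\<dots> = truncated_variation c x (B * s) (B * t)"
    using assms by (subst truncated_variation_eq_chains) auto
  finally show ?thesis .
qed

lemma truncated_variation_shift:
  assumes "c \<ge> 0" "s \<le> t"
  shows "truncated_variation c (\<lambda>u. x (u + h) - a) s t = truncated_variation c x (s + h) (t + h)"
proof -
  have im: "(\<lambda>ts. map (\<lambda>u. u + h) ts) ` time_chains s t = time_chains (s + h) (t + h)"
  proof (intro antisym subsetI)
    fix us assume "us \<in> time_chains (s + h) (t + h)"
    then have "map (\<lambda>u. u - h) us \<in> time_chains s t"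
      unfolding time_chains_def by (auto simp: sorted_map field_simps)
    moreover have "us = map (\<lambda>u. u + h) (map (\<lambda>u. u - h) us)"
      by (simp add: o_def)
    ultimately show "us \<in> map (\<lambda>u. u + h) ` time_chains s t" by blast
  qed (auto simp: time_chains_def sorted_map)
  have "truncated_sum c (\<lambda>u. x (u + h) - a) ts = truncated_sum c x (map (\<lambda>u. u + h) ts)" for ts
    by (induction ts rule: induct_list012) auto
  then show ?thesis
    using assms by (simp add: truncated_variation_eq_chains im[symmetric] image_comp)
qed

lemma truncated_variation_convex:
  assumes "0 \<le> l" "l \<le> 1" "a \<ge> 0" "b \<ge> 0" "s \<le> t"
  shows "truncated_variation (l * a + (1 - l) * b) x s t
    \<le> ennreal l * truncated_variation a x s t + ennreal (1 - l) * truncated_variation b x s t"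
proof -
  have "ennreal (truncated_sum (l * a + (1 - l) * b) x ts)
      \<le> ennreal l * truncated_variation a x s t + ennreal (1 - l) * truncated_variation b x s t"
    if "ts \<in> time_chains s t" for ts
  proof -
    have "ennreal (truncated_sum (l * a + (1 - l) * b) x ts)
        \<le> ennreal (l * truncated_sum a x ts + (1 - l) * truncated_sum b x ts)"
      using assms by (intro ennreal_leI truncated_sum_convex) auto
    also have "\<dots> = ennreal l * ennreal (truncated_sum a x ts) + ennreal (1 - l) * ennreal (truncated_sum b x ts)"
      using assms by (simp add: ennreal_mult truncated_sum_nonneg)
    also have "\<dots> \<le> ennreal l * truncated_variation a x s t + ennreal (1 - l) * truncated_variation b x s t"
      using assms that by (intro add_mono mult_left_mono truncated_sum_le_truncated_variation) auto
    finally show ?thesis .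
  qed
  then show ?thesis
    using assms by (subst truncated_variation_eq_chains) (auto intro!: SUP_least)
qed

lemma tendsto_truncated_sum:
  assumes "\<And>a. a \<in> set ts \<Longrightarrow> ((\<lambda>n. y n a) \<longlongrightarrow> x a) F"
  shows "((\<lambda>n. truncated_sum c (y n) ts) \<longlongrightarrow> truncated_sum c x ts) F"
  using assms
proof (induction ts rule: induct_list012)
  case (3 u v ts)
  then show ?case
    unfolding truncated_sum.simps by (intro tendsto_intros tendsto_max) auto
qed auto

section \<open>Downcrossings\<close>

text \<open>
  The points of \<open>S\<close> outside its interior are right end points of disjoint intervals, hence countably many.
\<close>

lemma left_open_borel:
  fixes S :: "real set"
  assumes "\<And>y. y \<in> S \<Longrightarrow> \<exists>e<y. {e<..y} \<subseteq> S"
  shows "S \<in> sets borel"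
proof -
  define E where "E = S - interior S"
  have "\<exists>q::rat. real_of_rat q < p \<and> {real_of_rat q<..<p} \<subseteq> interior S" if p: "p \<in> E" for p
  proof -
    obtain e where e: "e < p" "{e<..p} \<subseteq> S" using assms[of p] p by (auto simp: E_def)
    obtain q where q: "e < real_of_rat q" "real_of_rat q < p" using of_rat_dense[OF e(1)] by blast
    have "{real_of_rat q<..<p} \<subseteq> interior S"
      using q e by (intro interior_maximal) (auto simp: subset_eq)
    with q show ?thesis by blast
  qed
  then obtain q :: "real \<Rightarrow> rat"
    where q: "real_of_rat (q p) < p" "{real_of_rat (q p)<..<p} \<subseteq> interior S" if "p \<in> E" for p
    by metis
  have "\<not> p < p'" if "p \<in> E" "p' \<in> E" "q p = q p'" for p p'
  proof
    assume "p < p'"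
    then have "p \<in> {real_of_rat (q p')<..<p'}"
      using q(1)[OF that(1)] that(3) by simp
    with q(2)[OF that(2)] that(1) show False by (auto simp: E_def)
  qed
  then have "inj_on q E"
    by (intro inj_onI) (metis linorder_neqE)
  then have "countable E"
    by (rule countable_image_inj_on[rotated]) simp
  then have "E \<in> sets borel" by (rule sets.countable[rotated]) simp
  moreover have "S = E \<union> interior S" using interior_subset by (auto simp: E_def)
  ultimately show ?thesis by (metis borel_open open_interior sets.Un)
qed

text \<open>
  The level-dependent quantities \<open>lo = y - c/2\<close> and \<open>hi = y + c/2\<close> are kept apart from the recursion,
  which peels off the \<^emph>\<open>last\<close> downcrossing.
\<close>

primrec downcrosses :: "(real \<Rightarrow> real) \<Rightarrow> real \<Rightarrow> real \<Rightarrow> real \<Rightarrow> real \<Rightarrow> nat \<Rightarrow> bool" where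
  "downcrosses x lo hi s t 0 \<longleftrightarrow> s \<le> t"
| "downcrosses x lo hi s t (Suc n) \<longleftrightarrow>
     (\<exists>u v. s \<le> u \<and> u \<le> v \<and> v \<le> t \<and> hi \<le> x u \<and> x v < lo \<and> downcrosses x lo hi s u n)"

lemma downcrosses_le: "downcrosses x lo hi s t n \<Longrightarrow> s \<le> t"
  by (cases n) auto

lemma downcrosses_mono: "downcrosses x lo hi s r n \<Longrightarrow> r \<le> t \<Longrightarrow> downcrosses x lo hi s t n"
  by (cases n) (auto intro: order_trans)

lemma downcrosses_Suc_imp: "downcrosses x lo hi s t (Suc n) \<Longrightarrow> downcrosses x lo hi s t n"
  by (auto intro: downcrosses_mono)

lemma downcrosses_antimono: "downcrosses x lo hi s t n \<Longrightarrow> m \<le> n \<Longrightarrow> downcrosses x lo hi s t m"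
proof (induction n)
  case (Suc n)
  then show ?case
    using downcrosses_Suc_imp[OF Suc.prems(1)] by (cases "m = Suc n") auto
qed auto

lemma downcrosses_add:
  "downcrosses x lo hi s r m \<Longrightarrow> downcrosses x lo hi r t n \<Longrightarrow> downcrosses x lo hi s t (m + n)"
proof (induction n arbitrary: t)
  case 0
  then show ?case by (auto intro: downcrosses_mono)
next
  case (Suc n)
  from Suc.prems(2) obtain u v where uv: "r \<le> u" "u \<le> v" "v \<le> t" "hi \<le> x u" "x v < lo"
    "downcrosses x lo hi r u n" by auto
  then have "downcrosses x lo hi s u (m + n)" using Suc by blast
  with uv downcrosses_le[OF Suc.prems(1)] show ?case
    unfolding add_Suc_right downcrosses.simps by (meson order_trans)
qed

text \<open>Lowering the level preserves the non-strict \<open>y + h \<le> x u\<close>, and the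
  strict \<open>x v < y - h\<close> survives a small decrease. This asymmetry is why openness holds
  only to the left.\<close>

lemma downcrosses_left_open:
  assumes "downcrosses x (y - h) (y + h) s t n"
  shows "\<exists>e<y. \<forall>y'\<in>{e<..y}. downcrosses x (y' - h) (y' + h) s t n"
  using assms
proof (induction n arbitrary: t)
  case 0
  then show ?case by (auto intro!: exI[of _ "y - 1"])
next
  case (Suc n)
  then obtain u v where uv: "s \<le> u" "u \<le> v" "v \<le> t" "y + h \<le> x u" "x v < y - h"
    "downcrosses x (y - h) (y + h) s u n" by auto
  from Suc.IH[OF uv(6)] obtain e where e: "e < y" "\<forall>y'\<in>{e<..y}. downcrosses x (y' - h) (y' + h) s u n"
    by blast
  show ?case
  proof (intro exI[of _ "max e (x v + h)"] conjI ballI)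
    fix y' assume "y' \<in> {max e (x v + h)<..y}"
    with uv e have "y' + h \<le> x u" "x v < y' - h" "downcrosses x (y' - h) (y' + h) s u n" by auto
    with uv show "downcrosses x (y' - h) (y' + h) s t (Suc n)"
      unfolding downcrosses.simps by blast
  qed (use uv e in auto)
qed

lemma downcrosses_borel: "{y. downcrosses x (y - h) (y + h) s t n} \<in> sets borel"
proof (rule left_open_borel)
  fix y assume "y \<in> {y. downcrosses x (y - h) (y + h) s t n}"
  with downcrosses_left_open[of x y h s t n]
  show "\<exists>e<y. {e<..y} \<subseteq> {y. downcrosses x (y - h) (y + h) s t n}" by blast
qed

section \<open>Hitting times and witnesses of downcrossings\<close>

lemma right_continuous_gtD:
  fixes x :: "real \<Rightarrow> real"
  assumes "continuous (at_right r) x" "x r > a"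
  obtains e where "e > r" "\<And>w. r \<le> w \<Longrightarrow> w < e \<Longrightarrow> x w > a"
proof -
  have "\<forall>\<^sub>F w in at_right r. x w > a"
    using assms by (intro order_tendstoD) (auto simp: continuous_within)
  then obtain e where "e > r" "\<forall>w>r. w < e \<longrightarrow> x w > a"
    by (auto simp: eventually_at_right_field)
  with assms(2) show ?thesis by (intro that[of e]) (auto simp: le_less)
qed

lemma right_continuous_ltD:
  fixes x :: "real \<Rightarrow> real"
  assumes "continuous (at_right r) x" "x r < a"
  obtains e where "e > r" "\<And>w. r \<le> w \<Longrightarrow> w < e \<Longrightarrow> x w < a"
proof -
  have "continuous (at_right r) (\<lambda>u. - x u)" "- x r > - a"
    using assms by (auto intro: continuous_minus)
  then obtain e where "e > r" "\<And>w. r \<le> w \<Longrightarrow> w < e \<Longrightarrow> - x w > - a"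
    by (rule right_continuous_gtD) blast
  then show ?thesis by (intro that[of e]) auto
qed

text \<open>The greedy hitting times are the earliest possible, so no choice of witnesses finishes
  \<open>n\<close> downcrossings sooner.\<close>

lemma downcrosses_imp_time_le:
  assumes "downcrosses x (y - c / 2) (y + c / 2) s r n" "r \<le> t"
  shows "downcrossing_time x y c s t n \<le> ereal r"
  using assms
proof (induction n arbitrary: r)
  case (Suc n)
  then obtain u v where uv: "s \<le> u" "u \<le> v" "v \<le> r" "y + c / 2 \<le> x u" "x v < y - c / 2"
    "downcrosses x (y - c / 2) (y + c / 2) s u n" by auto
  have "downcrossing_time x y c s t n \<le> ereal u" using Suc uv by auto
  then have "hit_above x y c t (downcrossing_time x y c s t n) \<le> ereal u"
    unfolding hit_above_def using uv Suc by (intro INF_lower) auto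
  also have "\<dots> \<le> ereal v" using uv by simp
  finally have "hit_below x y c t (hit_above x y c t (downcrossing_time x y c s t n)) \<le> ereal v"
    unfolding hit_below_def using uv Suc by (intro INF_lower) auto
  also have "\<dots> \<le> ereal r" using uv by simp
  finally show ?case by simp
qed auto

lemma downcrossing_time_ge: "downcrossing_time x y c s t n \<ge> ereal s"
proof (induction n)
  case (Suc n)
  have "a \<le> hit_above x y c t a" "a \<le> hit_below x y c t a" for a
    by (auto simp: hit_above_def hit_below_def intro!: INF_greatest)
  with Suc show ?case unfolding downcrossing_time.simps by (meson order_trans)
qed auto

text \<open>An infimum at most \<open>r\<close> might be approached from the right of
  \<open>r\<close> without a member at or before \<open>r\<close>. The second hypothesis excludes
  such accumulation; right continuity will supply it.\<close>

lemma Inf_ereal_leE: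
  assumes "Inf (ereal ` S) \<le> ereal r"
    and "\<And>v. v \<in> S \<Longrightarrow> r < v \<Longrightarrow> \<exists>e>r. \<forall>w\<in>S. r < w \<longrightarrow> e \<le> w"
  obtains v where "v \<in> S" "v \<le> r"
proof (cases "\<exists>v\<in>S. v \<le> r")
  case False
  have "S \<noteq> {}" using assms(1) by (auto simp: top_ereal_def)
  then obtain v where "v \<in> S" by auto
  with False assms(2) obtain e where e: "e > r" "\<forall>w\<in>S. r < w \<longrightarrow> e \<le> w" by (meson not_le)
  have "ereal e \<le> Inf (ereal ` S)"
    using e False by (intro INF_greatest) auto
  with assms(1) e(1) have False by (meson ereal_less_eq(3) leD order_trans)
  then show ?thesis ..
qed (use that in auto)

text \<open>The times of \<open>x u < y - c / 2\<close> may accumulate at \<open>r\<close> from the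
  right only, and then no downcrossing is finished at \<open>r\<close>. The last hypothesis prevents
  this: either no time of the interval follows \<open>r\<close>, or right continuity keeps the path
  above \<open>y - c / 2\<close> for a while. It passes to the induction step because the preceding
  start of a downcrossing satisfies \<open>y + c / 2 \<le> x u\<close>.\<close>

lemma time_le_imp_downcrosses:
  assumes "\<And>u. u \<ge> s \<Longrightarrow> continuous (at_right u) x" "c > 0" "r \<le> t"
    and "downcrossing_time x y c s t n \<le> ereal r" "r = t \<or> y + c / 2 \<le> x r"
  shows "downcrosses x (y - c / 2) (y + c / 2) s r n"
  using assms(3-5)
proof (induction n arbitrary: r)
  case (Suc n)
  let ?\<sigma> = "downcrossing_time x y c s t n"
  let ?\<rho> = "hit_above x y c t ?\<sigma>"
  define S where "S = {u. ?\<rho> \<le> ereal u \<and> u \<le> t \<and> x u < y - c / 2}"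
  define U where "U = {u. ?\<sigma> \<le> ereal u \<and> u \<le> t \<and> y + c / 2 \<le> x u}"
  have ge: "ereal s \<le> ?\<sigma>" by (rule downcrossing_time_ge)
  have rho: "?\<rho> = Inf (ereal ` U)" "?\<sigma> \<le> ?\<rho>"
    by (auto simp: U_def hit_above_def intro!: INF_greatest)
  have "s \<le> r" using downcrossing_time_ge[of s x y c t "Suc n"] Suc.prems(2) by (meson ereal_less_eq(3) order_trans)
  have "Inf (ereal ` S) \<le> ereal r" using Suc.prems(2) by (simp add: S_def hit_below_def)
  then obtain v where v: "v \<in> S" "v \<le> r"
  proof (rule Inf_ereal_leE)
    fix v assume "v \<in> S" "r < v"
    then have "y - c / 2 < x r" using Suc.prems(3) assms(2) by (auto simp: S_def)
    with assms(1)[OF \<open>s \<le> r\<close>] obtain e where e: "e > r" "\<And>w. r \<le> w \<Longrightarrow> w < e \<Longrightarrow> x w > y - c / 2"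
      by (rule right_continuous_gtD) blast
    have "e \<le> w" if "w \<in> S" "r < w" for w
      using e(2)[of w] that by (force simp: S_def)
    with e(1) show "\<exists>e>r. \<forall>w\<in>S. r < w \<longrightarrow> e \<le> w" by blast
  qed
  have "s \<le> v" using v ge rho(2) by (auto simp: S_def) (meson ereal_less_eq(3) order_trans)
  have "x v < y + c / 2" using v assms(2) by (auto simp: S_def)
  have "Inf (ereal ` U) \<le> ereal v" using v rho by (simp add: S_def)
  then obtain u where u: "u \<in> U" "u \<le> v"
  proof (rule Inf_ereal_leE)
    obtain e where e: "e > v" "\<And>w. v \<le> w \<Longrightarrow> w < e \<Longrightarrow> x w < y + c / 2"
      using assms(1)[OF \<open>s \<le> v\<close>] \<open>x v < y + c / 2\<close> by (rule right_continuous_ltD) blast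
    have "e \<le> w" if "w \<in> U" "v < w" for w
      using e(2)[of w] that by (force simp: U_def)
    with e(1) show "\<exists>e>v. \<forall>w\<in>U. v < w \<longrightarrow> e \<le> w" by blast
  qed
  have "s \<le> u" using u ge by (auto simp: U_def) (meson ereal_less_eq(3) order_trans)
  have "downcrosses x (y - c / 2) (y + c / 2) s u n"
    using u by (intro Suc.IH) (auto simp: U_def)
  moreover have "x v < y - c / 2" "y + c / 2 \<le> x u" using u v by (auto simp: S_def U_def)
  ultimately show ?case
    using u(2) v(2) \<open>s \<le> u\<close> unfolding downcrosses.simps by blast
qed (use downcrossing_time_ge in auto)

section \<open>Step approximations of cadlag paths\<close>

text \<open>The cell of \<open>j = m\<close> is the end point \<open>t\<close> alone, so a jump at \<open>t\<close> does no harm.\<close>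

definition step_approx ::
    "(real \<Rightarrow> real) \<Rightarrow> real \<Rightarrow> real \<Rightarrow> real \<Rightarrow> nat \<Rightarrow> (nat \<Rightarrow> real) \<Rightarrow> (nat \<Rightarrow> real) \<Rightarrow> bool" where
  "step_approx x s t h m p z \<longleftrightarrow>
     p 0 = s \<and> p m = t \<and> (\<forall>j<m. p j \<le> p (Suc j)) \<and>
     (\<forall>j\<le>m. \<forall>v. p j \<le> v \<longrightarrow> v \<le> t \<longrightarrow> (j < m \<longrightarrow> v < p (Suc j)) \<longrightarrow> \<bar>x v - z j\<bar> \<le> h)"

lemma step_approx_mono:
  assumes "step_approx x s t h m p z" "i \<le> j" "j \<le> m"
  shows "p i \<le> p j"
  using assms(2,3)
proof (induction j rule: dec_induct)
  case (step n)
  then have "p n \<le> p (Suc n)" using assms(1) by (simp add: step_approx_def)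
  with step show ?case by simp
qed simp

lemma step_approx_cell:
  assumes "step_approx x s t h m p z" "s \<le> v" "v \<le> t"
  obtains j where "j \<le> m" "p j \<le> v" "j < m \<Longrightarrow> v < p (Suc j)"
proof -
  let ?P = "\<lambda>j. j \<le> m \<and> p j \<le> v"
  have 0: "?P 0" using assms by (auto simp: step_approx_def)
  have bd: "j \<le> m" if "?P j" for j using that by simp
  have G: "?P (Greatest ?P)" using GreatestI_nat[where P = ?P, OF 0 bd] .
  have "v < p (Suc (Greatest ?P))" if "Greatest ?P < m"
    using Greatest_le_nat[where P = ?P and k = "Suc (Greatest ?P)", OF _ bd] that by force
  with G show ?thesis using that by blast
qed

lemma discrete_ivt:
  fixes z :: "nat \<Rightarrow> real"
  assumes "z i < y" "y \<le> z j" "j \<le> i"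
  shows "\<exists>k. j \<le> k \<and> k < i \<and> z (Suc k) < y \<and> y \<le> z k"
  using assms(3,1)
proof (induction i rule: dec_induct)
  case base
  then show ?case using assms(2) by simp
next
  case (step i)
  show ?case
  proof (cases "z i < y")
    case True
    with step.IH show ?thesis by (auto intro: less_SucI)
  next
    case False
    with step show ?thesis by (intro exI[of _ i]) auto
  qed
qed

text \<open>Since \<open>z\<close> follows \<open>x\<close> within \<open>h\<close>, a downcrossing
  of the band takes \<open>z\<close> from at least \<open>y\<close> to below \<open>y\<close> and
  hence contains a single step of \<open>z\<close> over \<open>y\<close>. The step found for the
  last downcrossing comes after the cell in which it starts, so it is not among those counted for
  the earlier ones.\<close>

lemma downcrosses_le_card:
  assumes z: "step_approx x s t h m p z"
    and "downcrosses x (y - h) (y + h) s u n" "u \<le> t" "j \<le> m" "p j \<le> u" "j < m \<Longrightarrow> u < p (Suc j)"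
  shows "n \<le> card {k. k < j \<and> z (Suc k) < y \<and> y \<le> z k}"
  using assms(2-)
proof (induction n arbitrary: u j)
  case (Suc n)
  let ?K = "\<lambda>j. {k. k < j \<and> z (Suc k) < y \<and> y \<le> z k}"
  note zb = z[unfolded step_approx_def, THEN conjunct2, THEN conjunct2, THEN conjunct2, rule_format]
  obtain a b where ab: "s \<le> a" "a \<le> b" "b \<le> u" "y + h \<le> x a" "x b < y - h"
    "downcrosses x (y - h) (y + h) s a n" using Suc.prems(1) by auto
  obtain i where i: "i \<le> m" "p i \<le> a" "i < m \<Longrightarrow> a < p (Suc i)"
    using step_approx_cell[OF z ab(1)] ab Suc.prems by (metis order_trans)
  obtain l where l: "l \<le> m" "p l \<le> b" "l < m \<Longrightarrow> b < p (Suc l)"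
    using step_approx_cell[OF z, of b] ab Suc.prems by (metis order_trans)
  have cell_mono: "i' \<le> j'" if "i' \<le> m" "p i' \<le> v" "v \<le> w" "j' < m \<Longrightarrow> w < p (Suc j')" "j' \<le> m" for i' j' v w
  proof (rule ccontr)
    assume "\<not> i' \<le> j'"
    then have "p (Suc j') \<le> p i'" "j' < m" using that step_approx_mono[OF z, of "Suc j'" i'] by auto
    with that show False by linarith
  qed
  have "i \<le> l" "l \<le> j"
    using cell_mono[of i a b l] cell_mono[of l b u j] i l ab Suc.prems by auto
  have "y \<le> z i" using zb[of i a] i ab Suc.prems by (auto simp: abs_le_iff)
  moreover have "z l < y" using zb[of l b] l ab Suc.prems by (auto simp: abs_le_iff)
  ultimately obtain k where k: "i \<le> k" "k < l" "z (Suc k) < y" "y \<le> z k"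
    using discrete_ivt[of z l y i] \<open>i \<le> l\<close> by blast
  have "n \<le> card (?K i)" using ab i Suc.prems by (intro Suc.IH[of a]) auto
  also have "card (?K i) < card (?K j)"
  proof (rule psubset_card_mono)
    have "k \<in> ?K j" "k \<notin> ?K i" "?K i \<subseteq> ?K j" using k \<open>i \<le> l\<close> \<open>l \<le> j\<close> by auto
    then show "?K i \<subset> ?K j" by blast
  qed auto
  finally show ?case by simp
qed auto

text \<open>Compactness in the form of bisection: approximations of adjacent intervals concatenate,
  and near \<open>r\<close> the cells \<open>[a, r)\<close>, \<open>[r, b)\<close> and
  \<open>{b}\<close> suffice, by the left limit and right continuity at \<open>r\<close>.\<close>

lemma step_approx_exists:
  assumes "cadlag x" "0 \<le> s" "s \<le> t" "h > 0"
  shows "\<exists>m p. step_approx x s t h m p (\<lambda>j. x (p j))"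
proof -
  have "0 \<le> s \<longrightarrow> (\<exists>m p. step_approx x s t h m p (\<lambda>j. x (p j)))" using \<open>s \<le> t\<close>
  proof (induction rule: Bolzano)
    case (trans a b c)
    show ?case
    proof
      assume "0 \<le> a"
      with trans have "0 \<le> b" by simp
      with trans \<open>0 \<le> a\<close> obtain m p n q where p: "step_approx x a b h m p (\<lambda>j. x (p j))"
        and q: "step_approx x b c h n q (\<lambda>j. x (q j))" by blast
      \<comment> \<open>The one-point cell that ends the first approximation is dropped;
        \<open>b\<close> is taken over by the first cell of \<open>q\<close>.\<close>
      let ?r = "\<lambda>j. if j < m then p j else q (j - m)"
      have pm: "p m = b" "q 0 = b" "p 0 = a" "q n = c" using p q by (auto simp: step_approx_def)
      have "step_approx x a c h (m + n) ?r (\<lambda>j. x (?r j))"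
        unfolding step_approx_def
      proof (intro conjI allI impI)
        show "?r 0 = a" using pm by auto
        show "?r (m + n) = c" using pm by auto
        show "?r j \<le> ?r (Suc j)" if "j < m + n" for j
        proof -
          consider "Suc j < m" | "Suc j = m" | "m \<le> j" by linarith
          then show ?thesis
          proof cases
            case 1
            then show ?thesis using p by (auto simp: step_approx_def)
          next
            case 2
            then have "p j \<le> p m" using p by (auto simp: step_approx_def)
            with 2 pm show ?thesis by auto
          next
            case 3
            then have "q (j - m) \<le> q (Suc (j - m))" using q that by (auto simp: step_approx_def)
            with 3 show ?thesis by (simp add: Suc_diff_le)
          qed
        qed
        show "\<bar>x v - x (?r j)\<bar> \<le> h"
          if "j \<le> m + n" "?r j \<le> v" "v \<le> c" "j < m + n \<longrightarrow> v < ?r (Suc j)" for j v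
        proof (cases "j < m")
          case True
          have "v < p (Suc j)"
            using that True pm by (cases "Suc j = m") auto
          moreover have "p (Suc j) \<le> b"
            using step_approx_mono[OF p, of "Suc j" m] True pm by simp
          ultimately show ?thesis using p True that by (auto simp: step_approx_def)
        next
          case False
          then have "j - m < n \<longrightarrow> v < q (Suc (j - m))" using that by (auto simp: Suc_diff_le)
          then show ?thesis using q False that by (auto simp: step_approx_def)
        qed
      qed
      then show "\<exists>m p. step_approx x a c h m p (\<lambda>j. x (p j))" by blast
    qed
  next
    case (local r)
    have "r \<ge> 0" using local \<open>0 \<le> s\<close> by simp
    obtain d1 where d1: "d1 > 0" "\<And>v. r \<le> v \<Longrightarrow> v < r + d1 \<Longrightarrow> \<bar>x v - x r\<bar> \<le> h"
    proof -
      have c: "continuous (at_right r) x" using assms \<open>r \<ge> 0\<close> by (simp add: cadlag_def)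
      obtain e1 where e1: "e1 > r" "\<And>w. r \<le> w \<Longrightarrow> w < e1 \<Longrightarrow> x w > x r - h"
        using right_continuous_gtD[OF c, of "x r - h"] \<open>h > 0\<close> by auto
      obtain e2 where e2: "e2 > r" "\<And>w. r \<le> w \<Longrightarrow> w < e2 \<Longrightarrow> x w < x r + h"
        using right_continuous_ltD[OF c, of "x r + h"] \<open>h > 0\<close> by auto
      show ?thesis
      proof (rule that[of "min e1 e2 - r"])
        fix v assume "r \<le> v" "v < r + (min e1 e2 - r)"
        then show "\<bar>x v - x r\<bar> \<le> h" using e1(2)[of v] e2(2)[of v] by auto
      qed (use e1 e2 in auto)
    qed
    obtain d2 where d2: "d2 > 0"
      "\<And>u v. r - d2 < u \<Longrightarrow> 0 \<le> u \<Longrightarrow> u \<le> v \<Longrightarrow> v < r \<Longrightarrow> \<bar>x v - x u\<bar> \<le> h"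
    proof (cases "r = 0")
      case True
      then show ?thesis by (intro that[of 1]) auto
    next
      case False
      then obtain l where "(x \<longlongrightarrow> l) (at_left r)"
        using assms \<open>r \<ge> 0\<close> unfolding cadlag_def by (metis le_less)
      then have "\<forall>\<^sub>F v in at_left r. dist (x v) l < h / 2"
        using \<open>h > 0\<close> by (intro tendstoD) auto
      then obtain e where e: "e < r" "\<And>v. e < v \<Longrightarrow> v < r \<Longrightarrow> dist (x v) l < h / 2"
        by (auto simp: eventually_at_left_field)
      show ?thesis
      proof (rule that[of "r - e"])
        fix u v assume "r - (r - e) < u" "u \<le> v" "v < r"
        then have "dist (x u) l < h / 2" "dist (x v) l < h / 2" using e(2)[of u] e(2)[of v] by linarith+
        then show "\<bar>x v - x u\<bar> \<le> h" unfolding dist_real_def by linarith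
      qed (use e in auto)
    qed
    show ?case
    proof (intro exI[of _ "min d1 d2"] conjI allI impI)
      fix a b :: real assume ab: "a \<le> r \<and> r \<le> b \<and> b - a < min d1 d2" and "0 \<le> a"
      let ?p = "\<lambda>j::nat. if j = 0 then a else if j = 1 then r else b"
      have "step_approx x a b h 2 ?p (\<lambda>j. x (?p j))"
        unfolding step_approx_def
      proof (intro conjI allI impI)
        fix j v assume j: "j \<le> 2" "?p j \<le> v" "v \<le> b" "j < 2 \<longrightarrow> v < ?p (Suc j)"
        consider "j = 0" | "j = 1" | "j = 2" using j(1) by linarith
        then show "\<bar>x v - x (?p j)\<bar> \<le> h"
        proof cases
          case 1
          then show ?thesis using j ab \<open>0 \<le> a\<close> by (auto intro!: d2)
        next
          case 2
          then show ?thesis using j ab by (auto intro!: d1)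
        next
          case 3
          then show ?thesis using j \<open>h > 0\<close> by auto
        qed
      qed (use ab in auto)
      then show "\<exists>m p. step_approx x a b h m p (\<lambda>j. x (p j))" by blast
    qed (use d1 d2 in auto)
  qed
  with \<open>0 \<le> s\<close> show ?thesis by blast
qed

section \<open>Integrating the number of crossings over the levels\<close>

lemma cadlag_uminus: "cadlag x \<Longrightarrow> cadlag (\<lambda>u. - x u)"
  unfolding cadlag_def by (blast intro: continuous_minus tendsto_minus)

lemma step_approx_uminus:
  assumes "step_approx x s t h m p z"
  shows "step_approx (\<lambda>u. - x u) s t h m p (\<lambda>j. - z j)"
proof -
  have "\<bar>- x v - - z j\<bar> = \<bar>x v - z j\<bar>" for v j by simp
  with assms show ?thesis unfolding step_approx_def by metis
qed

lemma downcrosses_le_card_whole: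
  assumes "step_approx x s t h m p z" "downcrosses x (y - h) (y + h) s t n"
  shows "n \<le> card {k. k < m \<and> z (Suc k) < y \<and> y \<le> z k}"
  using assms by (intro downcrosses_le_card[of x s t h m p z y t n]) (auto simp: step_approx_def)

lemma downcrosses_finite:
  assumes "cadlag x" "0 \<le> s" "s \<le> t" "c > 0"
  shows "finite {n. downcrosses x (y - c / 2) (y + c / 2) s t n}"
proof -
  obtain m p where "step_approx x s t (c / 2) m p (\<lambda>j. x (p j))"
    using step_approx_exists[of x s t "c / 2"] assms by auto
  then have "{n. downcrosses x (y - c / 2) (y + c / 2) s t n}
      \<subseteq> {.. card {k. k < m \<and> x (p (Suc k)) < y \<and> y \<le> x (p k)}}"
    using downcrosses_le_card_whole by fastforce
  then show ?thesis by (rule finite_subset) simp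
qed

text \<open>The set of attained numbers is finite and downward closed, so its \<open>Max\<close> is
  fully described by membership. All later facts about the counts go through this
  equivalence.\<close>

lemma le_downcrossings_iff:
  assumes "cadlag x" "0 \<le> s" "s \<le> t" "c > 0"
  shows "n \<le> downcrossings y c x s t \<longleftrightarrow> downcrosses x (y - c / 2) (y + c / 2) s t n"
proof -
  let ?D = "\<lambda>n. downcrosses x (y - c / 2) (y + c / 2) s t n"
  have rc: "continuous (at_right u) x" if "u \<ge> s" for u
    using assms that by (simp add: cadlag_def)
  have "{n. downcrossing_time x y c s t n \<le> ereal t} = {n. ?D n}"
    using downcrosses_imp_time_le[of x y c s t _ t] time_le_imp_downcrosses[OF rc \<open>c > 0\<close> order_refl]
    by blast
  then have eq: "downcrossings y c x s t = Max {n. ?D n}" by (simp add: downcrossings_def)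
  have fin: "finite {n. ?D n}" using assms by (rule downcrosses_finite)
  have "?D 0" using assms by simp
  then have "Max {n. ?D n} \<in> {n. ?D n}" using fin Max_in by blast
  then show ?thesis
    unfolding eq using downcrosses_antimono fin by (blast intro: Max_ge)
qed

lemma downcrossings_add:
  assumes "cadlag x" "0 \<le> s" "s \<le> r" "r \<le> t" "c > 0"
  shows "downcrossings y c x s r + downcrossings y c x r t \<le> downcrossings y c x s t"
  using assms
  by (subst le_downcrossings_iff)
     (auto intro!: downcrosses_add[where r=r] le_downcrossings_iff[THEN iffD1])

lemma crossings_add:
  assumes "cadlag x" "0 \<le> s" "s \<le> r" "r \<le> t" "c > 0"
  shows "crossings y c x s r + crossings y c x r t \<le> crossings y c x s t"
  using downcrossings_add[OF assms, of y] downcrossings_add[OF cadlag_uminus[OF assms(1)] assms(2-5), of "- y"]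
  by (simp add: crossings_def upcrossings_def)

lemma measurable_downcrossings:
  assumes "cadlag x" "0 \<le> s" "s \<le> t" "c > 0"
  shows "(\<lambda>y. downcrossings y c x s t) \<in> borel \<rightarrow>\<^sub>M count_space UNIV"
proof (rule measurable_count_space_eq_countable[THEN iffD2])
  let ?d = "\<lambda>y. downcrossings y c x s t"
  have ge: "{y. n \<le> ?d y} \<in> sets borel" for n
    using downcrosses_borel[of x "c / 2" s t n] by (simp add: le_downcrossings_iff[OF assms])
  have "?d -` {n} \<inter> space borel = {y. n \<le> ?d y} - {y. Suc n \<le> ?d y}" for n by auto
  then show "?d \<in> space borel \<rightarrow> UNIV \<and> (\<forall>a\<in>UNIV. ?d -` {a} \<inter> space borel \<in> sets borel)"
    using ge by auto
qed simp

lemma measurable_crossings: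
  assumes "cadlag x" "0 \<le> s" "s \<le> t" "c > 0"
  shows "(\<lambda>y. crossings y c x s t) \<in> borel \<rightarrow>\<^sub>M count_space UNIV"
proof -
  have [measurable]: "(\<lambda>y. downcrossings y c x s t) \<in> borel \<rightarrow>\<^sub>M count_space UNIV"
    "(\<lambda>y. downcrossings y c (\<lambda>u. - x u) s t) \<in> borel \<rightarrow>\<^sub>M count_space UNIV"
    using assms by (auto intro!: measurable_downcrossings cadlag_uminus)
  show ?thesis unfolding crossings_def upcrossings_def by measurable
qed

lemma one_le_crossings:
  assumes "cadlag x" "0 \<le> s" "s \<le> t" "c > 0" "min (x s) (x t) + c / 2 < y" "y < max (x s) (x t) - c / 2"
  shows "1 \<le> crossings y c x s t"
proof (cases "x s \<le> x t")
  case True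
  have "downcrosses (\<lambda>u. - x u) (- y - c / 2) (- y + c / 2) s t 1"
    unfolding One_nat_def downcrosses.simps using assms True
    by - (rule exI[of _ s], rule exI[of _ t], auto)
  then have "1 \<le> upcrossings y c x s t"
    unfolding upcrossings_def using assms cadlag_uminus by (subst le_downcrossings_iff) auto
  then show ?thesis by (simp add: crossings_def)
next
  case False
  have "downcrosses x (y - c / 2) (y + c / 2) s t 1"
    unfolding One_nat_def downcrosses.simps using assms False
    by - (rule exI[of _ s], rule exI[of _ t], auto)
  then have "1 \<le> downcrossings y c x s t"
    using assms by (subst le_downcrossings_iff) auto
  then show ?thesis by (simp add: crossings_def)
qed

text \<open>A crossing attains values on both sides of its level.\<close>

lemma crossings_pos_imp_near:
  assumes "cadlag x" "0 \<le> s" "s \<le> t" "c > 0" "\<And>u. s \<le> u \<Longrightarrow> u \<le> t \<Longrightarrow> \<bar>x u - a\<bar> \<le> d"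
    and "crossings y c x s t \<noteq> 0"
  shows "\<bar>y - a\<bar> \<le> d"
proof -
  have "1 \<le> downcrossings y c x s t \<or> 1 \<le> downcrossings (- y) c (\<lambda>u. - x u) s t"
    using assms(6) by (auto simp: crossings_def upcrossings_def)
  then show ?thesis
  proof
    assume "1 \<le> downcrossings y c x s t"
    then have "downcrosses x (y - c / 2) (y + c / 2) s t 1"
      using le_downcrossings_iff[OF assms(1-4)] by blast
    then obtain u v where "s \<le> u" "u \<le> v" "v \<le> t" "y + c / 2 \<le> x u" "x v < y - c / 2" by auto
    then show ?thesis using assms(4) assms(5)[of u] assms(5)[of v] by auto
  next
    assume "1 \<le> downcrossings (- y) c (\<lambda>u. - x u) s t"
    then have "downcrosses (\<lambda>u. - x u) (- y - c / 2) (- y + c / 2) s t 1"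
      using le_downcrossings_iff[OF cadlag_uminus[OF assms(1)] assms(2-4)] by blast
    then obtain u v where "s \<le> u" "u \<le> v" "v \<le> t" "- y + c / 2 \<le> - x u" "- x v < - y - c / 2" by auto
    then show ?thesis using assms(4) assms(5)[of u] assms(5)[of v] by auto
  qed
qed

section \<open>The total mass of crossings over all levels\<close>

definition crossing_mass :: "real \<Rightarrow> (real \<Rightarrow> real) \<Rightarrow> real \<Rightarrow> real \<Rightarrow> ennreal" where
  "crossing_mass c x s t = (\<integral>\<^sup>+y. of_nat (crossings y c x s t) \<partial>lborel)"

lemma crossing_mass_add:
  assumes "cadlag x" "0 \<le> s" "s \<le> r" "r \<le> t" "c > 0"
  shows "crossing_mass c x s r + crossing_mass c x r t \<le> crossing_mass c x s t"
proof -
  have [measurable]: "(\<lambda>y. crossings y c x s r) \<in> borel \<rightarrow>\<^sub>M count_space UNIV"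
     "(\<lambda>y. crossings y c x r t) \<in> borel \<rightarrow>\<^sub>M count_space UNIV"
    using assms by (auto intro!: measurable_crossings)
  have "crossing_mass c x s r + crossing_mass c x r t
      = (\<integral>\<^sup>+y. of_nat (crossings y c x s r) + of_nat (crossings y c x r t) \<partial>lborel)"
    unfolding crossing_mass_def by (subst nn_integral_add) auto
  also have "\<dots> \<le> crossing_mass c x s t"
    unfolding crossing_mass_def of_nat_add[symmetric]
    using crossings_add[OF assms] by (intro nn_integral_mono) (metis of_nat_mono)
  finally show ?thesis .
qed

text \<open>All levels of \<open>?I\<close> are crossed between the two end points, and if
  \<open>?I\<close> is nonempty its length is the increment minus \<open>c\<close>.\<close>

lemma crossing_mass_lower:
  assumes "cadlag x" "0 \<le> s" "s \<le> t" "c > 0"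
  shows "ennreal (max (\<bar>x t - x s\<bar> - c) 0) \<le> crossing_mass c x s t"
proof -
  let ?I = "{min (x s) (x t) + c / 2 <..< max (x s) (x t) - c / 2}"
  have "ennreal (max (\<bar>x t - x s\<bar> - c) 0) = emeasure lborel ?I"
  proof (cases "\<bar>x t - x s\<bar> \<ge> c")
    case True
    then have "min (x s) (x t) + c / 2 \<le> max (x s) (x t) - c / 2" by auto
    then show ?thesis using True by (auto simp: min_def max_def abs_if algebra_simps split: if_splits)
  next
    case False
    then have "?I = {}" by (auto simp: min_def max_def split: if_splits)
    with False show ?thesis by simp
  qed
  also have "\<dots> = (\<integral>\<^sup>+y. indicator ?I y \<partial>lborel)" by simp
  also have "\<dots> \<le> crossing_mass c x s t"
    unfolding crossing_mass_def
  proof (rule nn_integral_mono)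
    fix y
    show "indicator ?I y \<le> (of_nat (crossings y c x s t) :: ennreal)"
      using one_le_crossings[OF assms, of y] of_nat_mono[of 1 "crossings y c x s t", where 'a=ennreal]
      by (auto simp: indicator_def)
  qed
  finally show ?thesis .
qed

lemma truncated_variation_le_crossing_mass:
  assumes "cadlag x" "0 \<le> s" "s \<le> t" "c > 0"
  shows "truncated_variation c x s t \<le> crossing_mass c x s t"
  using assms
  by (intro truncated_variation_le_superadditive crossing_mass_add crossing_mass_lower) auto

text \<open>The Banach indicatrix of the finite sequence \<open>z\<close>: the levels crossed by one
  step of \<open>z\<close> form a half-open interval, whose length is the size of the step.\<close>

lemma crossing_mass_le_variation:
  assumes "cadlag x" "0 \<le> s" "s \<le> t" "h > 0" "step_approx x s t h m p z"
  shows "crossing_mass (2 * h) x s t \<le> ennreal (\<Sum>k<m. \<bar>z (Suc k) - z k\<bar>)"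
proof -
  let ?D = "\<lambda>k. {z (Suc k)<..z k}" and ?U = "\<lambda>k. {z k..<z (Suc k)}"
  have "crossings y (2 * h) x s t
      \<le> card {k. k < m \<and> - z (Suc k) < - y \<and> - y \<le> - z k} + card {k. k < m \<and> z (Suc k) < y \<and> y \<le> z k}"
    (is "_ \<le> card ?A + card ?B") for y
  proof -
    have "downcrosses x (y - h) (y + h) s t (downcrossings y (2 * h) x s t)"
      using le_downcrossings_iff[of x s t "2 * h" "downcrossings y (2 * h) x s t" y] assms by simp
    then have "downcrossings y (2 * h) x s t \<le> card ?B"
      using assms(5) by (rule downcrosses_le_card_whole[rotated])
    moreover have "downcrosses (\<lambda>u. - x u) (- y - h) (- y + h) s t (downcrossings (- y) (2 * h) (\<lambda>u. - x u) s t)"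
      using le_downcrossings_iff[OF cadlag_uminus, of x s t "2 * h" "downcrossings (- y) (2 * h) (\<lambda>u. - x u) s t" "- y"] assms
      by simp
    then have "downcrossings (- y) (2 * h) (\<lambda>u. - x u) s t \<le> card ?A"
      using step_approx_uminus[OF assms(5)] by (rule downcrosses_le_card_whole[rotated])
    ultimately show ?thesis by (simp add: crossings_def upcrossings_def)
  qed
  moreover have "card {k. k < m \<and> - z (Suc k) < - y \<and> - y \<le> - z k} = (\<Sum>k<m. indicator (?U k) y)" for y
  proof -
    have "{k. k < m \<and> - z (Suc k) < - y \<and> - y \<le> - z k} = {k\<in>{..<m}. y \<in> ?U k}" by auto
    then show ?thesis by (simp add: sum_indicator_eq_card Int_def indicator_def sum.If_cases conj_commute)
  qed
  moreover have "card {k. k < m \<and> z (Suc k) < y \<and> y \<le> z k} = (\<Sum>k<m. indicator (?D k) y)" for y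
  proof -
    have "{k. k < m \<and> z (Suc k) < y \<and> y \<le> z k} = {k\<in>{..<m}. y \<in> ?D k}" by auto
    then show ?thesis by (simp add: sum_indicator_eq_card Int_def indicator_def sum.If_cases conj_commute)
  qed
  ultimately have *: "crossings y (2 * h) x s t \<le> (\<Sum>k<m. indicator (?U k) y + indicator (?D k) y)" for y
    by (simp add: sum.distrib)
  have "(of_nat (crossings y (2 * h) x s t) :: ennreal) \<le> (\<Sum>k<m. indicator (?U k) y + indicator (?D k) y)" for y
  proof -
    have "(of_nat (crossings y (2 * h) x s t) :: ennreal) \<le> of_nat (\<Sum>k<m. indicator (?U k) y + indicator (?D k) y)"
      using * by (rule of_nat_mono)
    also have "\<dots> = (\<Sum>k<m. indicator (?U k) y + indicator (?D k) y)"
      by (simp add: indicator_def of_nat_sum if_distrib cong: if_cong)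
    finally show ?thesis .
  qed
  then have "crossing_mass (2 * h) x s t \<le> (\<integral>\<^sup>+y. (\<Sum>k<m. indicator (?U k) y + indicator (?D k) y) \<partial>lborel)"
    unfolding crossing_mass_def by (intro nn_integral_mono)
  also have "\<dots> = (\<Sum>k<m. emeasure lborel (?U k) + emeasure lborel (?D k))"
    by (subst nn_integral_sum) (auto simp: nn_integral_add)
  also have "\<dots> = (\<Sum>k<m. ennreal \<bar>z (Suc k) - z k\<bar>)"
  proof (rule sum.cong[OF refl])
    fix k
    show "emeasure lborel (?U k) + emeasure lborel (?D k) = ennreal \<bar>z (Suc k) - z k\<bar>"
      by (cases "z k \<le> z (Suc k)") auto
  qed
  also have "\<dots> = ennreal (\<Sum>k<m. \<bar>z (Suc k) - z k\<bar>)" by (simp add: sum_ennreal)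
  finally show ?thesis .
qed

text \<open>The sampled path is itself an admissible \<open>z\<close>, and a finite sequence has
  finite variation.\<close>

lemma truncated_variation_finite:
  assumes "cadlag x" "0 \<le> s" "s \<le> t" "c > 0"
  shows "truncated_variation c x s t < \<infinity>"
proof -
  obtain m p where p: "step_approx x s t (c / 2) m p (\<lambda>j. x (p j))"
    using step_approx_exists[of x s t "c / 2"] assms by auto
  have "truncated_variation c x s t \<le> crossing_mass (2 * (c / 2)) x s t"
    using assms by (simp add: truncated_variation_le_crossing_mass)
  also have "\<dots> \<le> ennreal (\<Sum>k<m. \<bar>x (p (Suc k)) - x (p k)\<bar>)"
    using assms p by (intro crossing_mass_le_variation) auto
  also have "\<dots> < \<infinity>" by simp
  finally show ?thesis .
qed

section \<open>The play operator and the upper bound for the crossing mass\<close>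

text \<open>
  The sequence \<open>z\<close> is the play operator applied to \<open>a\<close>: it moves only when pushed by the band of
  half-width \<open>c/2\<close> around \<open>a\<close>. Its initial value is fixed once the oscillation of \<open>a\<close> first exceeds \<open>c\<close>.
  In the second alternative \<open>\<sigma>\<close> is the current direction of movement and \<open>i\<close> the index of the running
  extremum, so that moving on merely stretches or adds the last increment of the chain.
\<close>

lemma play_invariant:
  fixes a :: "nat \<Rightarrow> real"
  assumes "c \<ge> 0"
  shows "(\<exists>i j. i \<le> m \<and> j \<le> m \<and> (\<forall>k\<le>m. a i \<le> a k \<and> a k \<le> a j) \<and> a j - a i \<le> c) \<or>
    (\<exists>z js b i \<sigma>. \<bar>\<sigma>\<bar> = 1 \<and> (\<forall>k\<le>m. \<bar>a k - z k\<bar> \<le> c / 2) \<and>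
       sorted (js @ [b, i]) \<and> i \<le> m \<and> c \<le> \<sigma> * (a i - a b) \<and> z m = a i - \<sigma> * c / 2 \<and>
       (\<Sum>k<m. \<bar>z (Suc k) - z k\<bar>) = truncated_sum c a (js @ [b]) + (\<sigma> * (a i - a b) - c))"
    (is "?flat m \<or> ?moving m")
proof (induction m)
  case 0
  then show ?case using assms by auto
next
  case (Suc m)
  let ?a = "a (Suc m)"
  from Suc show ?case
  proof
    assume "?flat m"
    then obtain i j where ij: "i \<le> m" "j \<le> m" "\<forall>k\<le>m. a i \<le> a k \<and> a k \<le> a j" "a j - a i \<le> c" by blast
    have move: "?moving (Suc m)"
      if l: "l \<le> m" "\<forall>k\<le>m. 0 \<le> \<sigma> * (a k - a l) \<and> \<sigma> * (a k - a l) \<le> c" "\<sigma> * (?a - a l) > c" "\<bar>\<sigma>\<bar> = 1" for l \<sigma>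
    proof -
      \<comment> \<open>Here the oscillation exceeds \<open>c\<close> for the first time. Up to
        \<open>m\<close> all values lie within \<open>c\<close> of the extremum \<open>a l\<close>,
        on the side given by \<open>\<sigma>\<close>, so the constant at distance
        \<open>c / 2\<close> from \<open>a l\<close> serves them all; the new value pushes the band
        only by the excess over \<open>c\<close>.\<close>
      let ?z = "\<lambda>k. if k \<le> m then a l + \<sigma> * c / 2 else ?a - \<sigma> * c / 2"
      have \<sigma>: "\<sigma> = 1 \<or> \<sigma> = - 1" using l by auto
      have "(\<Sum>k<Suc m. \<bar>?z (Suc k) - ?z k\<bar>) = \<bar>?a - \<sigma> * c / 2 - (a l + \<sigma> * c / 2)\<bar>" by simp
      also have "\<dots> = \<sigma> * (?a - a l) - c" using \<sigma> l(3) assms by auto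
      finally have "(\<Sum>k<Suc m. \<bar>?z (Suc k) - ?z k\<bar>) = truncated_sum c a ([] @ [l]) + (\<sigma> * (?a - a l) - c)" by simp
      moreover have "\<forall>k\<le>Suc m. \<bar>a k - ?z k\<bar> \<le> c / 2"
      proof (intro allI impI)
        fix k assume "k \<le> Suc m"
        then show "\<bar>a k - ?z k\<bar> \<le> c / 2"
          using \<sigma> l(2) assms by (cases "k = Suc m") (auto simp: le_Suc_eq abs_le_iff field_simps)
      qed
      ultimately show ?thesis
        using l by - (rule exI[of _ ?z], rule exI[of _ "[]"], rule exI[of _ l], rule exI[of _ "Suc m"], rule exI[of _ \<sigma>], auto)
    qed
    consider "?a > a i + c" | "?a < a j - c" | "a j - c \<le> ?a" "?a \<le> a i + c" by linarith
    then show ?thesis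
    proof cases
      case 1
      then have "?moving (Suc m)" using ij by (intro move[of i 1]) force+
      then show ?thesis ..
    next
      case 2
      then have "?moving (Suc m)" using ij by (intro move[of j "- 1"]) force+
      then show ?thesis ..
    next
      case 3
      define i' where "i' = (if ?a < a i then Suc m else i)"
      define j' where "j' = (if ?a > a j then Suc m else j)"
      have "a i \<le> a j" using ij by auto
      have "\<forall>k\<le>Suc m. a i' \<le> a k \<and> a k \<le> a j'"
        using ij \<open>a i \<le> a j\<close> by (force simp: i'_def j'_def le_Suc_eq)
      moreover have "a j' - a i' \<le> c" using 3 ij assms \<open>a i \<le> a j\<close> by (auto simp: i'_def j'_def)
      moreover have "i' \<le> Suc m" "j' \<le> Suc m" using ij by (auto simp: i'_def j'_def)
      ultimately show ?thesis by blast
    qed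
  next
    assume "?moving m"
    then obtain z js b i \<sigma> where z: "\<bar>\<sigma>\<bar> = 1" "\<forall>k\<le>m. \<bar>a k - z k\<bar> \<le> c / 2" "sorted (js @ [b, i])" "i \<le> m"
      "c \<le> \<sigma> * (a i - a b)" "z m = a i - \<sigma> * c / 2"
      "(\<Sum>k<m. \<bar>z (Suc k) - z k\<bar>) = truncated_sum c a (js @ [b]) + (\<sigma> * (a i - a b) - c)" by blast
    have \<sigma>: "\<sigma> = 1 \<or> \<sigma> = - 1" using z by auto
    let ?z = "\<lambda>w k. if k \<le> m then z k else w"
    have sum: "(\<Sum>k<Suc m. \<bar>?z w (Suc k) - ?z w k\<bar>) = (\<Sum>k<m. \<bar>z (Suc k) - z k\<bar>) + \<bar>w - z m\<bar>" for w
      by simp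
    have near: "\<forall>k\<le>Suc m. \<bar>a k - ?z w k\<bar> \<le> c / 2" if "\<bar>?a - w\<bar> \<le> c / 2" for w
      using z(2) that by (auto simp: le_Suc_eq)
    have "\<sigma> * (?a - a i) = - (\<sigma> * (a i - ?a))" by (simp add: algebra_simps)
    then consider "\<sigma> * (?a - a i) > 0" | "0 \<le> \<sigma> * (a i - ?a)" "\<sigma> * (a i - ?a) \<le> c" | "c < \<sigma> * (a i - ?a)"
      by linarith
    then have "?moving (Suc m)"
    proof cases
      case 1
      let ?w = "?a - \<sigma> * c / 2"
      have "\<bar>?w - z m\<bar> = \<sigma> * (?a - a i)" using \<sigma> 1 z(6) by auto
      then have "(\<Sum>k<Suc m. \<bar>?z ?w (Suc k) - ?z ?w k\<bar>) = truncated_sum c a (js @ [b]) + (\<sigma> * (?a - a b) - c)"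
        unfolding sum z(7) by (simp add: algebra_simps)
      moreover have "\<forall>k\<le>Suc m. \<bar>a k - ?z ?w k\<bar> \<le> c / 2" using \<sigma> assms by (intro near) auto
      moreover have "sorted (js @ [b, Suc m])" using z(3,4) by (auto simp: sorted_append)
      moreover have "c \<le> \<sigma> * (?a - a b)" using z(5) 1 by (simp add: algebra_simps)
      ultimately show ?thesis
        using z(1) by - (rule exI[of _ "?z ?w"], rule exI[of _ js], rule exI[of _ b], rule exI[of _ "Suc m"], rule exI[of _ \<sigma>], auto)
    next
      case 2
      let ?w = "z m"
      have "(\<Sum>k<Suc m. \<bar>?z ?w (Suc k) - ?z ?w k\<bar>) = truncated_sum c a (js @ [b]) + (\<sigma> * (a i - a b) - c)"
        unfolding sum z(7) by simp
      moreover have "\<bar>?a - ?w\<bar> \<le> c / 2"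
        using \<sigma>
      proof
        assume "\<sigma> = 1"
        with 2 z(6) have "z m = a i - c / 2" "0 \<le> a i - ?a" "a i - ?a \<le> c" by auto
        then show ?thesis by linarith
      next
        assume "\<sigma> = - 1"
        with 2 z(6) have "z m = a i + c / 2" "0 \<le> ?a - a i" "?a - a i \<le> c" by auto
        then show ?thesis by linarith
      qed
      then have "\<forall>k\<le>Suc m. \<bar>a k - ?z ?w k\<bar> \<le> c / 2" by (rule near)
      ultimately show ?thesis
        using z by - (rule exI[of _ "?z ?w"], rule exI[of _ js], rule exI[of _ b], rule exI[of _ i], rule exI[of _ \<sigma>], auto)
    next
      case 3
      \<comment> \<open>A reversal by more than \<open>c\<close>: the extremum \<open>a i\<close> is
        final, so the increment from \<open>b\<close> to \<open>i\<close> joins the truncated sum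
        and a new one starts at \<open>i\<close>, while \<open>z\<close> moves by the excess of the
        reversal over \<open>c\<close>.\<close>
      let ?w = "?a + \<sigma> * c / 2"
      have "\<bar>?w - z m\<bar> = \<sigma> * (a i - ?a) - c" using \<sigma> 3 z(6) by auto
      moreover have "truncated_sum c a ((js @ [b]) @ [i]) = truncated_sum c a (js @ [b]) + (\<sigma> * (a i - a b) - c)"
        using \<sigma> z(5) assms by (auto simp: truncated_sum_snoc)
      ultimately have "(\<Sum>k<Suc m. \<bar>?z ?w (Suc k) - ?z ?w k\<bar>) = truncated_sum c a ((js @ [b]) @ [i]) + (- \<sigma> * (?a - a i) - c)"
        unfolding sum z(7) by (simp add: algebra_simps)
      moreover have "\<forall>k\<le>Suc m. \<bar>a k - ?z ?w k\<bar> \<le> c / 2" using \<sigma> assms by (intro near) auto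
      moreover have "sorted ((js @ [b]) @ [i, Suc m])" using z(3,4) by (auto simp: sorted_append)
      moreover have "c \<le> - \<sigma> * (?a - a i)" using 3 by (simp add: algebra_simps)
      ultimately show ?thesis
        using z(1) by - (rule exI[of _ "?z ?w"], rule exI[of _ "js @ [b]"], rule exI[of _ i], rule exI[of _ "Suc m"], rule exI[of _ "- \<sigma>"], auto)
    qed
    then show ?thesis ..
  qed
qed

text \<open>Appending the running extremum \<open>i\<close> turns the pending excess into one more
  truncated increment. If the oscillation never exceeded \<open>c\<close>, the midpoint of the range
  is a constant choice and the chain is empty.\<close>

lemma play_exists:
  fixes a :: "nat \<Rightarrow> real"
  assumes "c \<ge> 0"
  obtains z js where "\<And>k. k \<le> m \<Longrightarrow> \<bar>a k - z k\<bar> \<le> c / 2" "sorted js" "\<And>k. k \<in> set js \<Longrightarrow> k \<le> m"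
    "(\<Sum>k<m. \<bar>z (Suc k) - z k\<bar>) \<le> truncated_sum c a js"
  using play_invariant[OF assms, of m a]
proof
  assume "\<exists>i j. i \<le> m \<and> j \<le> m \<and> (\<forall>k\<le>m. a i \<le> a k \<and> a k \<le> a j) \<and> a j - a i \<le> c"
  then obtain i j where ij: "\<forall>k\<le>m. a i \<le> a k \<and> a k \<le> a j" "a j - a i \<le> c" by blast
  have "\<bar>a k - (a i + a j) / 2\<bar> \<le> c / 2" if "k \<le> m" for k
    using ij(1)[rule_format, OF that] ij(2) by (auto simp: abs_le_iff field_simps)
  then show ?thesis by (intro that[of "\<lambda>_. (a i + a j) / 2" "[]"]) auto
next
  assume "\<exists>z js b i \<sigma>. \<bar>\<sigma>\<bar> = 1 \<and> (\<forall>k\<le>m. \<bar>a k - z k\<bar> \<le> c / 2) \<and>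
       sorted (js @ [b, i]) \<and> i \<le> m \<and> c \<le> \<sigma> * (a i - a b) \<and> z m = a i - \<sigma> * c / 2 \<and>
       (\<Sum>k<m. \<bar>z (Suc k) - z k\<bar>) = truncated_sum c a (js @ [b]) + (\<sigma> * (a i - a b) - c)"
  then obtain z js b i \<sigma> where z: "\<bar>\<sigma>\<bar> = 1" "\<forall>k\<le>m. \<bar>a k - z k\<bar> \<le> c / 2" "sorted (js @ [b, i])" "i \<le> m"
      "c \<le> \<sigma> * (a i - a b)"
      "(\<Sum>k<m. \<bar>z (Suc k) - z k\<bar>) = truncated_sum c a (js @ [b]) + (\<sigma> * (a i - a b) - c)" by blast
  have "(\<sigma> :: real) = 1 \<or> \<sigma> = - 1" using z by auto
  then have "(\<Sum>k<m. \<bar>z (Suc k) - z k\<bar>) \<le> truncated_sum c a (js @ [b, i])"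
    using z by (auto simp: truncated_sum_snoc)
  with z show ?thesis by (intro that[of z "js @ [b, i]"]) (auto simp: sorted_append)
qed

text \<open>The play operator acts on finitely many values, so \<open>x\<close> is first sampled
  with error \<open>\<epsilon>\<close>. The resulting \<open>z\<close> follows \<open>x\<close>
  within \<open>c / 2 + \<epsilon>\<close>, which accounts for the width, and its variation is at
  most a truncated sum of \<open>x\<close> along grid times.\<close>

lemma widened_crossing_mass_le_truncated_variation:
  assumes "cadlag x" "0 \<le> s" "s \<le> t" "c > 0" "\<epsilon> > 0"
  shows "crossing_mass (c + 2 * \<epsilon>) x s t \<le> truncated_variation c x s t"
proof -
  obtain m p where p: "step_approx x s t \<epsilon> m p (\<lambda>j. x (p j))"
    using step_approx_exists[of x s t \<epsilon>] assms by auto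
  obtain z js where z: "\<And>k. k \<le> m \<Longrightarrow> \<bar>x (p k) - z k\<bar> \<le> c / 2" "sorted js" "\<And>k. k \<in> set js \<Longrightarrow> k \<le> m"
    "(\<Sum>k<m. \<bar>z (Suc k) - z k\<bar>) \<le> truncated_sum c (\<lambda>k. x (p k)) js"
    by (rule play_exists[OF less_imp_le[OF assms(4)], of m "\<lambda>k. x (p k)"]) (rule that)
  have "step_approx x s t (c / 2 + \<epsilon>) m p z"
    unfolding step_approx_def
  proof (intro conjI allI impI)
    fix j v assume "j \<le> m" "p j \<le> v" "v \<le> t" "j < m \<longrightarrow> v < p (Suc j)"
    then have "\<bar>x v - x (p j)\<bar> \<le> \<epsilon>" "\<bar>x (p j) - z j\<bar> \<le> c / 2"
      using p z(1) by (auto simp: step_approx_def)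
    then show "\<bar>x v - z j\<bar> \<le> c / 2 + \<epsilon>" by linarith
  qed (use p in \<open>auto simp: step_approx_def\<close>)
  then have "crossing_mass (2 * (c / 2 + \<epsilon>)) x s t \<le> ennreal (\<Sum>k<m. \<bar>z (Suc k) - z k\<bar>)"
    using assms by (intro crossing_mass_le_variation) auto
  also have "\<dots> \<le> ennreal (truncated_sum c x (map p js))"
    using z(4) by (intro ennreal_leI) (simp add: truncated_sum_map)
  also have "\<dots> \<le> truncated_variation c x s t"
  proof (rule truncated_sum_le_truncated_variation)
    have "p 0 = s" "p m = t" using p by (auto simp: step_approx_def)
    moreover have "p 0 \<le> p k" "p k \<le> p m" if "k \<in> set js" for k
      using step_approx_mono[OF p] z(3)[OF that] by auto
    moreover have "sorted (map p js)"
      unfolding sorted_map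
      by (rule sorted_wrt_mono_rel[OF _ z(2)]) (rule step_approx_mono[OF p], assumption, rule z(3))
    ultimately show "map p js \<in> time_chains s t"
      by (auto simp: time_chains_def)
  qed (use assms in simp)
  finally show ?thesis by (simp add: distrib_left)
qed

text \<open>The widening is absorbed by starting from the smaller threshold
  \<open>c - l * c / 2\<close>. This is a convex combination of \<open>c / 2\<close> and
  \<open>c\<close>, so convexity bounds its truncated variation by a quantity that tends to the
  value at \<open>c\<close> as \<open>l\<close> tends to 0. The argument needs finite values at both
  thresholds, which cadlag paths have.\<close>

theorem crossing_mass_eq_truncated_variation:
  assumes "cadlag x" "0 \<le> s" "s \<le> t" "c > 0"
  shows "crossing_mass c x s t = truncated_variation c x s t"
proof (rule antisym)
  define T where "T c = enn2real (truncated_variation c x s t)" for c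
  have T: "truncated_variation c x s t = ennreal (T c)" if "c > 0" for c
    using truncated_variation_finite[OF assms(1-3) that] by (simp add: T_def)
  have bd: "crossing_mass c x s t \<le> ennreal (l * T (c / 2) + (1 - l) * T c)" if l: "0 < l" "l < 1" for l
  proof -
    let ?c = "l * (c / 2) + (1 - l) * c"
    have "?c = c - l * (c / 2)" by (simp add: algebra_simps)
    moreover have "l * (c / 2) < 1 * (c / 2)" using l assms by (intro mult_strict_right_mono) auto
    ultimately have "?c > 0" using assms(4) by linarith
    have "crossing_mass (?c + 2 * (l * c / 4)) x s t \<le> truncated_variation ?c x s t"
      using \<open>?c > 0\<close> assms l by (intro widened_crossing_mass_le_truncated_variation) auto
    also have "?c + 2 * (l * c / 4) = c" by (simp add: algebra_simps)
    also have "truncated_variation ?c x s t \<le> ennreal l * ennreal (T (c / 2)) + ennreal (1 - l) * ennreal (T c)"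
      using truncated_variation_convex[of l "c / 2" c s t x] l assms by (simp add: T)
    also have "\<dots> = ennreal (l * T (c / 2) + (1 - l) * T c)"
      using l by (simp add: ennreal_mult T_def)
    finally show ?thesis .
  qed
  have "((\<lambda>l. ennreal (l * T (c / 2) + (1 - l) * T c)) \<longlongrightarrow> ennreal (0 * T (c / 2) + (1 - 0) * T c)) (at_right 0)"
    by (intro tendsto_intros tendsto_ennrealI)
  moreover have "\<forall>\<^sub>F l in at_right 0. crossing_mass c x s t \<le> ennreal (l * T (c / 2) + (1 - l) * T c)"
    unfolding eventually_at_right_field using bd by (intro exI[of _ 1]) auto
  ultimately have "crossing_mass c x s t \<le> ennreal (0 * T (c / 2) + (1 - 0) * T c)"
    by (rule tendsto_lowerbound) simp
  then show "crossing_mass c x s t \<le> truncated_variation c x s t" using T[OF assms(4)] by simp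
qed (rule truncated_variation_le_crossing_mass[OF assms])

section \<open>Weak convergence along one path\<close>

text \<open>The added 1 keeps these grid points strictly to the right of \<open>v\<close>, so that
  right continuity applies. They serve both for measurability of paths and for passing to rational
  chains.\<close>

lemma filterlim_grid_at_right:
  fixes v :: real
  shows "filterlim (\<lambda>k. (real_of_int \<lfloor>real k * v\<rfloor> + 1) / real k) (at_right v) sequentially"
proof -
  let ?q = "\<lambda>k::nat. (real_of_int \<lfloor>real k * v\<rfloor> + 1) / real k"
  have gt: "v < ?q k" "v \<le> ?q k" "?q k \<le> v + 1 / real k" if "k \<ge> 1" for k
  proof -
    have "real k * v < real_of_int \<lfloor>real k * v\<rfloor> + 1" "real_of_int \<lfloor>real k * v\<rfloor> \<le> real k * v"
      by linarith+
    then show "v < ?q k" "v \<le> ?q k" "?q k \<le> v + 1 / real k"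
      using that by (simp_all add: field_simps)
  qed
  have "?q \<longlonglongrightarrow> v"
  proof (rule tendsto_sandwich[of "\<lambda>_. v" _ _ "\<lambda>k. v + 1 / real k"])
    show "(\<lambda>k. v + 1 / real k) \<longlonglongrightarrow> v"
      using tendsto_add[OF tendsto_const lim_1_over_n, of v] by simp
    show "\<forall>\<^sub>F k in sequentially. v \<le> ?q k" "\<forall>\<^sub>F k in sequentially. ?q k \<le> v + 1 / real k"
      using gt by (intro eventually_sequentiallyI[of 1]; simp)+
  qed simp
  moreover have "\<forall>\<^sub>F k in sequentially. ?q k \<in> {v<..} \<and> ?q k \<noteq> v"
    using gt(1) by (intro eventually_sequentiallyI[of 1]) force
  ultimately show ?thesis by (simp add: filterlim_at)
qed

text \<open>Right continuity exhibits the path as a pointwise limit of functions constant on grid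
  cells; \<open>max 0\<close> discards negative times, where nothing is assumed.\<close>

lemma cadlag_borel_measurable:
  assumes "cadlag x"
  shows "(\<lambda>u. x (max 0 u)) \<in> borel_measurable borel"
proof (rule borel_measurable_LIMSEQ_real)
  fix u :: real
  have "(x \<longlongrightarrow> x (max 0 u)) (at_right (max 0 u))"
    using assms by (simp add: cadlag_def continuous_within)
  then show "(\<lambda>k. x ((real_of_int \<lfloor>real k * max 0 u\<rfloor> + 1) / real k)) \<longlonglongrightarrow> x (max 0 u)"
    using filterlim_grid_at_right by (rule filterlim_compose)
next
  fix k :: nat
  have "(\<lambda>i::int. x ((real_of_int i + 1) / real k)) \<in> borel_measurable (count_space UNIV)" by simp
  then show "(\<lambda>u. x ((real_of_int \<lfloor>real k * max 0 u\<rfloor> + 1) / real k)) \<in> borel_measurable borel"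
    by (rule measurable_compose[rotated]) measurable
qed

definition crossing_integral ::
    "(real \<Rightarrow> real) \<Rightarrow> real \<Rightarrow> (real \<Rightarrow> real) \<Rightarrow> real \<Rightarrow> real \<Rightarrow> real" where
  "crossing_integral f c x s t = (\<integral>y. f y * real (crossings y c x s t) \<partial>lborel)"

lemma crossings_integrable:
  assumes "cadlag x" "0 \<le> s" "s \<le> t" "c > 0"
  shows "integrable lborel (\<lambda>y. real (crossings y c x s t))"
    and "(\<integral>y. real (crossings y c x s t) \<partial>lborel) = enn2real (truncated_variation c x s t)"
proof -
  have [measurable]: "(\<lambda>y. crossings y c x s t) \<in> borel \<rightarrow>\<^sub>M count_space UNIV"
    using assms by (rule measurable_crossings)
  have eq: "(\<integral>\<^sup>+y. ennreal (real (crossings y c x s t)) \<partial>lborel) = truncated_variation c x s t"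
    using crossing_mass_eq_truncated_variation[OF assms]
    by (simp add: crossing_mass_def ennreal_of_nat_eq_real_of_nat)
  show "integrable lborel (\<lambda>y. real (crossings y c x s t))"
    using truncated_variation_finite[OF assms] eq by (intro integrableI_nonneg) auto
  show "(\<integral>y. real (crossings y c x s t) \<partial>lborel) = enn2real (truncated_variation c x s t)"
    by (subst integral_eq_nn_integral) (auto simp: eq)
qed

lemma crossing_integral_integrable:
  assumes "cadlag x" "0 \<le> s" "s \<le> t" "c > 0" "f \<in> borel_measurable borel" "\<And>y. \<bar>f y\<bar> \<le> B"
  shows "integrable lborel (\<lambda>y. f y * real (crossings y c x s t))"
proof (rule Bochner_Integration.integrable_bound)
  show "integrable lborel (\<lambda>y. B * real (crossings y c x s t))"
    using crossings_integrable[OF assms(1-4)] by simp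
  have [measurable]: "f \<in> borel_measurable borel" by fact
  have [measurable]: "(\<lambda>y. crossings y c x s t) \<in> borel \<rightarrow>\<^sub>M count_space UNIV"
    using assms(1-4) by (rule measurable_crossings)
  show "(\<lambda>y. f y * real (crossings y c x s t)) \<in> borel_measurable lborel" by measurable
  show "AE y in lborel. norm (f y * real (crossings y c x s t)) \<le> norm (B * real (crossings y c x s t))"
    using assms(6) by (intro AE_I2) (auto simp: abs_mult intro!: mult_right_mono order_trans[OF assms(6) abs_ge_self])
qed

text \<open>Only levels within \<open>d\<close> of \<open>a\<close> are crossed, and there
  \<open>f\<close> may be replaced by \<open>b\<close>.\<close>

lemma crossing_integral_near:
  assumes "cadlag x" "0 \<le> s" "s \<le> t" "c > 0" "f \<in> borel_measurable borel" "\<And>y. \<bar>f y\<bar> \<le> B"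
    and "\<And>u. s \<le> u \<Longrightarrow> u \<le> t \<Longrightarrow> \<bar>x u - a\<bar> \<le> d" "\<And>y. \<bar>y - a\<bar> \<le> d \<Longrightarrow> \<bar>f y - b\<bar> \<le> \<epsilon>"
  shows "\<bar>crossing_integral f c x s t - b * enn2real (truncated_variation c x s t)\<bar>
    \<le> \<epsilon> * enn2real (truncated_variation c x s t)"
proof -
  let ?n = "\<lambda>y. real (crossings y c x s t)"
  note int = crossings_integrable[OF assms(1-4)] crossing_integral_integrable[OF assms(1-6)]
  have "crossing_integral f c x s t - b * enn2real (truncated_variation c x s t)
      = (\<integral>y. f y * ?n y - b * ?n y \<partial>lborel)"
    unfolding crossing_integral_def int(2)[symmetric] using int by simp
  also have "\<bar>\<dots>\<bar> \<le> (\<integral>y. \<epsilon> * ?n y \<partial>lborel)"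
  proof (rule order_trans[OF integral_abs_bound integral_mono])
    fix y
    have "\<bar>f y - b\<bar> \<le> \<epsilon>" if "crossings y c x s t \<noteq> 0"
      using crossings_pos_imp_near[OF assms(1-4,7) that] assms(8) by blast
    then show "\<bar>f y * ?n y - b * ?n y\<bar> \<le> \<epsilon> * ?n y"
      by (cases "crossings y c x s t = 0") (auto simp: left_diff_distrib[symmetric] abs_mult intro!: mult_right_mono)
  qed (use int in auto)
  also have "\<dots> = \<epsilon> * enn2real (truncated_variation c x s t)" using int by simp
  finally show ?thesis .
qed

lemma crossing_integral_bound:
  assumes "cadlag x" "0 \<le> s" "s \<le> t" "c > 0" "f \<in> borel_measurable borel" "\<And>y. \<bar>f y\<bar> \<le> B"
  shows "\<bar>crossing_integral f c x s t\<bar> \<le> B * enn2real (truncated_variation c x s t)"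
proof -
  let ?n = "\<lambda>y. real (crossings y c x s t)"
  note int = crossings_integrable[OF assms(1-4)] crossing_integral_integrable[OF assms(1-6)]
  have "\<bar>crossing_integral f c x s t\<bar> \<le> (\<integral>y. B * ?n y \<partial>lborel)"
    unfolding crossing_integral_def
  proof (rule order_trans[OF integral_abs_bound integral_mono])
    fix y show "\<bar>f y * ?n y\<bar> \<le> B * ?n y"
      using assms(6)[of y] by (auto simp: abs_mult intro!: mult_right_mono)
  qed (use int in auto)
  with int show ?thesis by simp
qed

text \<open>Counts are superadditive, so the crossings missed by the two halves have a nonnegative
  count at every level, and its integral is the defect of additivity of the truncated
  variation.\<close>

lemma crossing_integral_split:
  assumes "cadlag x" "0 \<le> s" "s \<le> r" "r \<le> t" "c > 0" "f \<in> borel_measurable borel" "\<And>y. \<bar>f y\<bar> \<le> B"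
  shows "\<bar>crossing_integral f c x s t - crossing_integral f c x s r - crossing_integral f c x r t\<bar>
    \<le> B * (enn2real (truncated_variation c x s t) - enn2real (truncated_variation c x s r)
          - enn2real (truncated_variation c x r t))"
proof -
  let ?n = "\<lambda>s t y. real (crossings y c x s t)"
  have st: "0 \<le> r" "s \<le> t" using assms by auto
  note int = crossings_integrable[OF assms(1,2,3,5)] crossings_integrable[OF assms(1) st(1) assms(4,5)]
    crossings_integrable[OF assms(1,2) st(2) assms(5)]
    crossing_integral_integrable[OF assms(1,2,3,5-7)] crossing_integral_integrable[OF assms(1) st(1) assms(4,5-7)]
    crossing_integral_integrable[OF assms(1,2) st(2) assms(5-7)]
  have eq: "crossing_integral f c x s t - crossing_integral f c x s r - crossing_integral f c x r t
      = (\<integral>y. f y * ?n s t y - f y * ?n s r y - f y * ?n r t y \<partial>lborel)"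
    unfolding crossing_integral_def using int by simp
  have "\<bar>\<integral>y. f y * ?n s t y - f y * ?n s r y - f y * ?n r t y \<partial>lborel\<bar> \<le> (\<integral>y. B * (?n s t y - ?n s r y - ?n r t y) \<partial>lborel)"
  proof (rule order_trans[OF integral_abs_bound integral_mono])
    fix y
    have "real (crossings y c x s r + crossings y c x r t) \<le> ?n s t y"
      using crossings_add[OF assms(1-5)] by (intro of_nat_mono)
    then have "0 \<le> ?n s t y - ?n s r y - ?n r t y" by simp
    then have "\<bar>f y * (?n s t y - ?n s r y - ?n r t y)\<bar> \<le> B * (?n s t y - ?n s r y - ?n r t y)"
      using assms(7)[of y] by (simp add: abs_mult mult_right_mono)
    then show "\<bar>f y * ?n s t y - f y * ?n s r y - f y * ?n r t y\<bar> \<le> B * (?n s t y - ?n s r y - ?n r t y)"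
      by (simp add: algebra_simps)
  qed (use int in auto)
  also have "\<dots> = B * (enn2real (truncated_variation c x s t) - enn2real (truncated_variation c x s r)
          - enn2real (truncated_variation c x r t))"
    by (simp only: integral_mult_right_zero int(2,4,6)
      Bochner_Integration.integral_diff[OF Bochner_Integration.integrable_diff[OF int(5,1)] int(3)]
      Bochner_Integration.integral_diff[OF int(5,1)])
  finally show ?thesis unfolding eq .
qed

text \<open>The target is the bound \<open>2 * C * \<epsilon> * (t - s)\<close> for the eventual
  size of the error \<open>J\<close>. It is additive in the interval, so bisection reduces it to
  intervals around a single time, where the path is close to its value on the right and to its left
  limit on the left.\<close>

lemma crossing_integral_tendsto:
  fixes x :: "real \<Rightarrow> real" and c w :: "nat \<Rightarrow> real" and C B :: real and f :: "real \<Rightarrow> real"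
  assumes cad: "cadlag x" and c: "\<And>n. c n > 0" and w: "\<And>n. w n \<ge> 0" and C: "C \<ge> 0"
    and lim: "\<And>s t. 0 \<le> s \<Longrightarrow> s \<le> t \<Longrightarrow>
      (\<lambda>n. w n * enn2real (truncated_variation (c n) x s t)) \<longlonglongrightarrow> C * (t - s)"
    and f: "continuous_on UNIV f" and B: "\<And>y. \<bar>f y\<bar> \<le> B" and t: "0 \<le> t"
  shows "(\<lambda>n. w n * crossing_integral f (c n) x 0 t)
    \<longlonglongrightarrow> C * (\<integral>u. indicator {0<..t} u * f (x (max 0 u)) \<partial>lborel)"
proof -
  let ?T = "\<lambda>n s t. enn2real (truncated_variation (c n) x s t)"
  define g where "g u = f (x (max 0 u))" for u
  have fm [measurable]: "f \<in> borel_measurable borel" using f by (rule borel_measurable_continuous_onI)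
  have [measurable]: "g \<in> borel_measurable borel"
    unfolding g_def using cadlag_borel_measurable[OF cad] by (rule measurable_compose) simp
  have B0: "B \<ge> 0" using B[of 0] by linarith
  define I where "I s t = (\<integral>u. indicator {s<..t} u * g u \<partial>lborel)" for s t
  have intg: "integrable lborel (\<lambda>u. indicator {s<..t} u * g u)" for s t
  proof (rule Bochner_Integration.integrable_bound)
    show "integrable lborel (\<lambda>u. indicator {s<..t} u * B)" for s t :: real
      by (cases "s \<le> t") auto
    show "AE u in lborel. norm (indicator {s<..t} u * g u) \<le> norm (indicator {s<..t} u * B)"
      using B B0 by (intro AE_I2) (auto simp: indicator_def g_def)
  qed measurable
  have I_add: "I s t = I s r + I r t" if "s \<le> r" "r \<le> t" for s r t
  proof -
    have "(indicator {s<..t} u :: real) = indicator {s<..r} u + indicator {r<..t} u" for u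
      using that by (auto simp: indicator_def)
    then have "I s t = (\<integral>u. indicator {s<..r} u * g u + indicator {r<..t} u * g u \<partial>lborel)"
      unfolding I_def by (simp add: distrib_right)
    then show ?thesis unfolding I_def using intg by simp
  qed
  have I_near: "\<bar>I s t - b * (t - s)\<bar> \<le> \<epsilon> * (t - s)"
    if "s \<le> t" "\<And>u. s < u \<Longrightarrow> u \<le> t \<Longrightarrow> \<bar>g u - b\<bar> \<le> \<epsilon>" for s t b \<epsilon>
  proof -
    have "I s t - b * (t - s) = (\<integral>u. indicator {s<..t} u * g u - indicator {s<..t} u * b \<partial>lborel)"
      unfolding I_def using that intg by (subst Bochner_Integration.integral_diff) auto
    also have "\<bar>\<dots>\<bar> \<le> (\<integral>u. indicator {s<..t} u * \<epsilon> \<partial>lborel)"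
    proof (rule order_trans[OF integral_abs_bound integral_mono])
      show "integrable lborel (\<lambda>u. \<bar>indicator {s<..t} u * g u - indicator {s<..t} u * b\<bar>)"
        using that intg by (intro integrable_abs Bochner_Integration.integrable_diff) auto
      show "integrable lborel (\<lambda>u. indicator {s<..t} u * \<epsilon>)" using that by auto
    qed (use that(2) in \<open>auto simp: indicator_def\<close>)
    also have "\<dots> = \<epsilon> * (t - s)" using that by simp
    finally show ?thesis .
  qed
  define J where "J n s t = w n * crossing_integral f (c n) x s t - C * I s t" for n s t
  \<comment> \<open>This needs no control of the path and later pays for the short piece before a
    possible jump.\<close>
  have crude: "\<forall>\<^sub>F n in sequentially. \<bar>J n s t\<bar> \<le> 2 * B * C * (t - s) + \<eta>"
    if "0 \<le> s" "s \<le> t" "\<eta> > 0" for s t \<eta>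
  proof -
    have "(\<lambda>n. B * (w n * ?T n s t) + C * (B * (t - s))) \<longlonglongrightarrow> B * (C * (t - s)) + C * (B * (t - s))"
      using that by (intro tendsto_intros lim)
    then have "\<forall>\<^sub>F n in sequentially. B * (w n * ?T n s t) + C * (B * (t - s)) < 2 * B * C * (t - s) + \<eta>"
      by (rule order_tendstoD) (use that in \<open>simp add: algebra_simps\<close>)
    then show ?thesis
    proof eventually_elim
      case (elim n)
      have "\<bar>w n * crossing_integral f (c n) x s t\<bar> \<le> B * (w n * ?T n s t)"
        using mult_left_mono[OF crossing_integral_bound[OF cad that(1,2) c fm B] w, of n n] w[of n]
        by (simp add: abs_mult algebra_simps)
      moreover have "\<bar>C * I s t\<bar> \<le> C * (B * (t - s))"
        using I_near[OF that(2), of 0 B] B C by (simp add: abs_mult mult_left_mono g_def)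
      ultimately show ?case using elim unfolding J_def by linarith
    qed
  qed
  have near: "\<forall>\<^sub>F n in sequentially. \<bar>J n s t\<bar> \<le> 2 * C * \<epsilon> * (t - s) + \<eta>"
    if st: "0 \<le> s" "s \<le> t" and \<eta>: "\<eta> > 0" and a: "\<And>u. s \<le> u \<Longrightarrow> u \<le> t \<Longrightarrow> \<bar>x u - a\<bar> \<le> d"
      "\<And>y. \<bar>y - a\<bar> \<le> d \<Longrightarrow> \<bar>f y - b\<bar> \<le> \<epsilon>" for s t \<eta> a d b \<epsilon>
  proof -
    have "(\<lambda>n. \<epsilon> * (w n * ?T n s t) + \<bar>b * (w n * ?T n s t - C * (t - s))\<bar> + C * (\<epsilon> * (t - s)))
        \<longlonglongrightarrow> \<epsilon> * (C * (t - s)) + \<bar>b * (C * (t - s) - C * (t - s))\<bar> + C * (\<epsilon> * (t - s))"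
      using st by (intro tendsto_intros lim)
    then have "\<forall>\<^sub>F n in sequentially. \<epsilon> * (w n * ?T n s t) + \<bar>b * (w n * ?T n s t - C * (t - s))\<bar>
        + C * (\<epsilon> * (t - s)) < 2 * C * \<epsilon> * (t - s) + \<eta>"
      by (rule order_tendstoD) (use \<eta> in \<open>simp add: algebra_simps\<close>)
    then show ?thesis
    proof eventually_elim
      case (elim n)
      have "\<bar>crossing_integral f (c n) x s t - b * ?T n s t\<bar> \<le> \<epsilon> * ?T n s t"
        using crossing_integral_near[OF cad st c fm B a] by blast
      from mult_left_mono[OF this w, of n]
      have 1: "\<bar>w n * crossing_integral f (c n) x s t - b * (w n * ?T n s t)\<bar> \<le> \<epsilon> * (w n * ?T n s t)"
        using w[of n] by (simp add: abs_mult_pos' right_diff_distrib mult.left_commute)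
      have "\<bar>I s t - b * (t - s)\<bar> \<le> \<epsilon> * (t - s)"
        using st a by (intro I_near) (auto simp: g_def)
      from mult_left_mono[OF this C]
      have 2: "\<bar>C * I s t - b * (C * (t - s))\<bar> \<le> C * (\<epsilon> * (t - s))"
        using C by (simp add: abs_mult_pos' right_diff_distrib mult.left_commute)
      show ?case using elim 1 2 unfolding J_def right_diff_distrib by linarith
    qed
  qed
  have split: "\<forall>\<^sub>F n in sequentially. \<bar>J n s t\<bar> \<le> \<bar>J n s r\<bar> + \<bar>J n r t\<bar> + \<eta>"
    if st: "0 \<le> s" "s \<le> r" "r \<le> t" and \<eta>: "\<eta> > 0" for s r t \<eta>
  proof -
    have "(\<lambda>n. B * (w n * ?T n s t - w n * ?T n s r - w n * ?T n r t))
        \<longlonglongrightarrow> B * (C * (t - s) - C * (r - s) - C * (t - r))"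
      using st by (intro tendsto_intros lim) auto
    then have "\<forall>\<^sub>F n in sequentially. B * (w n * ?T n s t - w n * ?T n s r - w n * ?T n r t) < \<eta>"
      by (rule order_tendstoD) (use \<eta> in \<open>simp add: algebra_simps\<close>)
    then show ?thesis
    proof eventually_elim
      case (elim n)
      from mult_left_mono[OF crossing_integral_split[OF cad st c fm B] w, of n n]
      have "\<bar>w n * crossing_integral f (c n) x s t - w n * crossing_integral f (c n) x s r
          - w n * crossing_integral f (c n) x r t\<bar> \<le> B * (w n * ?T n s t - w n * ?T n s r - w n * ?T n r t)"
        using w[of n] by (simp add: abs_mult_pos' right_diff_distrib mult.left_commute)
      then show ?case
        using elim I_add[OF st(2,3)] unfolding J_def by (simp add: distrib_left)
    qed
  qed
  have main: "\<forall>\<^sub>F n in sequentially. \<bar>J n 0 t\<bar> \<le> 2 * C * \<epsilon> * t + \<eta>" if \<epsilon>: "\<epsilon> > 0" and \<eta>: "\<eta> > 0" for \<epsilon> \<eta>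
  proof -
    \<comment> \<open>Asking for every \<open>\<eta>\<close> makes the property stable under
      concatenation: each half and the splitting error take a third of it.\<close>
    let ?P = "\<lambda>s t. \<forall>\<eta>>0. \<forall>\<^sub>F n in sequentially. \<bar>J n s t\<bar> \<le> 2 * C * \<epsilon> * (t - s) + \<eta>"
    have P_trans: "?P s t" if "?P s r" "?P r t" "0 \<le> s" "s \<le> r" "r \<le> t" for s r t
    proof (intro allI impI)
      fix \<eta> :: real assume "\<eta> > 0"
      then have "\<eta> / 3 > 0" by simp
      then have "\<forall>\<^sub>F n in sequentially. \<bar>J n s r\<bar> \<le> 2 * C * \<epsilon> * (r - s) + \<eta> / 3"
        "\<forall>\<^sub>F n in sequentially. \<bar>J n r t\<bar> \<le> 2 * C * \<epsilon> * (t - r) + \<eta> / 3"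
        "\<forall>\<^sub>F n in sequentially. \<bar>J n s t\<bar> \<le> \<bar>J n s r\<bar> + \<bar>J n r t\<bar> + \<eta> / 3"
        using that split by blast+
      then show "\<forall>\<^sub>F n in sequentially. \<bar>J n s t\<bar> \<le> 2 * C * \<epsilon> * (t - s) + \<eta>"
      proof eventually_elim
        case (elim n)
        have "2 * C * \<epsilon> * (t - s) = 2 * C * \<epsilon> * (r - s) + 2 * C * \<epsilon> * (t - r)"
          by (simp add: algebra_simps)
        with elim show ?case by linarith
      qed
    qed
    \<comment> \<open>The neighbourhoods in the bisection may reach below time 0, where nothing is
      known about the path; there \<open>Q\<close> holds vacuously.\<close>
    define Q where "Q s t \<longleftrightarrow> (0 \<le> s \<longrightarrow> ?P s t)" for s t
    have "Q 0 t" using t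
    proof (induction rule: Bolzano)
      case (trans s r t)
      show ?case
        unfolding Q_def
      proof
        assume "0 \<le> s"
        with trans have "?P s r" "?P r t" by (auto simp: Q_def)
        then show "?P s t" using \<open>0 \<le> s\<close> trans(3,4) by (rule P_trans)
      qed
    next
      case (local r)
      have nbhd: "\<exists>d>0. \<forall>y. \<bar>y - a\<bar> \<le> d \<longrightarrow> \<bar>f y - f a\<bar> \<le> \<epsilon>" for a
      proof -
        have "isCont f a" using f by (simp add: continuous_on_eq_continuous_at)
        then obtain d where d: "d > 0" "\<forall>y. dist y a < d \<longrightarrow> dist (f y) (f a) < \<epsilon>"
          using \<epsilon> by (auto simp: continuous_at_eps_delta)
        have "\<bar>f y - f a\<bar> \<le> \<epsilon>" if "\<bar>y - a\<bar> \<le> d / 2" for y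
          using d(2)[rule_format, of y] that d(1) by (simp add: dist_real_def)
        with d(1) show ?thesis by (intro exI[of _ "d / 2"]) simp
      qed
      obtain e1 where e1: "e1 > 0" "\<And>t. r \<le> t \<Longrightarrow> t < r + e1 \<Longrightarrow> ?P r t"
      proof -
        obtain d where d: "d > 0" "\<And>y. \<bar>y - x r\<bar> \<le> d \<Longrightarrow> \<bar>f y - f (x r)\<bar> \<le> \<epsilon>" using nbhd by blast
        have "continuous (at_right r) x" using cad local by (simp add: cadlag_def)
        then have "\<forall>\<^sub>F u in at_right r. dist (x u) (x r) < d"
          using d by (auto simp: continuous_within intro: tendstoD)
        then obtain b where b: "b > r" "\<And>u. r < u \<Longrightarrow> u < b \<Longrightarrow> dist (x u) (x r) < d"
          by (auto simp: eventually_at_right_field)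
        have "\<bar>x u - x r\<bar> \<le> d" if "r \<le> u" "u < b" for u
          using b(2)[of u] that d(1) by (cases "u = r") (auto simp: dist_real_def)
        then show ?thesis
          using b(1) d local
          by (intro that[of "b - r"] allI impI near[of r _ _ "x r" d "f (x r)"]) auto
      qed
      obtain e2 where e2: "e2 > 0" "\<And>s. 0 \<le> s \<Longrightarrow> s \<le> r \<Longrightarrow> r - e2 < s \<Longrightarrow> ?P s r"
      proof (cases "r = 0")
        case True
        with e1 have "?P 0 0" by (metis add_0 order_refl)
        with True show ?thesis by (intro that[of 1]) (auto dest: antisym)
      next
        case False
        then obtain l where l: "(x \<longlongrightarrow> l) (at_left r)"
          using cad local unfolding cadlag_def by (metis le_less)
        obtain d where d: "d > 0" "\<And>y. \<bar>y - l\<bar> \<le> d \<Longrightarrow> \<bar>f y - f l\<bar> \<le> \<epsilon>" using nbhd by blast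
        have "\<forall>\<^sub>F u in at_left r. dist (x u) l < d" using l d by (intro tendstoD)
        then obtain b where b: "b < r" "\<And>u. b < u \<Longrightarrow> u < r \<Longrightarrow> dist (x u) l < d"
          by (auto simp: eventually_at_left_field)
        show ?thesis
        proof (rule that[of "r - b"])
          fix s assume s: "0 \<le> s" "s \<le> r" "r - (r - b) < s"
          show "?P s r"
          proof (cases "s = r")
            case True
            then show ?thesis using crude[of r r] local by simp
          next
            case False
            show ?thesis
            proof (intro allI impI)
              fix \<eta> :: real assume \<eta>: "\<eta> > 0"
              \<comment> \<open>At \<open>r\<close> the path may have jumped away from
                \<open>l\<close>, so a last piece of length \<open>\<delta>\<close> is left to the
                crude bound, which there amounts to at most \<open>\<eta> / 2\<close>. The added 1
                avoids division by 0.\<close>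
              define \<delta> where "\<delta> = min (r - s) (\<eta> / 4 / (2 * B * C + 1))"
              have BC: "2 * B * C \<ge> 0" using B0 C by simp
              have \<delta>: "\<delta> > 0" "\<delta> \<le> r - s" using s False \<eta> BC by (auto simp: \<delta>_def)
              have "2 * B * C * \<delta> \<le> (2 * B * C + 1) * \<delta>" using \<delta> by simp
              also have "\<dots> \<le> (2 * B * C + 1) * (\<eta> / 4 / (2 * B * C + 1))"
                using BC by (intro mult_left_mono) (auto simp: \<delta>_def)
              also have "\<dots> = \<eta> / 4"
                using BC by (subst times_divide_eq_right, subst nonzero_mult_div_cancel_left) auto
              finally have small: "2 * B * C * \<delta> \<le> \<eta> / 4" .
              let ?r = "r - \<delta>"
              have eta4: "\<eta> / 4 > 0" using \<eta> by simp
              have "\<bar>x u - l\<bar> \<le> d" if "s \<le> u" "u \<le> ?r" for u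
                using b(2)[of u] that s \<delta> by (auto simp: dist_real_def)
              then have "\<forall>\<^sub>F n in sequentially. \<bar>J n s ?r\<bar> \<le> 2 * C * \<epsilon> * (?r - s) + \<eta> / 4"
                using s \<delta> d eta4 by (intro near[of s ?r _ l d "f l"]) auto
              moreover have "\<forall>\<^sub>F n in sequentially. \<bar>J n ?r r\<bar> \<le> 2 * B * C * (r - ?r) + \<eta> / 4"
                using s \<delta> eta4 by (intro crude) auto
              moreover have "\<forall>\<^sub>F n in sequentially. \<bar>J n s r\<bar> \<le> \<bar>J n s ?r\<bar> + \<bar>J n ?r r\<bar> + \<eta> / 4"
                using s \<delta> eta4 by (intro split) auto
              ultimately show "\<forall>\<^sub>F n in sequentially. \<bar>J n s r\<bar> \<le> 2 * C * \<epsilon> * (r - s) + \<eta>"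
              proof eventually_elim
                case (elim n)
                have "2 * C * \<epsilon> * (?r - s) \<le> 2 * C * \<epsilon> * (r - s)"
                  using \<delta> C \<epsilon> by (intro mult_left_mono) auto
                with elim small show ?case by simp
              qed
            qed
          qed
        qed (use b in auto)
      qed
      show ?case
      proof (intro exI[of _ "min e1 e2"] conjI allI impI)
        fix a b :: real assume ab: "a \<le> r \<and> r \<le> b \<and> b - a < min e1 e2"
        show "Q a b" unfolding Q_def
        proof (intro impI)
          assume "0 \<le> a"
          have "?P a r" using ab \<open>0 \<le> a\<close> by (intro e2(2)) auto
          moreover have "?P r b" using ab by (intro e1(2)) auto
          ultimately show "?P a b" using ab \<open>0 \<le> a\<close> by (intro P_trans[of a r b]) auto
        qed
      qed (use e1 e2 in auto)
    qed
    then show ?thesis using \<eta> by (simp add: Q_def)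
  qed
  have "(\<lambda>n. J n 0 t) \<longlonglongrightarrow> 0"
  proof (rule tendstoI)
    fix e :: real assume e: "e > 0"
    define \<epsilon> where "\<epsilon> = e / 3 / (2 * C * t + 1)"
    have Ct: "2 * C * t \<ge> 0" using C t by simp
    then have "\<epsilon> > 0" using e by (simp add: \<epsilon>_def)
    then have "\<forall>\<^sub>F n in sequentially. \<bar>J n 0 t\<bar> \<le> 2 * C * \<epsilon> * t + e / 3" using e by (intro main) auto
    moreover have "2 * C * \<epsilon> * t \<le> e / 3"
    proof -
      have "2 * C * \<epsilon> * t = (2 * C * t) * \<epsilon>" by simp
      also have "\<dots> \<le> (2 * C * t + 1) * \<epsilon>" using \<open>\<epsilon> > 0\<close> by simp
      also have "\<dots> = e / 3"
        unfolding \<epsilon>_def using Ct by (subst times_divide_eq_right, subst nonzero_mult_div_cancel_left) auto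
      finally show ?thesis .
    qed
    ultimately show "\<forall>\<^sub>F n in sequentially. dist (J n 0 t) 0 < e"
      using e by (auto simp: dist_real_def elim!: eventually_mono)
  qed
  then have "(\<lambda>n. J n 0 t + C * I 0 t) \<longlonglongrightarrow> 0 + C * I 0 t" by (intro tendsto_intros)
  then show ?thesis by (simp add: J_def I_def g_def)
qed

text \<open>By absolute continuity the density integrates back to the occupation measure. The limit
  is thus a multiple of the image of Lebesgue measure on \<open>[0, t]\<close> under the path, which
  is what \<open>crossing_integral_tendsto\<close> produces.\<close>

lemma crossings_weakly_converge:
  fixes x :: "real \<Rightarrow> real" and c w :: "nat \<Rightarrow> real" and C :: real
  assumes cad: "cadlag x" and c: "\<And>n. c n > 0" and w: "\<And>n. w n \<ge> 0" and C: "C \<ge> 0"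
    and lim: "\<And>s t. 0 \<le> s \<Longrightarrow> s \<le> t \<Longrightarrow>
      (\<lambda>n. w n * enn2real (truncated_variation (c n) x s t)) \<longlonglongrightarrow> C * (t - s)"
    and t: "0 \<le> t"
    and ac: "absolutely_continuous lborel (distr (restrict_space lborel {0..t}) borel x)"
  shows "weakly_converges
    (\<lambda>n. density lborel (\<lambda>y. ennreal (w n * real (crossings y (c n) x 0 t))))
    (density lborel (\<lambda>y. ennreal C * RN_deriv lborel (distr (restrict_space lborel {0..t}) borel x) y))"
proof -
  let ?R = "restrict_space lborel {0..t}"
  let ?O = "distr ?R borel x"
  have xm [measurable]: "x \<in> borel_measurable ?R"
  proof -
    have "(\<lambda>u. x (max 0 u)) \<in> borel_measurable ?R"
      using cadlag_borel_measurable[OF cad] by (intro measurable_restrict_space1) simp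
    then show ?thesis
      by (rule measurable_cong[THEN iffD1, rotated]) (auto simp: space_restrict_space)
  qed
  have cm [measurable]: "(\<lambda>y. crossings y (c n) x 0 t) \<in> borel \<rightarrow>\<^sub>M count_space UNIV" for n
    using cad t c by (intro measurable_crossings) auto
  have "finite_measure ?R" by (intro finite_measureI) (use t in \<open>simp add: emeasure_restrict_space space_restrict_space\<close>)
  then have finO: "finite_measure ?O" by (intro finite_measure.finite_measure_distr) auto
  have "density lborel (RN_deriv lborel ?O) = ?O"
    using ac by (intro sigma_finite_measure.density_RN_deriv[OF sigma_finite_lborel]) auto
  then have \<nu>: "density lborel (\<lambda>y. ennreal C * RN_deriv lborel ?O y) = density ?O (\<lambda>_. ennreal C)"
    using density_density_eq[of "RN_deriv lborel ?O" lborel "\<lambda>_. ennreal C"] by (simp add: mult.commute)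
  have fin\<nu>: "finite_measure (density ?O (\<lambda>_. ennreal C))"
    using finite_measure.emeasure_finite[OF finO, of UNIV]
    by (intro finite_measureI) (simp add: emeasure_density_const ennreal_mult_eq_top_iff)
  have fin\<mu>: "finite_measure (density lborel (\<lambda>y. ennreal (w n * real (crossings y (c n) x 0 t))))" for n
  proof (rule finite_measureI)
    have "(\<integral>\<^sup>+y. ennreal (w n * real (crossings y (c n) x 0 t)) \<partial>lborel)
        = ennreal (w n) * crossing_mass (c n) x 0 t"
      unfolding crossing_mass_def using w
      by (subst nn_integral_cmult[symmetric]) (auto simp: ennreal_mult ennreal_of_nat_eq_real_of_nat)
    also have "\<dots> < \<infinity>"
      using truncated_variation_finite[OF cad order_refl t c] crossing_mass_eq_truncated_variation[OF cad order_refl t c]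
      by (simp add: ennreal_mult_less_top)
    finally show "emeasure (density lborel (\<lambda>y. ennreal (w n * real (crossings y (c n) x 0 t))))
        (space (density lborel (\<lambda>y. ennreal (w n * real (crossings y (c n) x 0 t))))) \<noteq> \<infinity>"
      by (simp add: emeasure_density)
  qed
  have "(\<lambda>n. \<integral>y. f y \<partial>density lborel (\<lambda>y. ennreal (w n * real (crossings y (c n) x 0 t))))
      \<longlonglongrightarrow> (\<integral>y. f y \<partial>density ?O (\<lambda>_. ennreal C))"
    if f: "continuous_on UNIV f" and bf: "bounded (range f)" for f :: "real \<Rightarrow> real"
  proof -
    obtain B where B: "\<And>y. \<bar>f y\<bar> \<le> B" using bf by (auto simp: bounded_iff)
    have [measurable]: "f \<in> borel_measurable borel" using f by (rule borel_measurable_continuous_onI)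
    have "(\<integral>y. f y \<partial>density lborel (\<lambda>y. ennreal (w n * real (crossings y (c n) x 0 t))))
        = (\<integral>y. w n * (f y * real (crossings y (c n) x 0 t)) \<partial>lborel)" for n
      using w by (subst integral_density) (auto simp: mult_ac)
    then have 1: "(\<integral>y. f y \<partial>density lborel (\<lambda>y. ennreal (w n * real (crossings y (c n) x 0 t))))
        = w n * crossing_integral f (c n) x 0 t" for n
      by (simp add: crossing_integral_def)
    have "(\<integral>y. f y \<partial>density ?O (\<lambda>_. ennreal C)) = C * (\<integral>y. f y \<partial>?O)"
      using C by (subst integral_density) auto
    also have "(\<integral>y. f y \<partial>?O) = (\<integral>u. f (x u) \<partial>?R)" by (subst integral_distr) auto
    also have "\<dots> = (\<integral>u. indicator {0..t} u * f (x u) \<partial>lborel)"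
      by (subst integral_restrict_space) auto
    \<comment> \<open>Half-open intervals made the time integrals additive over adjacent pieces; the
      missing point 0 is null.\<close>
    also have "\<dots> = (\<integral>u. indicator {0<..t} u * f (x (max 0 u)) \<partial>lborel)"
    proof (rule integral_cong_AE)
      have [measurable]: "(\<lambda>u. x (max 0 u)) \<in> borel_measurable borel" by (rule cadlag_borel_measurable[OF cad])
      show "(\<lambda>u. indicator {0<..t} u * f (x (max 0 u))) \<in> borel_measurable lborel" by measurable
      have "(\<lambda>u. indicator {0..t} u * f (x (max 0 u))) \<in> borel_measurable lborel" by measurable
      then show "(\<lambda>u. indicator {0..t} u * f (x u)) \<in> borel_measurable lborel"
        by (rule measurable_cong[THEN iffD1, rotated]) (auto simp: indicator_def)
      show "AE u in lborel. indicator {0..t} u * f (x u) = indicator {0<..t} u * f (x (max 0 u))"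
        using AE_lborel_singleton[of 0] by eventually_elim (auto simp: indicator_def)
    qed
    finally show ?thesis
      unfolding 1 using crossing_integral_tendsto[OF cad c w C lim f B t] by simp
  qed
  then show ?thesis
    unfolding weakly_converges_def \<nu> using fin\<mu> fin\<nu> by blast
qed

section \<open>Birkhoff's theorem for ergodic stationary sequences\<close>

text \<open>
  \<open>max_sum T f n z\<close> is the largest of the partial sums of \<open>f z, f (T z), \<dots>\<close> with at most \<open>n\<close> terms,
  the empty sum included.
\<close>

primrec max_sum :: "('a \<Rightarrow> 'a) \<Rightarrow> ('a \<Rightarrow> real) \<Rightarrow> nat \<Rightarrow> 'a \<Rightarrow> real" where
  "max_sum T f 0 z = 0"
| "max_sum T f (Suc n) z = max 0 (f z + max_sum T f n (T z))"

lemma max_sum_nonneg: "max_sum T f n z \<ge> 0"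
  by (cases n) auto

lemma max_sum_Suc_ge: "max_sum T f n z \<le> max_sum T f (Suc n) z"
proof (induction n arbitrary: z)
  case (Suc n)
  from Suc[of "T z"] show ?case by auto
qed auto

lemma max_sum_mono: "m \<le> n \<Longrightarrow> max_sum T f m z \<le> max_sum T f n z"
  by (induction n rule: dec_induct) (blast intro: order_refl order_trans[OF _ max_sum_Suc_ge])+

lemma sum_le_max_sum: "(\<Sum>i<n. f ((T ^^ i) z)) \<le> max_sum T f n z"
proof (induction n arbitrary: z)
  case (Suc n)
  have "(\<Sum>i<Suc n. f ((T ^^ i) z)) = f z + (\<Sum>i<n. f ((T ^^ i) (T z)))"
    by (simp only: sum.lessThan_Suc_shift funpow_0 funpow_simps_right o_apply id_apply)
  with Suc[of "T z"] show ?case by simp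
qed auto

locale ergodic_map = prob_space +
  fixes T :: "'a \<Rightarrow> 'a"
  assumes T [measurable]: "T \<in> M \<rightarrow>\<^sub>M M"
    and preserving: "distr M M T = M"
    and ergodic: "\<And>A. A \<in> sets M \<Longrightarrow> T -` A \<inter> space M = A \<Longrightarrow> prob A \<in> {0, 1}"
begin

lemma integrable_compose_T: "integrable M f \<Longrightarrow> integrable M (\<lambda>z. f (T z))"
  for f :: "'a \<Rightarrow> real"
  using integrable_distr[OF T, of f] by (simp add: preserving)

lemma integral_compose_T:
  fixes f :: "'a \<Rightarrow> real"
  assumes "f \<in> borel_measurable M"
  shows "(\<integral>z. f (T z) \<partial>M) = (\<integral>z. f z \<partial>M)"
  using integral_distr[OF T, of f] assms by (simp add: preserving)

lemma integrable_max_sum: "integrable M f \<Longrightarrow> integrable M (max_sum T f n)"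
proof (induction n)
  case (Suc n)
  have "integrable M (\<lambda>z. f z + max_sum T f n (T z))"
    using Suc by (intro Bochner_Integration.integrable_add integrable_compose_T) auto
  then show ?case
    unfolding max_sum.simps by (intro integrable_max) auto
qed (simp add: max_sum.simps[abs_def])

text \<open>
  Garsia's argument on the invariant event that the partial sums are unbounded above: there
  \<open>max_sum T f (n + 1) - max_sum T f n \<circ> T\<close> converges to \<open>f\<close>, and its integral is nonnegative.
\<close>

lemma partial_sums_bounded:
  fixes f :: "'a \<Rightarrow> real"
  assumes f: "integrable M f" and neg: "(\<integral>z. f z \<partial>M) < 0"
  shows "AE z in M. \<exists>K. \<forall>n. (\<Sum>i<n. f ((T ^^ i) z)) \<le> K"
proof -
  let ?m = "max_sum T f"
  have [measurable]: "f \<in> borel_measurable M" using f by simp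
  have int: "integrable M (?m n)" for n using f by (rule integrable_max_sum)
  then have [measurable]: "?m n \<in> borel_measurable M" for n by simp
  define A where "A = {z \<in> space M. \<forall>K::nat. \<exists>n. real K < ?m n z}"
  have A: "A \<in> sets M" unfolding A_def by measurable
  have Tsp: "T z \<in> space M" if "z \<in> space M" for z using measurable_space[OF T that] .
  have inv: "T z \<in> A \<longleftrightarrow> z \<in> A" if z: "z \<in> space M" for z
  proof
    assume TA: "T z \<in> A"
    have "\<exists>n. real K < ?m n z" for K :: nat
    proof -
      obtain k :: nat where k: "real K - f z < real k" using reals_Archimedean2 by blast
      obtain n where "real k < ?m n (T z)" using TA by (auto simp: A_def)
      with k have "real K < ?m (Suc n) z" by simp
      then show ?thesis ..
    qed
    then show "z \<in> A" using z by (simp add: A_def)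
  next
    assume zA: "z \<in> A"
    have "\<exists>n. real K < ?m n (T z)" for K :: nat
    proof -
      obtain k :: nat where k: "real K + \<bar>f z\<bar> < real k" using reals_Archimedean2 by blast
      obtain n where n: "real k < ?m n z" using zA by (auto simp: A_def)
      then obtain n' where "n = Suc n'" by (cases n) auto
      with n k have "real K < ?m n' (T z)" by auto
      then show ?thesis ..
    qed
    then show "T z \<in> A" using Tsp[OF z] by (simp add: A_def)
  qed
  have "prob A \<noteq> 1"
  proof
    assume "prob A = 1"
    then have AE_A: "AE z in M. z \<in> A" using A by (simp add: prob_eq_1)
    let ?d = "\<lambda>n z. ?m (Suc n) z - ?m n (T z)"
    \<comment> \<open>This form gives both the domination by the absolute value of \<open>f\<close>
      and equality with \<open>f z\<close> once \<open>max_sum T f n (T z)\<close> exceeds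
      \<open>- f z\<close>.\<close>
    have d: "?d n z = max (- ?m n (T z)) (f z)" for n z by auto
    have "(\<lambda>n. \<integral>z. ?d n z \<partial>M) \<longlonglongrightarrow> (\<integral>z. f z \<partial>M)"
    proof (rule integral_dominated_convergence)
      show "integrable M (\<lambda>z. \<bar>f z\<bar>)" using f by simp
      show "AE z in M. norm (?d n z) \<le> \<bar>f z\<bar>" for n
      proof (intro AE_I2)
        fix z
        show "norm (?d n z) \<le> \<bar>f z\<bar>"
          unfolding d using max_sum_nonneg[of T f n "T z"] by auto
      qed
      show "AE z in M. (\<lambda>n. ?d n z) \<longlonglongrightarrow> f z"
        using AE_A
      proof eventually_elim
        case (elim z)
        then have "T z \<in> A" using inv[of z] by (auto simp: A_def)
        obtain K :: nat where K: "- f z < real K" using reals_Archimedean2 by blast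
        obtain N where N: "real K < ?m N (T z)" using \<open>T z \<in> A\<close> by (auto simp: A_def)
        have "?d n z = f z" if "n \<ge> N" for n
          using max_sum_mono[OF that, of T f "T z"] N K unfolding d by auto
        then show ?case
          by (intro tendsto_eventually eventually_sequentiallyI[of N])
      qed
    qed (use f in measurable)
    moreover have "(\<integral>z. ?d n z \<partial>M) \<ge> 0" for n
    proof -
      \<comment> \<open>Measure preservation removes \<open>T\<close>; what remains is nonnegative
        because the maxima grow with \<open>n\<close>.\<close>
      have "(\<integral>z. ?d n z \<partial>M) = (\<integral>z. ?m (Suc n) z \<partial>M) - (\<integral>z. ?m n z \<partial>M)"
        using int integrable_compose_T[OF int]
        by (subst Bochner_Integration.integral_diff) (auto simp: integral_compose_T simp del: max_sum.simps)
      also have "\<dots> \<ge> 0"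
        using integral_mono[OF int int max_sum_Suc_ge] by (simp del: max_sum.simps)
      finally show ?thesis .
    qed
    ultimately have "(\<integral>z. f z \<partial>M) \<ge> 0" by (intro LIMSEQ_le_const) auto
    with neg show False by simp
  qed
  moreover have "T -` A \<inter> space M = A" using inv by (auto simp: A_def)
  ultimately have "prob A = 0" using ergodic[OF A] by blast
  then have "AE z in M. z \<notin> A" using A by (simp add: prob_eq_0)
  then show ?thesis
    using AE_space
  proof eventually_elim
    case (elim z)
    then obtain K :: nat where "\<And>n. ?m n z \<le> real K" by (auto simp: A_def not_less)
    then show ?case using sum_le_max_sum[where T=T and f=f] order_trans by blast
  qed
qed

text \<open>Shifting \<open>f\<close> by its mean and a small \<open>e j\<close> makes the mean
  strictly negative, so the partial sums are bounded above; the same for \<open>- f\<close> bounds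
  them below. Dividing by \<open>n\<close> leaves an error of at most \<open>e j\<close>, and
  countably many \<open>j\<close> share one null set.\<close>

lemma birkhoff:
  fixes f :: "'a \<Rightarrow> real"
  assumes f: "integrable M f"
  shows "AE z in M. (\<lambda>n. (\<Sum>i<n. f ((T ^^ i) z)) / real n) \<longlonglongrightarrow> (\<integral>z. f z \<partial>M)"
proof -
  let ?S = "\<lambda>n z. \<Sum>i<n. f ((T ^^ i) z)"
  define E where "E = (\<integral>z. f z \<partial>M)"
  define e where "e j = 1 / real (Suc j)" for j
  have e: "e j > 0" for j by (simp add: e_def)
  have "AE z in M. \<forall>j. \<exists>K. \<forall>n. ?S n z - real n * (E + e j) \<le> K"
  proof (subst AE_all_countable, rule allI)
    fix j
    have "AE z in M. \<exists>K. \<forall>n. (\<Sum>i<n. f ((T ^^ i) z) - (E + e j)) \<le> K"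
      using f e[of j] by (intro partial_sums_bounded) (auto simp: prob_space E_def)
    then show "AE z in M. \<exists>K. \<forall>n. ?S n z - real n * (E + e j) \<le> K"
      by (simp add: sum_subtractf)
  qed
  moreover have "AE z in M. \<forall>j. \<exists>K. \<forall>n. real n * (E - e j) - ?S n z \<le> K"
  proof (subst AE_all_countable, rule allI)
    fix j
    have "AE z in M. \<exists>K. \<forall>n. (\<Sum>i<n. (E - e j) - f ((T ^^ i) z)) \<le> K"
      using f e[of j] by (intro partial_sums_bounded) (auto simp: prob_space E_def)
    then show "AE z in M. \<exists>K. \<forall>n. real n * (E - e j) - ?S n z \<le> K"
      by (simp add: sum_subtractf)
  qed
  ultimately have "AE z in M. (\<lambda>n. ?S n z / real n) \<longlonglongrightarrow> E"
  proof eventually_elim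
    case (elim z)
    show ?case
    proof (rule tendstoI)
      fix r :: real assume "r > 0"
      then obtain j where j: "e j < r / 2" unfolding e_def using nat_approx_posE[of "r / 2"] by auto
      obtain K1 K2 where K: "\<And>n. ?S n z - real n * (E + e j) \<le> K1" "\<And>n. real n * (E - e j) - ?S n z \<le> K2"
        using elim by metis
      define K where "K = max K1 K2"
      obtain N :: nat where N: "real N > 2 * K / r" using reals_Archimedean2 by blast
      have "dist (?S n z / real n) E < r" if n: "n \<ge> Suc N" for n
      proof -
        have "2 * K / r < real n" using N n by linarith
        then have "K < real n * (r / 2)" using \<open>r > 0\<close> by (simp add: field_simps)
        moreover have "real n * e j \<le> real n * (r / 2)" using j by (intro mult_left_mono) auto
        moreover have "?S n z - real n * E \<le> K + real n * e j" "real n * E - ?S n z \<le> K + real n * e j"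
          using K(1)[of n] K(2)[of n] by (auto simp: K_def algebra_simps)
        ultimately have "\<bar>?S n z - real n * E\<bar> < real n * r" by linarith
        moreover have "?S n z / real n - E = (?S n z - real n * E) / real n" using n by (simp add: field_simps)
        ultimately show ?thesis using n by (simp add: dist_real_def abs_divide field_simps)
      qed
      then show "\<forall>\<^sub>F n in sequentially. dist (?S n z / real n) E < r"
        by (intro eventually_sequentiallyI[of "Suc N"])
    qed
  qed
  then show ?thesis by (simp add: E_def)
qed

end

text \<open>The process need not come with a transformation of its own space. The ergodic theorem is
  applied to the shift under the law of the sequence, and the almost sure statement is pulled
  back.\<close>

lemma (in prob_space) stationary_ergodic_average:
  fixes Y :: "nat \<Rightarrow> 'a \<Rightarrow> ennreal"
  assumes Y [measurable]: "\<And>i. Y i \<in> borel_measurable M"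
    and stationary: "distr M (\<Pi>\<^sub>M i\<in>UNIV. borel) (\<lambda>\<omega> i. Y (Suc i) \<omega>) = distr M (\<Pi>\<^sub>M i\<in>UNIV. borel) (\<lambda>\<omega> i. Y i \<omega>)"
    and ergodic: "ergodic_sequence M borel Y"
    and int: "integrable M (\<lambda>\<omega>. enn2real (Y 0 \<omega>))"
  shows "AE \<omega> in M. (\<lambda>n. (\<Sum>i<n. enn2real (Y i \<omega>)) / real n) \<longlonglongrightarrow> (\<integral>\<omega>. enn2real (Y 0 \<omega>) \<partial>M)"
proof -
  let ?P = "\<Pi>\<^sub>M i\<in>(UNIV :: nat set). (borel :: ennreal measure)"
  let ?Q = "distr M ?P (\<lambda>\<omega> i. Y i \<omega>)"
  let ?T = "\<lambda>(z :: nat \<Rightarrow> ennreal) i. z (Suc i)"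
  have Ym [measurable]: "(\<lambda>\<omega> i. Y i \<omega>) \<in> M \<rightarrow>\<^sub>M ?P"
    by (intro measurable_PiM_single') (auto simp: space_PiM)
  have Tm: "?T \<in> ?P \<rightarrow>\<^sub>M ?P"
    by (intro measurable_PiM_single') (auto simp: space_PiM)
  have pow: "(?T ^^ i) z = (\<lambda>j. z (i + j))" for i z
    by (induction i arbitrary: z) (auto simp: fun_eq_iff)
  interpret Q: ergodic_map ?Q ?T
  proof (intro ergodic_map.intro ergodic_map_axioms.intro)
    show "prob_space ?Q" using Ym by (rule prob_space_distr)
    show "?T \<in> ?Q \<rightarrow>\<^sub>M ?Q" using Tm by simp
    have "distr ?Q ?Q ?T = distr ?Q ?P ?T" by (intro distr_cong) auto
    also have "\<dots> = distr M ?P (\<lambda>\<omega> i. Y (Suc i) \<omega>)"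
      using Tm by (subst distr_distr) (auto simp: o_def)
    finally show "distr ?Q ?Q ?T = ?Q" using stationary by simp
    fix A assume A: "A \<in> sets ?Q" "?T -` A \<inter> space ?Q = A"
    then have "measure M {\<omega> \<in> space M. (\<lambda>i. Y i \<omega>) \<in> A} \<in> {0, 1}"
      using ergodic unfolding ergodic_sequence_def by (auto simp: vimage_def Int_def conj_commute)
    moreover have "measure ?Q A = measure M {\<omega> \<in> space M. (\<lambda>i. Y i \<omega>) \<in> A}"
      using A Ym by (subst measure_distr) (auto simp: vimage_def Int_def conj_commute)
    ultimately show "measure ?Q A \<in> {0, 1}" by simp
  qed
  have fm [measurable]: "(\<lambda>z. enn2real (z 0)) \<in> borel_measurable ?P" by measurable
  have "integrable ?Q (\<lambda>z. enn2real (z 0))"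
    using int by (subst integrable_distr_eq) auto
  then have "AE z in ?Q. (\<lambda>n. (\<Sum>i<n. enn2real ((?T ^^ i) z 0)) / real n) \<longlonglongrightarrow> (\<integral>z. enn2real (z 0) \<partial>?Q)"
    by (rule Q.birkhoff)
  then have "AE z in ?Q. (\<lambda>n. (\<Sum>i<n. enn2real (z i)) / real n) \<longlonglongrightarrow> (\<integral>\<omega>. enn2real (Y 0 \<omega>) \<partial>M)"
    by (simp add: pow integral_distr)
  then show ?thesis by (rule AE_distrD[OF Ym])
qed

section \<open>Laws of truncated variations\<close>

text \<open>
  The right end point \<open>t\<close> is added to the rationals because right continuity cannot recover the value
  there from earlier times.
\<close>

definition rational_chains :: "real \<Rightarrow> real \<Rightarrow> real list set" where
  "rational_chains s t = {ts \<in> time_chains s t. set ts \<subseteq> insert t \<rat>}"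

lemma countable_rational_chains: "countable (rational_chains s t)"
proof (rule countable_subset)
  show "rational_chains s t \<subseteq> lists (insert t \<rat>)" by (auto simp: rational_chains_def)
  show "countable (lists (insert t \<rat>))" by (intro countable_lists) (simp add: countable_rat)
qed

text \<open>A countable supremum of functions of finitely many coordinates, hence measurable on the
  product space, whereas \<open>truncated_variation\<close> involves uncountably many times. Through
  it, equality of path laws passes to truncated variations.\<close>

definition tv_functional :: "real \<Rightarrow> real \<Rightarrow> real \<Rightarrow> (real \<Rightarrow> real) \<Rightarrow> ennreal" where
  "tv_functional c s t x = (SUP ts\<in>rational_chains s t. ennreal (truncated_sum c x ts))"

lemma tv_functional_cong:
  "(\<And>u. s \<le> u \<Longrightarrow> u \<le> t \<Longrightarrow> x u = y u) \<Longrightarrow> tv_functional c s t x = tv_functional c s t y"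
  unfolding tv_functional_def
  by (intro SUP_cong refl arg_cong[where f=ennreal] truncated_sum_cong) (auto simp: rational_chains_def time_chains_def)

text \<open>The times of a chain are moved right to a rational grid, or to \<open>t\<close> where
  this would overshoot. The move is monotone, so chains stay chains, and right continuity makes the
  sums converge.\<close>

lemma tv_functional_eq:
  assumes "cadlag x" "0 \<le> s" "s \<le> t" "c \<ge> 0"
  shows "tv_functional c s t x = truncated_variation c x s t"
proof (rule antisym)
  show "tv_functional c s t x \<le> truncated_variation c x s t"
    unfolding tv_functional_def using assms
    by (auto simp: rational_chains_def intro!: SUP_least truncated_sum_le_truncated_variation)
  show "truncated_variation c x s t \<le> tv_functional c s t x"
    unfolding truncated_variation_eq_chains[OF assms(4,3)]
  proof (rule SUP_least)
    fix ts assume ts: "ts \<in> time_chains s t"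
    define q where "q k v = min t ((real_of_int \<lfloor>real k * v\<rfloor> + 1) / real k)" for k :: nat and v
    have q: "v \<le> q k v \<and> q k v \<le> t \<and> q k v \<in> insert t \<rat>" if "k \<ge> 1" "v \<le> t" for k v
    proof -
      have "real k * v \<le> real_of_int \<lfloor>real k * v\<rfloor> + 1" by linarith
      then have "v \<le> (real_of_int \<lfloor>real k * v\<rfloor> + 1) / real k" using that by (simp add: field_simps)
      with that show ?thesis by (auto simp: q_def min_def)
    qed
    have q_mono: "q k u \<le> q k v" if "u \<le> v" for k u v
      using that unfolding q_def
      by (intro min.mono divide_right_mono add_mono) (auto intro!: floor_mono mult_left_mono)
    have "(\<lambda>k. x (q k v)) \<longlonglongrightarrow> x v" if v: "s \<le> v" "v \<le> t" for v
    proof (cases "v = t")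
      case True
      then have "q k v = t" if "k \<ge> 1" for k using q[OF that, of v] v by auto
      with True show ?thesis by (intro tendsto_eventually eventually_sequentiallyI[of 1]) auto
    next
      case False
      let ?g = "\<lambda>k. (real_of_int \<lfloor>real k * v\<rfloor> + 1) / real k"
      have g: "filterlim ?g (at_right v) sequentially" by (rule filterlim_grid_at_right)
      then have "?g \<longlonglongrightarrow> v" by (rule filterlim_mono) (auto simp: at_within_le_nhds)
      then have "\<forall>\<^sub>F k in sequentially. ?g k < t" using False v by (intro order_tendstoD) auto
      then have "\<forall>\<^sub>F k in sequentially. x (?g k) = x (q k v)" by eventually_elim (auto simp: q_def)
      moreover have "(x \<longlongrightarrow> x v) (at_right v)"
        using assms v by (simp add: cadlag_def continuous_within)
      then have "(\<lambda>k. x (?g k)) \<longlonglongrightarrow> x v" using g by (rule filterlim_compose)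
      ultimately show ?thesis by (rule Lim_transform_eventually[rotated])
    qed
    then have "(\<lambda>k. truncated_sum c (\<lambda>v. x (q k v)) ts) \<longlonglongrightarrow> truncated_sum c x ts"
      using ts by (intro tendsto_truncated_sum) (auto simp: time_chains_def)
    then have lim: "(\<lambda>k. ennreal (truncated_sum c (\<lambda>v. x (q k v)) ts)) \<longlonglongrightarrow> ennreal (truncated_sum c x ts)"
      by (rule tendsto_ennrealI)
    have "ennreal (truncated_sum c (\<lambda>v. x (q k v)) ts) \<le> tv_functional c s t x" if k: "k \<ge> 1" for k
    proof -
      have "sorted (map (q k) ts)"
        using ts unfolding sorted_map time_chains_def
        by (auto intro: sorted_wrt_mono_rel[of _ "(\<le>)"] q_mono)
      moreover have "s \<le> q k v \<and> q k v \<le> t \<and> q k v \<in> insert t \<rat>" if "v \<in> set ts" for v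
      proof -
        have "s \<le> v" "v \<le> t" using ts that by (auto simp: time_chains_def)
        with q[OF k, of v] show ?thesis by auto
      qed
      ultimately have "map (q k) ts \<in> rational_chains s t"
        by (auto simp: rational_chains_def time_chains_def)
      then show ?thesis
        unfolding tv_functional_def truncated_sum_map[symmetric] by (rule SUP_upper)
    qed
    then show "ennreal (truncated_sum c x ts) \<le> tv_functional c s t x"
      by (intro LIMSEQ_le_const2[OF lim]) blast
  qed
qed

lemma measurable_truncated_sum:
  assumes "\<And>u. u \<in> set ts \<Longrightarrow> (\<lambda>p. x p u) \<in> borel_measurable N"
  shows "(\<lambda>p. truncated_sum c (x p) ts) \<in> borel_measurable N"
  using assms
proof (induction ts rule: induct_list012)
  case (3 u v ts)
  then have [measurable]: "(\<lambda>p. x p u) \<in> borel_measurable N" "(\<lambda>p. x p v) \<in> borel_measurable N"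
    "(\<lambda>p. truncated_sum c (x p) (v # ts)) \<in> borel_measurable N" by auto
  show ?case unfolding truncated_sum.simps by measurable
qed auto

lemma measurable_tv_functional:
  assumes "0 \<le> s"
  shows "tv_functional c s t \<in> borel_measurable (\<Pi>\<^sub>M t\<in>{0..}. borel)"
proof -
  have "(\<lambda>x. truncated_sum c x ts) \<in> borel_measurable (\<Pi>\<^sub>M t\<in>{0..}. borel)" if "ts \<in> rational_chains s t" for ts
  proof (rule measurable_truncated_sum)
    fix u assume "u \<in> set ts"
    then have "u \<in> {0..}" using that assms by (auto simp: rational_chains_def time_chains_def)
    then show "(\<lambda>p. p u) \<in> borel_measurable (\<Pi>\<^sub>M t\<in>{0..}. borel)" by measurable
  qed
  then show ?thesis
    unfolding tv_functional_def[abs_def]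
    by (intro borel_measurable_SUP countable_rational_chains measurable_compose[OF _ measurable_ennreal])
qed

definition path_law :: "'w measure \<Rightarrow> (real \<Rightarrow> 'w \<Rightarrow> real) \<Rightarrow> (real \<Rightarrow> real) measure" where
  "path_law M X = distr M (\<Pi>\<^sub>M t\<in>{0..}. borel) (\<lambda>\<omega>. \<lambda>t\<in>{0..}. X t \<omega>)"

locale cadlag_process = prob_space +
  fixes X :: "real \<Rightarrow> 'a \<Rightarrow> real"
  assumes X_measurable [measurable]: "\<And>t. t \<ge> 0 \<Longrightarrow> X t \<in> borel_measurable M"
    and cadlag: "\<And>\<omega>. \<omega> \<in> space M \<Longrightarrow> cadlag (\<lambda>t. X t \<omega>)"
begin

lemma measurable_path: "(\<lambda>\<omega>. \<lambda>t\<in>{0..}. X t \<omega>) \<in> M \<rightarrow>\<^sub>M (\<Pi>\<^sub>M t\<in>{0..}. borel)"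
  by (intro measurable_restrict) (auto intro: X_measurable)

lemma tv_functional_path:
  assumes "\<omega> \<in> space M" "0 \<le> s" "s \<le> t" "c \<ge> 0"
  shows "tv_functional c s t (\<lambda>t\<in>{0..}. X t \<omega>) = truncated_variation c (\<lambda>t. X t \<omega>) s t"
proof -
  have "tv_functional c s t (\<lambda>t\<in>{0..}. X t \<omega>) = tv_functional c s t (\<lambda>t. X t \<omega>)"
    using assms by (intro tv_functional_cong) auto
  then show ?thesis using assms cadlag by (simp add: tv_functional_eq)
qed

lemma measurable_truncated_variation:
  assumes "0 \<le> s" "s \<le> t" "c \<ge> 0"
  shows "(\<lambda>\<omega>. truncated_variation c (\<lambda>t. X t \<omega>) s t) \<in> borel_measurable M"
proof -
  have "(\<lambda>\<omega>. tv_functional c s t (\<lambda>t\<in>{0..}. X t \<omega>)) \<in> borel_measurable M"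
    using measurable_path measurable_tv_functional[OF assms(1)] by (rule measurable_compose)
  then show ?thesis
    by (rule measurable_cong[THEN iffD1, rotated]) (use assms in \<open>simp add: tv_functional_path\<close>)
qed

lemma distr_truncated_variation:
  assumes "0 \<le> s" "s \<le> t" "c \<ge> 0"
  shows "distr M borel (\<lambda>\<omega>. truncated_variation c (\<lambda>t. X t \<omega>) s t)
    = distr (path_law M X) borel (tv_functional c s t)"
proof -
  have "distr (path_law M X) borel (tv_functional c s t)
      = distr M borel (\<lambda>\<omega>. tv_functional c s t (\<lambda>t\<in>{0..}. X t \<omega>))"
    unfolding path_law_def using measurable_tv_functional[OF assms(1)] measurable_path
    by (subst distr_distr) (auto simp: o_def)
  also have "\<dots> = distr M borel (\<lambda>\<omega>. truncated_variation c (\<lambda>t. X t \<omega>) s t)"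
    using assms by (intro distr_cong) (auto simp: tv_functional_path)
  finally show ?thesis ..
qed

lemma distr_truncated_variation_seq:
  assumes "\<And>i::nat. 0 \<le> s i" "\<And>i. s i \<le> t i" "c \<ge> 0"
  shows "distr M (\<Pi>\<^sub>M i\<in>UNIV. borel) (\<lambda>\<omega> i. truncated_variation c (\<lambda>t. X t \<omega>) (s i) (t i))
    = distr (path_law M X) (\<Pi>\<^sub>M i\<in>UNIV. borel) (\<lambda>x i. tv_functional c (s i) (t i) x)"
proof -
  have "(\<lambda>x i. tv_functional c (s i) (t i) x) \<in> (\<Pi>\<^sub>M t\<in>{0..}. borel) \<rightarrow>\<^sub>M (\<Pi>\<^sub>M i\<in>(UNIV::nat set). borel)"
    using assms by (intro measurable_PiM_single' measurable_tv_functional) (auto simp: space_PiM)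
  then have "distr (path_law M X) (\<Pi>\<^sub>M i\<in>UNIV. borel) (\<lambda>x i. tv_functional c (s i) (t i) x)
      = distr M (\<Pi>\<^sub>M i\<in>UNIV. borel) (\<lambda>\<omega> i. tv_functional c (s i) (t i) (\<lambda>t\<in>{0..}. X t \<omega>))"
    unfolding path_law_def using measurable_path by (subst distr_distr) (auto simp: o_def)
  also have "\<dots> = distr M (\<Pi>\<^sub>M i\<in>UNIV. borel) (\<lambda>\<omega> i. truncated_variation c (\<lambda>t. X t \<omega>) (s i) (t i))"
    using assms by (intro distr_cong) (auto simp: tv_functional_path)
  finally show ?thesis ..
qed

end

section \<open>Shifted and rescaled processes\<close>

lemma cadlag_rescale:
  assumes "cadlag x" "B > 0"
  shows "cadlag (\<lambda>t. a * x (B * t))"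
  unfolding cadlag_def
proof (intro conjI allI impI)
  fix t :: real assume t: "t \<ge> 0"
  have "filterlim (\<lambda>u. B * u) (at_right (B * t)) (at_right t)"
    unfolding filterlim_at using assms(2)
    by (auto intro!: tendsto_intros simp: eventually_at_filter)
  moreover have "(x \<longlongrightarrow> x (B * t)) (at_right (B * t))"
    using assms t by (simp add: cadlag_def continuous_within)
  ultimately have "((\<lambda>u. x (B * u)) \<longlongrightarrow> x (B * t)) (at_right t)" by (rule filterlim_compose[rotated])
  then show "continuous (at_right t) (\<lambda>t. a * x (B * t))"
    unfolding continuous_within by (rule tendsto_mult_left)
next
  fix t :: real assume t: "t > 0"
  have "filterlim (\<lambda>u. B * u) (at_left (B * t)) (at_left t)"
    unfolding filterlim_at using assms(2)
    by (auto intro!: tendsto_intros simp: eventually_at_filter)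
  moreover obtain l where "(x \<longlongrightarrow> l) (at_left (B * t))"
    using assms t unfolding cadlag_def by (metis mult_pos_pos)
  ultimately have "((\<lambda>u. x (B * u)) \<longlongrightarrow> l) (at_left t)" by (rule filterlim_compose[rotated])
  then have "((\<lambda>t. a * x (B * t)) \<longlongrightarrow> a * l) (at_left t)" by (rule tendsto_mult_left)
  then show "\<exists>l. ((\<lambda>t. a * x (B * t)) \<longlongrightarrow> l) (at_left t)" ..
qed

lemma cadlag_shift:
  assumes "cadlag x" "h \<ge> 0"
  shows "cadlag (\<lambda>t. x (t + h) - a)"
  unfolding cadlag_def
proof (intro conjI allI impI)
  fix t :: real assume t: "t \<ge> 0"
  have "filterlim (\<lambda>u. u + h) (at_right (t + h)) (at_right t)"
    unfolding filterlim_at by (auto intro!: tendsto_intros simp: eventually_at_filter)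
  moreover have "(x \<longlongrightarrow> x (t + h)) (at_right (t + h))"
    using assms t by (simp add: cadlag_def continuous_within)
  ultimately have "((\<lambda>u. x (u + h)) \<longlongrightarrow> x (t + h)) (at_right t)" by (rule filterlim_compose[rotated])
  then show "continuous (at_right t) (\<lambda>t. x (t + h) - a)"
    unfolding continuous_within by (intro tendsto_intros)
next
  fix t :: real assume t: "t > 0"
  have "filterlim (\<lambda>u. u + h) (at_left (t + h)) (at_left t)"
    unfolding filterlim_at by (auto intro!: tendsto_intros simp: eventually_at_filter)
  moreover obtain l where "(x \<longlongrightarrow> l) (at_left (t + h))"
    using assms t unfolding cadlag_def by (metis add_pos_nonneg)
  ultimately have "((\<lambda>u. x (u + h)) \<longlongrightarrow> l) (at_left t)" by (rule filterlim_compose[rotated])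
  then have "((\<lambda>t. x (t + h) - a) \<longlongrightarrow> l - a) (at_left t)" by (intro tendsto_intros)
  then show "\<exists>l. ((\<lambda>t. x (t + h) - a) \<longlongrightarrow> l) (at_left t)" ..
qed

text \<open>The hypothesis concerns consecutive increments at finitely many times. Once 0 is among
  the times, \<open>X (t + h) - X h\<close> is a partial sum of such increments, so a cylinder event
  becomes the event \<open>B\<close> of the increment vector, the same for every shift; cylinder
  events determine the law. The right-hand side keeps the shift 0 visible so that both sides are
  instances of one process.\<close>

lemma (in cadlag_process) path_law_increments:
  assumes st: "stationary_increments M X" and h: "h > 0"
  shows "path_law M (\<lambda>t \<omega>. X (t + h) \<omega> - X h \<omega>) = path_law M (\<lambda>t \<omega>. X (t + 0) \<omega> - X 0 \<omega>)"
  unfolding path_law_def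
proof (rule measure_eqI_PiM_infinite)
  let ?P = "\<Pi>\<^sub>M t\<in>{0::real..}. (borel :: real measure)"
  let ?Z = "\<lambda>h \<omega>. \<lambda>t\<in>{0..}. X (t + h) \<omega> - X h \<omega>"
  have Zm: "?Z k \<in> M \<rightarrow>\<^sub>M ?P" if "k \<ge> 0" for k
    using that by (intro measurable_restrict borel_measurable_diff X_measurable) auto
  show "finite_measure (distr M ?P (?Z h))"
    using Zm[of h] h by (intro finite_measure.finite_measure_distr) (auto intro: finite_measure_axioms)
  fix A :: "real \<Rightarrow> real set" and J :: "real set"
  assume J: "finite J" "J \<subseteq> {0..}" and A: "\<And>i. i \<in> J \<Longrightarrow> A i \<in> sets borel"
  obtain L where L: "set L = insert 0 J" "sorted_wrt (<) L"
    using J by (metis sorted_list_of_set.finite_set_strict_sorted finite_insert)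
  define n where "n = length L"
  define t where "t i = L ! (i - 1)" for i :: nat
  have n: "n \<ge> 1" using L(1) by (cases L) (auto simp: n_def)
  have t_less: "t i < t (i + 1)" if "i \<in> {1..<n}" for i
    using that sorted_wrt_nth_less[OF L(2), of "i - 1" i] by (auto simp: t_def n_def)
  have t_ge: "t i \<ge> 0" if "i \<in> {1..n}" for i
  proof -
    have "t i \<in> set L" using that by (auto simp: t_def n_def)
    with L J show ?thesis by auto
  qed
  have t1: "t 1 = 0"
  proof -
    have "0 \<in> set L" using L(1) by simp
    then obtain k where k: "k < n" "L ! k = 0" by (auto simp: in_set_conv_nth n_def)
    have "k = 0"
    proof (rule ccontr)
      assume "k \<noteq> 0"
      then have "t 1 < 0" using sorted_wrt_nth_less[OF L(2), of 0 k] k by (auto simp: t_def n_def)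
      with t_ge[of 1] n show False by auto
    qed
    with k show ?thesis by (simp add: t_def)
  qed
  have all_J: "(\<forall>u\<in>J. Q u) \<longleftrightarrow> (\<forall>i\<in>{1..n}. t i \<in> J \<longrightarrow> Q (t i))" for Q
  proof -
    have "\<exists>i\<in>{1..n}. t i = u" if "u \<in> J" for u
    proof -
      have "u \<in> set L" using that L(1) by simp
      then obtain k where "k < n" "L ! k = u" by (auto simp: in_set_conv_nth n_def)
      then show ?thesis by (intro bexI[of _ "Suc k"]) (auto simp: t_def)
    qed
    then show ?thesis by blast
  qed
  let ?D = "\<Pi>\<^sub>M i\<in>{1..<n}. (borel :: real measure)"
  let ?W = "\<lambda>h \<omega>. \<lambda>i\<in>{1..<n}. X (t (i + 1) + h) \<omega> - X (t i + h) \<omega>"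
  define B where "B = {d \<in> space ?D. \<forall>i\<in>{1..n}. t i \<in> J \<longrightarrow> (\<Sum>j\<in>{1..<i}. d j) \<in> A (t i)}"
  have Bm: "B \<in> sets ?D"
  proof -
    have [measurable]: "(\<lambda>d. \<Sum>j\<in>{1..<i}. d j) \<in> borel_measurable ?D" if "i \<in> {1..n}" for i
      using that by (intro borel_measurable_sum measurable_component_singleton) auto
    have "{d \<in> space ?D. t i \<in> J \<longrightarrow> (\<Sum>j\<in>{1..<i}. d j) \<in> A (t i)} \<in> sets ?D" if "i \<in> {1..n}" for i
    proof (cases "t i \<in> J")
      case True
      then have [measurable]: "A (t i) \<in> sets borel" by (rule A)
      show ?thesis using that True by simp
    qed simp
    then show ?thesis unfolding B_def by (intro sets.sets_Collect_finite_All) auto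
  qed
  have Wm: "?W k \<in> M \<rightarrow>\<^sub>M ?D" if "k \<ge> 0" for k
    using that by (intro measurable_restrict borel_measurable_diff X_measurable add_nonneg_nonneg t_ge) auto
  have key: "emeasure (distr M ?P (?Z k)) (prod_emb {0..} (\<lambda>_. borel) J (Pi\<^sub>E J A))
      = emeasure (distr M ?D (?W k)) B" if k: "k \<ge> 0" for k
  proof -
    have tel: "(\<Sum>j\<in>{1..<i}. ?W k \<omega> j) = X (t i + k) \<omega> - X k \<omega>" if "i \<in> {1..n}" for i \<omega>
    proof -
      have "(\<Sum>j\<in>{1..<i}. ?W k \<omega> j) = (\<Sum>j\<in>{1..<i}. X (t (Suc j) + k) \<omega> - X (t j + k) \<omega>)"
        using that by (intro sum.cong) auto
      also have "\<dots> = X (t i + k) \<omega> - X (t 1 + k) \<omega>"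
        using that by (subst sum_Suc_diff') auto
      finally show ?thesis unfolding t1 add_0 .
    qed
    have "emeasure (distr M ?P (?Z k)) (prod_emb {0..} (\<lambda>_. borel) J (Pi\<^sub>E J A))
        = emeasure M (?Z k -` prod_emb {0..} (\<lambda>_. borel) J (Pi\<^sub>E J A) \<inter> space M)"
      using J A Zm[OF k] by (intro emeasure_distr sets_PiM_I) auto
    also have "?Z k -` prod_emb {0..} (\<lambda>_. borel) J (Pi\<^sub>E J A) \<inter> space M
        = {\<omega> \<in> space M. \<forall>u\<in>J. X (u + k) \<omega> - X k \<omega> \<in> A u}"
      using J(2) by (auto simp: prod_emb_def space_PiM PiE_iff extensional_def restrict_def subset_iff)
    also have "\<dots> = ?W k -` B \<inter> space M"
      unfolding all_J using tel measurable_space[OF Wm[OF k]] by (auto simp: B_def)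
    also have "emeasure M \<dots> = emeasure (distr M ?D (?W k)) B"
      using Wm[OF k] Bm by (rule emeasure_distr[symmetric])
    finally show ?thesis .
  qed
  have "distr M ?D (\<lambda>\<omega>. \<lambda>i\<in>{1..<n}. X (t (i + 1)) \<omega> - X (t i) \<omega>) = distr M ?D (?W h)"
    using st n t1 t_less h unfolding stationary_increments_def by simp
  then have "distr M ?D (?W 0) = distr M ?D (?W h)" by simp
  then show "emeasure (distr M ?P (?Z h)) (prod_emb {0..} (\<lambda>_. borel) J (Pi\<^sub>E J A))
      = emeasure (distr M ?P (?Z 0)) (prod_emb {0..} (\<lambda>_. borel) J (Pi\<^sub>E J A))"
    using key[of h] key[of 0] h by simp
qed (auto simp: space_PiM)

lemma (in cadlag_process) shifted_process:
  "h \<ge> 0 \<Longrightarrow> cadlag_process M (\<lambda>t \<omega>. X (t + h) \<omega> - X h \<omega>)"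
  by unfold_locales (auto intro!: borel_measurable_diff X_measurable cadlag_shift cadlag)

lemma (in cadlag_process) rescaled_process:
  "A > 0 \<Longrightarrow> cadlag_process M (\<lambda>t \<omega>. a * X (A * t) \<omega>)"
  by unfold_locales (auto intro!: borel_measurable_times X_measurable cadlag_rescale cadlag)

text \<open>Truncated variation ignores the additive constant \<open>X h\<close>, so the law of the
  increments is enough. The joint law of the sequence is needed for stationarity of the block
  sequences.\<close>

lemma (in cadlag_process) distr_truncated_variation_seq_shift:
  assumes "stationary_increments M X" "h > 0" "\<And>i::nat. 0 \<le> s i" "\<And>i. s i \<le> t i" "c \<ge> 0"
  shows "distr M (\<Pi>\<^sub>M i\<in>UNIV. borel) (\<lambda>\<omega> i. truncated_variation c (\<lambda>t. X t \<omega>) (s i + h) (t i + h))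
    = distr M (\<Pi>\<^sub>M i\<in>UNIV. borel) (\<lambda>\<omega> i. truncated_variation c (\<lambda>t. X t \<omega>) (s i) (t i))"
proof -
  have *: "distr M (\<Pi>\<^sub>M i\<in>UNIV. borel) (\<lambda>\<omega> i. truncated_variation c (\<lambda>t. X t \<omega>) (s i + k) (t i + k))
    = distr (path_law M (\<lambda>t \<omega>. X (t + k) \<omega> - X k \<omega>)) (\<Pi>\<^sub>M i\<in>UNIV. borel) (\<lambda>x i. tv_functional c (s i) (t i) x)"
    if "k \<ge> 0" for k
    using cadlag_process.distr_truncated_variation_seq[OF shifted_process[OF that] assms(3-5)]
    unfolding truncated_variation_shift[OF assms(5,4), where x="\<lambda>t. X t _"] .
  show ?thesis
    using *[of h] *[of 0] assms(2) path_law_increments[OF assms(1,2)] by simp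
qed

lemma (in cadlag_process) distr_truncated_variation_shift:
  assumes "stationary_increments M X" "h > 0" "0 \<le> s" "s \<le> t" "c \<ge> 0"
  shows "distr M borel (\<lambda>\<omega>. truncated_variation c (\<lambda>t. X t \<omega>) (s + h) (t + h))
    = distr M borel (\<lambda>\<omega>. truncated_variation c (\<lambda>t. X t \<omega>) s t)"
proof -
  have *: "distr M borel (\<lambda>\<omega>. truncated_variation c (\<lambda>t. X t \<omega>) (s + k) (t + k))
    = distr (path_law M (\<lambda>t \<omega>. X (t + k) \<omega> - X k \<omega>)) borel (tv_functional c s t)"
    if "k \<ge> 0" for k
    using cadlag_process.distr_truncated_variation[OF shifted_process[OF that] assms(3-5)]
    unfolding truncated_variation_shift[OF assms(5,4), where x="\<lambda>t. X t _"] .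
  show ?thesis
    using *[of h] *[of 0] assms(2) path_law_increments[OF assms(1,2)] by simp
qed

text \<open>Choosing the threshold equal to the factor \<open>A powr (- \<beta>)\<close> trades a
  small threshold for threshold 1 on a long interval.\<close>

lemma (in cadlag_process) distr_truncated_variation_self_similar:
  assumes "self_similar M X \<beta>" "A > 0" "0 \<le> t"
  shows "distr M borel (\<lambda>\<omega>. truncated_variation (A powr (- \<beta>)) (\<lambda>t. X t \<omega>) 0 t)
    = distr M borel (\<lambda>\<omega>. ennreal (A powr (- \<beta>)) * truncated_variation 1 (\<lambda>t. X t \<omega>) 0 (A * t))"
proof -
  let ?a = "A powr (- \<beta>)"
  have "path_law M (\<lambda>t \<omega>. ?a * X (A * t) \<omega>) = path_law M X"
    using assms by (simp add: self_similar_def path_law_def)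
  then have "distr M borel (\<lambda>\<omega>. truncated_variation ?a (\<lambda>t. ?a * X (A * t) \<omega>) 0 t)
      = distr M borel (\<lambda>\<omega>. truncated_variation ?a (\<lambda>t. X t \<omega>) 0 t)"
    using cadlag_process.distr_truncated_variation[OF rescaled_process[OF assms(2)], of 0 t ?a ?a]
      distr_truncated_variation[of 0 t ?a] assms by simp
  moreover have "truncated_variation ?a (\<lambda>t. ?a * X (A * t) \<omega>) 0 t
      = ennreal ?a * truncated_variation 1 (\<lambda>t. X t \<omega>) 0 (A * t)" for \<omega>
    using truncated_variation_scale[of 1 0 t ?a A "\<lambda>t. X t \<omega>"] assms by simp
  ultimately show ?thesis by simp
qed

section \<open>Growth of the truncated variation\<close>

definition real_tv :: "real \<Rightarrow> (real \<Rightarrow> real) \<Rightarrow> real \<Rightarrow> real \<Rightarrow> real" where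
  "real_tv c x s t = enn2real (truncated_variation c x s t)"

lemma ennreal_real_tv:
  assumes "cadlag x" "0 \<le> s" "s \<le> t" "c > 0"
  shows "ennreal (real_tv c x s t) = truncated_variation c x s t"
  using truncated_variation_finite[OF assms] by (simp add: real_tv_def)

lemma real_tv_nonneg: "real_tv c x s t \<ge> 0"
  by (simp add: real_tv_def)

lemma real_tv_superadd:
  assumes "cadlag x" "0 \<le> s" "s \<le> r" "r \<le> t" "c > 0"
  shows "real_tv c x s r + real_tv c x r t \<le> real_tv c x s t"
proof -
  have "ennreal (real_tv c x s r + real_tv c x r t) \<le> ennreal (real_tv c x s t)"
    using truncated_variation_superadd[of c s r t x] assms
    by (simp add: ennreal_plus[OF real_tv_nonneg real_tv_nonneg] ennreal_real_tv del: ennreal_plus)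
  then show ?thesis by (rule ennreal_le_iff[THEN iffD1, rotated]) (rule real_tv_nonneg)
qed

lemma real_tv_subadd:
  assumes "cadlag x" "0 \<le> s" "s \<le> r" "r \<le> t" "c > 0"
  shows "real_tv c x s t \<le> real_tv c x s r + real_tv c x r t + c"
proof -
  have "ennreal (real_tv c x s t) \<le> ennreal (real_tv c x s r + real_tv c x r t + c)"
    using truncated_variation_subadd[of c s r t x] assms
    by (simp add: ennreal_plus real_tv_nonneg ennreal_real_tv)
  then show ?thesis
    by (rule ennreal_le_iff[THEN iffD1, rotated]) (use assms in \<open>auto intro!: add_nonneg_nonneg real_tv_nonneg\<close>)
qed

lemma real_tv_mono:
  assumes "cadlag x" "0 \<le> s" "s \<le> t" "c > 0"
  shows "real_tv c x 0 s \<le> real_tv c x 0 t"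
  using real_tv_superadd[OF assms(1), of 0 s t c] assms real_tv_nonneg[of c x s t] by simp

lemma real_tv_blocks:
  assumes "cadlag x" "c > 0"
  shows "(\<Sum>i<n. real_tv c x (real (i * k)) (real ((i + 1) * k))) \<le> real_tv c x 0 (real (n * k))"
    and "real_tv c x 0 (real (n * k)) \<le> (\<Sum>i<n. real_tv c x (real (i * k)) (real ((i + 1) * k))) + c * real n"
proof (induction n)
  case (Suc n)
  {
    case 1
    then show ?case
      using Suc real_tv_superadd[OF assms(1), of 0 "real (n * k)" "real ((n + 1) * k)" c] assms(2) by simp
  next
    case 2
    then show ?case
      using Suc real_tv_subadd[OF assms(1), of 0 "real (n * k)" "real ((n + 1) * k)" c] assms(2)
      by (simp add: algebra_simps)
  }
qed (use assms in \<open>auto simp: real_tv_def truncated_variation_self\<close>)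

text \<open>With \<open>m k T\<close> complete blocks, \<open>V T / T\<close> is squeezed between
  two quantities whose limits differ by \<open>1 / real k\<close>. Squeezing it by two block lengths
  at once compares their averages; hence the supremum of \<open>a k / real k\<close> lies within
  \<open>1 / real k\<close> of each of them and is the limit.\<close>

lemma block_averages_limit:
  fixes V :: "real \<Rightarrow> real" and S :: "nat \<Rightarrow> nat \<Rightarrow> real" and a :: "nat \<Rightarrow> real"
  assumes mono: "\<And>s t. 0 \<le> s \<Longrightarrow> s \<le> t \<Longrightarrow> V s \<le> V t"
    and lim: "\<And>k. k \<ge> 1 \<Longrightarrow> (\<lambda>n. S k n / real n) \<longlonglongrightarrow> a k"
    and lo: "\<And>k n. k \<ge> 1 \<Longrightarrow> S k n \<le> V (real (n * k))"
    and hi: "\<And>k n. k \<ge> 1 \<Longrightarrow> V (real (n * k)) \<le> S k n + real n"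
  shows "\<exists>C. ((\<lambda>T. V T / T) \<longlongrightarrow> C) at_top \<and> (\<forall>k\<ge>1. a k / real k \<le> C \<and> C \<le> a k / real k + 1 / real k)"
proof -
  define m where "m k T = nat \<lfloor>T / real k\<rfloor>" for k :: nat and T :: real
  define lf where "lf k T = S k (m k T) / real (m k T) * (real (m k T) / T)" for k T
  define uf where "uf k T = (S k (m k T + 1) / real (m k T + 1) + 1) * (real (m k T + 1) / T)" for k T
  have m: "real (m k T) \<le> T / real k" "T / real k \<le> real (m k T + 1)" if "k \<ge> 1" "T \<ge> 0" for k T
    using that of_nat_floor[of "T / real k"] unfolding m_def by (auto, linarith)
  have m_top: "filterlim (m k) sequentially at_top" if k: "k \<ge> 1" for k
    unfolding filterlim_at_top
  proof
    fix N
    have "N \<le> m k T" if "T \<ge> real (N * k)" for T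
    proof -
      have "real N \<le> T / real k" using that k by (simp add: field_simps)
      then show ?thesis unfolding m_def by (simp add: le_nat_floor)
    qed
    then show "\<forall>\<^sub>F T in at_top. N \<le> m k T" by (intro eventually_at_top_linorderI[of "real (N * k)"])
  qed
  have inv: "((\<lambda>T::real. 1 / T) \<longlongrightarrow> 0) at_top"
    using tendsto_inverse_0_at_top[OF filterlim_ident] by (simp add: inverse_eq_divide)
  have ratio: "((\<lambda>T. real (m k T) / T) \<longlongrightarrow> 1 / real k) at_top" if k: "k \<ge> 1" for k
  proof (rule tendsto_sandwich[of "\<lambda>T. 1 / real k - 1 / T" _ _ "\<lambda>_. 1 / real k"])
    have "((\<lambda>T::real. 1 / real k - 1 / T) \<longlongrightarrow> 1 / real k - 0) at_top" using inv by (intro tendsto_intros)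
    then show "((\<lambda>T::real. 1 / real k - 1 / T) \<longlongrightarrow> 1 / real k) at_top" by simp
    show "\<forall>\<^sub>F T in at_top. 1 / real k - 1 / T \<le> real (m k T) / T"
    proof (rule eventually_at_top_linorderI[of 1])
      fix T :: real assume T: "T \<ge> 1"
      have "(T / real k - 1) / T \<le> real (m k T) / T"
        using m(2)[OF k, of T] T by (intro divide_right_mono) auto
      then show "1 / real k - 1 / T \<le> real (m k T) / T" using T by (simp add: diff_divide_distrib)
    qed
    show "\<forall>\<^sub>F T in at_top. real (m k T) / T \<le> 1 / real k"
    proof (rule eventually_at_top_linorderI[of 1])
      fix T :: real assume T: "T \<ge> 1"
      have "real (m k T) / T \<le> (T / real k) / T"
        using m(1)[OF k, of T] T by (intro divide_right_mono) auto
      then show "real (m k T) / T \<le> 1 / real k" using T by simp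
    qed
  qed simp
  have lf: "(lf k \<longlongrightarrow> a k / real k) at_top" if k: "k \<ge> 1" for k
  proof -
    have "((\<lambda>T. S k (m k T) / real (m k T)) \<longlongrightarrow> a k) at_top"
      using lim[OF k] m_top[OF k] by (rule filterlim_compose)
    from tendsto_mult[OF this ratio[OF k]] show ?thesis by (simp add: lf_def[abs_def])
  qed
  have uf: "(uf k \<longlongrightarrow> (a k + 1) / real k) at_top" if k: "k \<ge> 1" for k
  proof -
    have "filterlim (\<lambda>T. m k T + 1) sequentially at_top"
      by (rule filterlim_at_top_mono[OF m_top[OF k]]) simp
    with lim[OF k] have "((\<lambda>T. S k (m k T + 1) / real (m k T + 1)) \<longlongrightarrow> a k) at_top"
      by (rule filterlim_compose)
    moreover have "((\<lambda>T. real (m k T) / T + 1 / T) \<longlongrightarrow> 1 / real k + 0) at_top"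
      using ratio[OF k] inv by (intro tendsto_add)
    then have "((\<lambda>T. real (m k T + 1) / T) \<longlongrightarrow> 1 / real k) at_top"
      by (simp add: add_divide_distrib add.commute)
    ultimately have "(uf k \<longlongrightarrow> (a k + 1) * (1 / real k)) at_top"
      unfolding uf_def[abs_def] by (intro tendsto_mult tendsto_add tendsto_const)
    then show ?thesis by simp
  qed
  have bounds: "\<forall>\<^sub>F T in at_top. lf k T \<le> V T / T \<and> V T / T \<le> uf k T" if k: "k \<ge> 1" for k
  proof (rule eventually_at_top_linorderI[of "real k"])
    fix T :: real assume T: "T \<ge> real k"
    with k have T0: "T > 0" by linarith
    have "1 \<le> T / real k" using T k by (simp add: field_simps)
    then have m1: "m k T \<ge> 1" unfolding m_def by (simp add: le_nat_floor)
    have "real (m k T * k) \<le> T" "T \<le> real ((m k T + 1) * k)"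
      using m[OF k, of T] T0 k by (auto simp: field_simps)
    then have "V (real (m k T * k)) \<le> V T" "V T \<le> V (real ((m k T + 1) * k))"
      using T0 by (auto intro!: mono)
    then have "S k (m k T) \<le> V T" "V T \<le> S k (m k T + 1) + real (m k T + 1)"
      using lo[OF k, of "m k T"] hi[OF k, of "m k T + 1"] by linarith+
    moreover have "lf k T = S k (m k T) / T" using m1 by (simp add: lf_def)
    moreover have "uf k T = (S k (m k T + 1) + real (m k T + 1)) / T"
      unfolding uf_def by (simp add: distrib_right add_divide_distrib del: of_nat_Suc of_nat_add)
    ultimately show "lf k T \<le> V T / T \<and> V T / T \<le> uf k T"
      using T0 by (simp add: divide_right_mono)
  qed
  define r where "r k = a k / real k" for k
  have rr: "r k \<le> r j + 1 / real j" if "k \<ge> 1" "j \<ge> 1" for k j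
  proof -
    have "\<forall>\<^sub>F T in at_top. lf k T \<le> uf j T"
      using bounds[OF that(1)] bounds[OF that(2)] by eventually_elim linarith
    then have "a k / real k \<le> (a j + 1) / real j"
      using uf[OF that(2)] lf[OF that(1)] by (intro tendsto_le[of at_top]) auto
    then show ?thesis by (simp add: r_def add_divide_distrib)
  qed
  define C where "C = Sup (r ` {1..})"
  have bdd: "bdd_above (r ` {1..})" using rr[of _ 1] by (intro bdd_aboveI[of _ "r 1 + 1"]) auto
  have C: "r k \<le> C" "C \<le> r k + 1 / real k" if "k \<ge> 1" for k
    unfolding C_def using that rr[OF _ that] bdd by (auto intro!: cSup_upper cSup_least)
  have "((\<lambda>T. V T / T) \<longlongrightarrow> C) at_top"
  proof (rule tendstoI)
    fix e :: real assume e: "e > 0"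
    obtain k :: nat where k: "k > 0" "1 / real k < e / 2"
      using nat_approx_posE[of "e / 2"] e by (metis half_gt_zero of_nat_Suc zero_less_Suc)
    then have k1: "k \<ge> 1" by simp
    have "\<forall>\<^sub>F T in at_top. lf k T > r k - e / 2"
      using lf[OF k1] e by (intro order_tendstoD) (auto simp: r_def)
    moreover have "\<forall>\<^sub>F T in at_top. uf k T < r k + 1 / real k + e / 2"
      using uf[OF k1] e by (intro order_tendstoD) (auto simp: r_def add_divide_distrib)
    ultimately show "\<forall>\<^sub>F T in at_top. dist (V T / T) C < e"
      using bounds[OF k1]
    proof eventually_elim
      case (elim T)
      then show ?case using C[OF k1] k(2) by (simp add: dist_real_def abs_less_iff)
    qed
  qed
  with C show ?thesis unfolding r_def by blast
qed

text \<open>Monotonicity squeezes \<open>g n t\<close> between rational times on either side, where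
  the limits differ little from \<open>C * t\<close>. This yields all times on a single
  event.\<close>

lemma monotone_tendsto_from_rationals:
  fixes g :: "nat \<Rightarrow> real \<Rightarrow> real"
  assumes mono: "\<And>n s t. 0 \<le> s \<Longrightarrow> s \<le> t \<Longrightarrow> g n s \<le> g n t" and C: "C \<ge> 0"
    and rat: "\<And>q. q \<in> \<rat> \<Longrightarrow> 0 \<le> q \<Longrightarrow> (\<lambda>n. g n q) \<longlonglongrightarrow> C * q"
    and t: "0 \<le> t"
  shows "(\<lambda>n. g n t) \<longlonglongrightarrow> C * t"
proof (cases "t = 0")
  case True
  then show ?thesis using rat[of 0] by simp
next
  case False
  show ?thesis
  proof (rule tendstoI)
    fix e :: real assume e: "e > 0"
    define d where "d = e / (2 * (C + 1))"
    have d: "d > 0" "C * d \<le> e / 2" using C e by (auto simp: d_def field_simps)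
    obtain q1 where q1: "q1 \<in> \<rat>" "max 0 (t - d) < q1" "q1 < t"
      using Rats_dense_in_real[of "max 0 (t - d)" t] False t d by auto
    obtain q2 where q2: "q2 \<in> \<rat>" "t < q2" "q2 < t + d"
      using Rats_dense_in_real[of t "t + d"] d by auto
    have c1: "C * (t - d) \<le> C * q1" and c2: "C * q2 \<le> C * (t + d)"
      using C q1 q2 by (auto intro!: mult_left_mono)
    have "\<forall>\<^sub>F n in sequentially. g n q1 > C * q1 - e / 2"
      using rat[OF q1(1)] q1 e by (intro order_tendstoD) auto
    moreover have "\<forall>\<^sub>F n in sequentially. g n q2 < C * q2 + e / 2"
      using rat[OF q2(1)] q2 t e by (intro order_tendstoD) auto
    ultimately show "\<forall>\<^sub>F n in sequentially. dist (g n t) (C * t) < e"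
    proof eventually_elim
      case (elim n)
      have "g n q1 \<le> g n t" "g n t \<le> g n q2" using q1 q2 t by (auto intro!: mono)
      with elim c1 c2 d show ?case
        unfolding dist_real_def abs_less_iff by (auto simp: algebra_simps)
    qed
  qed
qed

lemma nn_integral_eq_if_distr_eq:
  fixes f g :: "'a \<Rightarrow> ennreal"
  assumes "distr M borel f = distr M borel g" "f \<in> borel_measurable M" "g \<in> borel_measurable M"
  shows "(\<integral>\<^sup>+\<omega>. f \<omega> \<partial>M) = (\<integral>\<^sup>+\<omega>. g \<omega> \<partial>M)"
proof -
  have "(\<integral>\<^sup>+\<omega>. f \<omega> \<partial>M) = (\<integral>\<^sup>+y. y \<partial>distr M borel f)" using assms by (subst nn_integral_distr) auto
  also have "\<dots> = (\<integral>\<^sup>+\<omega>. g \<omega> \<partial>M)" unfolding assms(1) using assms by (subst nn_integral_distr) auto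
  finally show ?thesis .
qed

locale self_similar_process = cadlag_process +
  fixes \<beta> c\<^sub>0 :: real
  assumes \<beta>: "\<beta> > 0"
    and self_similar: "self_similar M X \<beta>"
    and stationary: "stationary_increments M X"
    and c\<^sub>0: "c\<^sub>0 > 0"
    and finite_tv: "(\<integral>\<^sup>+\<omega>. truncated_variation c\<^sub>0 (\<lambda>t. X t \<omega>) 0 1 \<partial>M) < \<infinity>"
    and ergodic: "\<And>k::nat. k \<ge> 1 \<Longrightarrow>
      ergodic_sequence M borel
        (\<lambda>i \<omega>. truncated_variation 1 (\<lambda>t. X t \<omega>) (real (i * k)) (real ((i + 1) * k)))"
begin

abbreviation "TV c s t \<omega> \<equiv> truncated_variation c (\<lambda>t. X t \<omega>) s t"

abbreviation "V c t \<omega> \<equiv> real_tv c (\<lambda>t. X t \<omega>) 0 t"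

text \<open>With \<open>A = c\<^sub>0 powr (- 1 / \<beta>)\<close>, self-similarity turns threshold
  \<open>c\<^sub>0\<close> on \<open>[0, 1]\<close> into threshold 1 on \<open>[0, A]\<close>.
  Stationarity and subadditivity up to 1 reach multiples of \<open>A\<close>, and monotonicity any
  \<open>T\<close>.\<close>

lemma expectation_tv_finite:
  assumes "T \<ge> 0"
  shows "(\<integral>\<^sup>+\<omega>. TV 1 0 T \<omega> \<partial>M) < \<infinity>"
proof -
  note [measurable] = measurable_truncated_variation
  define A where "A = c\<^sub>0 powr (- 1 / \<beta>)"
  have A: "A > 0" "A powr (- \<beta>) = c\<^sub>0" using c\<^sub>0 \<beta> by (auto simp: A_def powr_powr)
  have "(\<integral>\<^sup>+\<omega>. TV c\<^sub>0 0 1 \<omega> \<partial>M) = (\<integral>\<^sup>+\<omega>. ennreal c\<^sub>0 * TV 1 0 A \<omega> \<partial>M)"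
    using distr_truncated_variation_self_similar[OF self_similar A(1), of 1] A c\<^sub>0
    by (intro nn_integral_eq_if_distr_eq) auto
  also have "\<dots> = ennreal c\<^sub>0 * (\<integral>\<^sup>+\<omega>. TV 1 0 A \<omega> \<partial>M)"
    using A by (intro nn_integral_cmult) auto
  finally have base: "(\<integral>\<^sup>+\<omega>. TV 1 0 A \<omega> \<partial>M) < \<infinity>"
    using finite_tv c\<^sub>0 by (auto simp: ennreal_mult_less_top)
  have multiples: "(\<integral>\<^sup>+\<omega>. TV 1 0 (real n * A) \<omega> \<partial>M) < \<infinity>" for n
  proof (induction n)
    case 0
    then show ?case by (simp add: truncated_variation_self)
  next
    case (Suc n)
    let ?a = "real n * A"
    have a: "0 \<le> ?a" using A by simp
    have step: "(\<integral>\<^sup>+\<omega>. TV 1 (0 + ?a) (A + ?a) \<omega> \<partial>M) < \<infinity>"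
    proof (cases "n = 0")
      case False
      then have "(\<integral>\<^sup>+\<omega>. TV 1 (0 + ?a) (A + ?a) \<omega> \<partial>M) = (\<integral>\<^sup>+\<omega>. TV 1 0 A \<omega> \<partial>M)"
        using A by (intro nn_integral_eq_if_distr_eq distr_truncated_variation_shift stationary) auto
      then show ?thesis using base by simp
    qed (use base in simp)
    have "(\<integral>\<^sup>+\<omega>. TV 1 0 (real (Suc n) * A) \<omega> \<partial>M)
        \<le> (\<integral>\<^sup>+\<omega>. TV 1 0 ?a \<omega> + TV 1 (0 + ?a) (A + ?a) \<omega> + ennreal 1 \<partial>M)"
    proof (rule nn_integral_mono)
      fix \<omega>
      have "real (Suc n) * A = A + ?a" by (simp add: algebra_simps)
      then show "TV 1 0 (real (Suc n) * A) \<omega> \<le> TV 1 0 ?a \<omega> + TV 1 (0 + ?a) (A + ?a) \<omega> + ennreal 1"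
        using truncated_variation_subadd[of 1 0 ?a "A + ?a"] a A by simp
    qed
    also have "\<dots> = (\<integral>\<^sup>+\<omega>. TV 1 0 ?a \<omega> \<partial>M) + (\<integral>\<^sup>+\<omega>. TV 1 (0 + ?a) (A + ?a) \<omega> \<partial>M) + 1"
      using A a by (subst nn_integral_add, simp, simp, subst nn_integral_add) (auto simp: emeasure_space_1)
    also have "\<dots> < \<infinity>" using Suc step by (simp add: ennreal_add_less_top)
    finally show ?case .
  qed
  obtain n :: nat where "T / A < real n" using reals_Archimedean2 by blast
  then have "T \<le> real n * A" using A by (simp add: field_simps)
  then have "(\<integral>\<^sup>+\<omega>. TV 1 0 T \<omega> \<partial>M) \<le> (\<integral>\<^sup>+\<omega>. TV 1 0 (real n * A) \<omega> \<partial>M)"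
    using assms by (intro nn_integral_mono truncated_variation_mono) auto
  then show ?thesis using multiples[of n] by (rule le_less_trans)
qed

lemma measurable_V: "c > 0 \<Longrightarrow> t \<ge> 0 \<Longrightarrow> (\<lambda>\<omega>. V c t \<omega>) \<in> borel_measurable M"
  unfolding real_tv_def using measurable_truncated_variation[of 0 t c] by simp

lemma nn_integral_V:
  assumes "c > 0" "t \<ge> 0"
  shows "(\<integral>\<^sup>+\<omega>. ennreal (V c t \<omega>) \<partial>M) = (\<integral>\<^sup>+\<omega>. TV c 0 t \<omega> \<partial>M)"
  using assms cadlag by (intro nn_integral_cong) (simp add: ennreal_real_tv)

lemma integrable_V: "t \<ge> 0 \<Longrightarrow> integrable M (\<lambda>\<omega>. V 1 t \<omega>)"
  using expectation_tv_finite[of t] nn_integral_V[of 1 t] measurable_V[of 1 t]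
  by (intro integrableI_nonneg) (auto simp: real_tv_nonneg)

text \<open>Shifting time by \<open>k\<close> moves the block sequence by one index, so stationary
  increments give the stationarity that \<open>ergodic_sequence\<close> does not contain.\<close>

lemma block_averages:
  assumes k: "k \<ge> 1"
  shows "AE \<omega> in M. (\<lambda>n. (\<Sum>i<n. real_tv 1 (\<lambda>t. X t \<omega>) (real (i * k)) (real ((i + 1) * k))) / real n)
    \<longlonglongrightarrow> expectation (V 1 (real k))"
proof -
  let ?Y = "\<lambda>i \<omega>. TV 1 (real (i * k)) (real ((i + 1) * k)) \<omega>"
  have "AE \<omega> in M. (\<lambda>n. (\<Sum>i<n. enn2real (?Y i \<omega>)) / real n) \<longlonglongrightarrow> (\<integral>\<omega>. enn2real (?Y 0 \<omega>) \<partial>M)"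
  proof (rule stationary_ergodic_average)
    show "?Y i \<in> borel_measurable M" for i by (rule measurable_truncated_variation) auto
    show "integrable M (\<lambda>\<omega>. enn2real (?Y 0 \<omega>))" using integrable_V[of "real k"] by (simp add: real_tv_def)
    have "distr M (\<Pi>\<^sub>M i\<in>UNIV. borel)
        (\<lambda>\<omega> i. TV 1 (real (i * k) + real k) (real ((i + 1) * k) + real k) \<omega>)
      = distr M (\<Pi>\<^sub>M i\<in>UNIV. borel) (\<lambda>\<omega> i. TV 1 (real (i * k)) (real ((i + 1) * k)) \<omega>)"
      using k by (intro distr_truncated_variation_seq_shift stationary) auto
    then show "distr M (\<Pi>\<^sub>M i\<in>UNIV. borel) (\<lambda>\<omega> i. ?Y (Suc i) \<omega>) = distr M (\<Pi>\<^sub>M i\<in>UNIV. borel) (\<lambda>\<omega> i. ?Y i \<omega>)"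
      by (simp add: algebra_simps)
  qed (rule ergodic[OF k])
  then show ?thesis by (simp add: real_tv_def)
qed

text \<open>
  The bounds of \<open>block_averages_limit\<close> recover the limit along a path from the expectations alone, so it
  is the same for almost all paths.
\<close>

lemma growth_rate:
  obtains C where "C \<ge> 0" "AE \<omega> in M. ((\<lambda>T. V 1 T \<omega> / T) \<longlongrightarrow> C) at_top"
    "(\<lambda>n. expectation (V 1 (real n)) / real n) \<longlonglongrightarrow> C"
proof -
  let ?a = "\<lambda>k. expectation (V 1 (real k))"
  let ?good = "\<lambda>\<omega> C. ((\<lambda>T. V 1 T \<omega> / T) \<longlongrightarrow> C) at_top \<and>
    (\<forall>k\<ge>1. ?a k / real k \<le> C \<and> C \<le> ?a k / real k + 1 / real k)"
  have unique: "(\<lambda>n. ?a n / real n) \<longlonglongrightarrow> C" if "?good \<omega> C" for \<omega> C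
  proof (rule tendsto_sandwich[of "\<lambda>n. C - 1 / real n" _ _ "\<lambda>_. C"])
    show "(\<lambda>n. C - 1 / real n) \<longlonglongrightarrow> C"
      using tendsto_diff[OF tendsto_const lim_1_over_n, of C] by simp
    show "\<forall>\<^sub>F n in sequentially. C - 1 / real n \<le> ?a n / real n"
      "\<forall>\<^sub>F n in sequentially. ?a n / real n \<le> C"
      using that by (auto intro!: eventually_sequentiallyI[of 1] simp: diff_le_eq)
  qed simp
  have "AE \<omega> in M. \<forall>k. k \<ge> 1 \<longrightarrow>
      (\<lambda>n. (\<Sum>i<n. real_tv 1 (\<lambda>t. X t \<omega>) (real (i * k)) (real ((i + 1) * k))) / real n) \<longlonglongrightarrow> ?a k"
    unfolding AE_all_countable using block_averages by auto
  then have ae: "AE \<omega> in M. \<exists>C. ?good \<omega> C"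
    using AE_space
  proof eventually_elim
    case (elim \<omega>)
    show ?case
    proof (rule block_averages_limit[where S="\<lambda>k n. \<Sum>i<n. real_tv 1 (\<lambda>t. X t \<omega>) (real (i * k)) (real ((i + 1) * k))"])
      show "V 1 s \<omega> \<le> V 1 t \<omega>" if "0 \<le> s" "s \<le> t" for s t
        using that cadlag elim by (intro real_tv_mono) auto
      show "(\<Sum>i<n. real_tv 1 (\<lambda>t. X t \<omega>) (real (i * k)) (real ((i + 1) * k))) \<le> V 1 (real (n * k)) \<omega>" for k n
        using real_tv_blocks(1)[OF cadlag, of \<omega> 1 k n] elim by simp
      show "V 1 (real (n * k)) \<omega> \<le> (\<Sum>i<n. real_tv 1 (\<lambda>t. X t \<omega>) (real (i * k)) (real ((i + 1) * k))) + real n" for k n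
        using real_tv_blocks(2)[OF cadlag, of \<omega> 1 n k] elim by simp
    qed (use elim in blast)
  qed
  \<comment> \<open>A property that holds almost surely in a probability space holds somewhere; the
    rate of this one path becomes the constant.\<close>
  have "\<exists>\<omega> C. ?good \<omega> C"
  proof (rule ccontr)
    assume none: "\<not> ?thesis"
    from ae have "AE \<omega> in M. False"
      by eventually_elim (use none in blast)
    then show False by simp
  qed
  then obtain \<omega>0 C where C: "?good \<omega>0 C" by blast
  show ?thesis
  proof (rule that)
    show lim: "(\<lambda>n. ?a n / real n) \<longlonglongrightarrow> C" by (rule unique[OF C])
    show "C \<ge> 0"
      using lim by (rule LIMSEQ_le_const) (auto simp: real_tv_nonneg intro!: divide_nonneg_nonneg integral_nonneg)
    show "AE \<omega> in M. ((\<lambda>T. V 1 T \<omega> / T) \<longlongrightarrow> C) at_top"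
      using ae
    proof eventually_elim
      case (elim \<omega>)
      then obtain C' where C': "?good \<omega> C'" by blast
      have "C' = C" using LIMSEQ_unique[OF unique[OF C'] lim] .
      with C' show ?case by simp
    qed
  qed
qed

end

section \<open>Almost sure convergence along a subsequence\<close>

text \<open>This is the weighted cost of one splitting, which tends to 0 with \<open>c\<close>; for
  \<open>c = A powr (- \<beta>)\<close> it is the factor \<open>1 / A\<close> of the scaling
  identity.\<close>

lemma weight_times_level:
  fixes c \<beta> :: real
  assumes "c > 0"
  shows "c powr (1 / \<beta> - 1) * c = c powr (1 / \<beta>)"
  using powr_add[of c "1 / \<beta> - 1" 1] assms by simp

text \<open>Super- and subadditivity make the weighted truncated variation additive up to
  \<open>c n powr (1 / \<beta>)\<close>, so intervals starting at 0 determine all others.\<close>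

lemma real_tv_increments_tendsto:
  fixes c :: "nat \<Rightarrow> real"
  assumes x: "cadlag x" and c: "\<And>n. c n > 0" "c \<longlonglongrightarrow> 0" and \<beta>: "\<beta> > 0" and C: "C \<ge> 0"
    and rat: "\<And>q. q \<in> \<rat> \<Longrightarrow> 0 \<le> q \<Longrightarrow> (\<lambda>n. c n powr (1 / \<beta> - 1) * real_tv (c n) x 0 q) \<longlonglongrightarrow> C * q"
    and st: "0 \<le> s" "s \<le> t"
  shows "(\<lambda>n. c n powr (1 / \<beta> - 1) * real_tv (c n) x s t) \<longlonglongrightarrow> C * (t - s)"
proof -
  let ?w = "\<lambda>n. c n powr (1 / \<beta> - 1)"
  let ?G = "\<lambda>n t. ?w n * real_tv (c n) x 0 t"
  have G: "(\<lambda>n. ?G n u) \<longlonglongrightarrow> C * u" if "0 \<le> u" for u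
  proof (rule monotone_tendsto_from_rationals[OF _ C rat that])
    show "?G n s \<le> ?G n t" if "0 \<le> s" "s \<le> t" for n s t
      using that x c(1)[of n] by (intro mult_left_mono real_tv_mono) auto
  qed
  have "(\<lambda>n. ?G n t - ?G n s) \<longlonglongrightarrow> C * t - C * s" using G st by (intro tendsto_diff) auto
  then have up: "(\<lambda>n. ?G n t - ?G n s) \<longlonglongrightarrow> C * (t - s)" by (simp add: right_diff_distrib)
  have "(\<lambda>n. c n powr (1 / \<beta>)) \<longlonglongrightarrow> 0"
    using c \<beta> by (intro tendsto_zero_powrI[OF c(2) tendsto_const]) (auto intro!: always_eventually less_imp_le)
  then have low: "(\<lambda>n. ?G n t - ?G n s - c n powr (1 / \<beta>)) \<longlonglongrightarrow> C * (t - s)"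
    using tendsto_diff[OF up] by fastforce
  show ?thesis
  proof (rule tendsto_sandwich[OF _ _ low up])
    show "\<forall>\<^sub>F n in sequentially. ?w n * real_tv (c n) x s t \<le> ?G n t - ?G n s"
    proof (rule always_eventually, rule allI)
      fix n
      have "?w n * (real_tv (c n) x 0 s + real_tv (c n) x s t) \<le> ?w n * real_tv (c n) x 0 t"
        using real_tv_superadd[OF x order_refl st c(1)] by (intro mult_left_mono) auto
      then show "?w n * real_tv (c n) x s t \<le> ?G n t - ?G n s" by (simp add: distrib_left)
    qed
    show "\<forall>\<^sub>F n in sequentially. ?G n t - ?G n s - c n powr (1 / \<beta>) \<le> ?w n * real_tv (c n) x s t"
    proof (rule always_eventually, rule allI)
      fix n
      have "?w n * real_tv (c n) x 0 t \<le> ?w n * (real_tv (c n) x 0 s + real_tv (c n) x s t + c n)"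
        using real_tv_subadd[OF x order_refl st c(1)] by (intro mult_left_mono) auto
      then show "?G n t - ?G n s - c n powr (1 / \<beta>) \<le> ?w n * real_tv (c n) x s t"
        using weight_times_level[OF c(1), of n \<beta>] by (simp add: distrib_left)
    qed
  qed
qed

context self_similar_process
begin

text \<open>The expectation of a bounded function of one truncated variation depends on its law
  alone, so it can be moved to threshold 1, where almost sure convergence is known. The cap
  \<open>min 1\<close> gives the domination and still detects convergence in probability. The levels
  correspond to \<open>A = real (Suc n)\<close>.\<close>

lemma mean_convergence:
  assumes ae: "AE \<omega> in M. ((\<lambda>T. V 1 T \<omega> / T) \<longlongrightarrow> C) at_top" and q: "q \<ge> 0"
    and c_def: "\<And>n. c n = real (Suc n) powr (- \<beta>)"
  shows "(\<lambda>n. \<integral>\<omega>. min 1 \<bar>c n powr (1 / \<beta> - 1) * V (c n) q \<omega> - C * q\<bar> \<partial>M) \<longlonglongrightarrow> 0"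
proof -
  let ?A = "\<lambda>n. real (Suc n)"
  have c: "c n > 0" for n by (simp add: c_def)
  have "(\<integral>\<omega>. min 1 \<bar>c n powr (1 / \<beta> - 1) * V (c n) q \<omega> - C * q\<bar> \<partial>M)
      = (\<integral>\<omega>. min 1 \<bar>V 1 (?A n * q) \<omega> / ?A n - C * q\<bar> \<partial>M)" for n
  proof -
    define g where "g y = min 1 \<bar>c n powr (1 / \<beta> - 1) * enn2real y - C * q\<bar>" for y
    have [measurable]: "g \<in> borel_measurable borel" unfolding g_def by measurable
    have [measurable]: "(\<lambda>\<omega>. TV (c n) 0 q \<omega>) \<in> borel_measurable M"
      "(\<lambda>\<omega>. TV 1 0 (?A n * q) \<omega>) \<in> borel_measurable M"
      using q c[of n] by (intro measurable_truncated_variation; simp)+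
    have e: "- \<beta> * (1 / \<beta>) = - 1" using \<beta> by simp
    have "c n powr (1 / \<beta>) = ?A n powr (- 1)"
      by (simp only: c_def powr_powr e)
    also have "\<dots> = 1 / ?A n" by (simp add: powr_minus_divide)
    finally have "c n powr (1 / \<beta>) = 1 / ?A n" .
    then have w: "c n powr (1 / \<beta> - 1) * (c n * v) = v / ?A n" for v
      using weight_times_level[OF c, of n \<beta>] by (simp add: mult.assoc[symmetric])
    have "(\<integral>\<omega>. g (TV (c n) 0 q \<omega>) \<partial>M) = (\<integral>y. g y \<partial>distr M borel (TV (c n) 0 q))"
      by (subst integral_distr) auto
    also have "\<dots> = (\<integral>y. g y \<partial>distr M borel (\<lambda>\<omega>. ennreal (c n) * TV 1 0 (?A n * q) \<omega>))"
      using distr_truncated_variation_self_similar[OF self_similar, of "?A n" q] q by (simp add: c_def)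
    also have "\<dots> = (\<integral>\<omega>. g (ennreal (c n) * TV 1 0 (?A n * q) \<omega>) \<partial>M)"
      by (rule integral_distr) measurable
    also have "\<dots> = (\<integral>\<omega>. min 1 \<bar>V 1 (?A n * q) \<omega> / ?A n - C * q\<bar> \<partial>M)"
      using c[of n] by (simp add: g_def enn2real_mult w real_tv_def del: of_nat_Suc)
    finally show ?thesis by (simp add: g_def real_tv_def)
  qed
  moreover have "(\<lambda>n. \<integral>\<omega>. min 1 \<bar>V 1 (?A n * q) \<omega> / ?A n - C * q\<bar> \<partial>M) \<longlonglongrightarrow> (\<integral>\<omega>. 0 \<partial>M)"
  proof (rule integral_dominated_convergence)
    have [measurable]: "(\<lambda>\<omega>. V 1 (?A n * q) \<omega>) \<in> borel_measurable M" for n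
      using q by (intro measurable_V) auto
    show "(\<lambda>\<omega>. min 1 \<bar>V 1 (?A n * q) \<omega> / ?A n - C * q\<bar>) \<in> borel_measurable M" for n by measurable
    show "AE \<omega> in M. (\<lambda>n. min 1 \<bar>V 1 (?A n * q) \<omega> / ?A n - C * q\<bar>) \<longlonglongrightarrow> 0"
      using ae
    proof eventually_elim
      case (elim \<omega>)
      have "(\<lambda>n. V 1 (?A n * q) \<omega> / ?A n) \<longlonglongrightarrow> C * q"
      proof (cases "q = 0")
        case True
        then show ?thesis by (simp add: real_tv_def truncated_variation_self)
      next
        case False
        have "filterlim (\<lambda>n. ?A n * q) at_top sequentially"
          using False q by (intro filterlim_at_top_mult_tendsto_pos[OF tendsto_const]
              filterlim_compose[OF filterlim_real_sequentially filterlim_Suc]) auto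
        with elim have "(\<lambda>n. V 1 (?A n * q) \<omega> / (?A n * q)) \<longlonglongrightarrow> C" by (rule filterlim_compose)
        from tendsto_mult[OF this tendsto_const[of q]] show ?thesis using False by simp
      qed
      then have "(\<lambda>n. \<bar>V 1 (?A n * q) \<omega> / ?A n - C * q\<bar>) \<longlonglongrightarrow> \<bar>C * q - C * q\<bar>"
        by (intro tendsto_intros)
      from tendsto_min[OF tendsto_const[of 1] this] show ?case by simp
    qed
    show "AE \<omega> in M. norm (min 1 \<bar>V 1 (?A n * q) \<omega> / ?A n - C * q\<bar>) \<le> 1" for n
      by (intro AE_I2) auto
    show "integrable M (\<lambda>_. 1 :: real)" by simp
  qed simp
  ultimately show ?thesis by simp
qed

text \<open>One sequence has to serve all rational times. \<open>u m n\<close> adds the errors at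
  the first \<open>m\<close> of them; along \<open>N m\<close> the number of times grows while the
  expected total error vanishes, so a single almost surely convergent subsequence controls every
  rational time eventually.\<close>

lemma almost_sure_subsequence:
  assumes ae: "AE \<omega> in M. ((\<lambda>T. V 1 T \<omega> / T) \<longlongrightarrow> C) at_top"
  obtains c :: "nat \<Rightarrow> real" where "\<And>n. c n > 0" "c \<longlonglongrightarrow> 0"
    "AE \<omega> in M. \<forall>q. q \<in> \<rat> \<and> 0 \<le> q \<longrightarrow> (\<lambda>n. c n powr (1 / \<beta> - 1) * V (c n) q \<omega>) \<longlonglongrightarrow> C * q"
proof -
  define b where "b n = real (Suc n) powr (- \<beta>)" for n
  have b: "b n > 0" for n by (simp add: b_def)
  have b0: "b \<longlonglongrightarrow> 0"
    unfolding b_def[abs_def] using \<beta>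
    by (intro tendsto_neg_powr filterlim_compose[OF filterlim_real_sequentially filterlim_Suc]) auto
  let ?R = "{q :: real. q \<in> \<rat> \<and> 0 \<le> q}"
  have "countable ?R" by (rule countable_subset[OF _ countable_rat]) auto
  moreover have "?R \<noteq> {}" by (auto intro!: exI[of _ 0])
  ultimately have "range (from_nat_into ?R) = ?R" by (intro range_from_nat_into)
  then obtain qs :: "nat \<Rightarrow> real" where qs: "range qs = ?R" ..
  then have qs0: "qs j \<ge> 0" for j by auto
  define d where "d n j \<omega> = min 1 \<bar>b n powr (1 / \<beta> - 1) * V (b n) (qs j) \<omega> - C * qs j\<bar>" for n j \<omega>
  have d0: "d n j \<omega> \<ge> 0" for n j \<omega> by (simp add: d_def)
  have dm: "d n j \<in> borel_measurable M" for n j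
  proof -
    have [measurable]: "(\<lambda>\<omega>. V (b n) (qs j) \<omega>) \<in> borel_measurable M"
      using b qs0 by (rule measurable_V)
    show ?thesis unfolding d_def[abs_def] by measurable
  qed
  have dint: "integrable M (d n j)" for n j
    using dm by (intro integrable_const_bound[of _ 1]) (auto simp: d_def)
  define u where "u m n \<omega> = (\<Sum>j<m. d n j \<omega>)" for m n \<omega>
  have uint: "integrable M (u m n)" for m n
    unfolding u_def[abs_def] using dint by (intro Bochner_Integration.integrable_sum)
  have "(\<lambda>n. \<integral>\<omega>. u m n \<omega> \<partial>M) \<longlonglongrightarrow> 0" for m
  proof -
    have "(\<lambda>n. \<Sum>j<m. \<integral>\<omega>. d n j \<omega> \<partial>M) \<longlonglongrightarrow> (\<Sum>j<m. 0)"
      unfolding d_def using mean_convergence[OF ae qs0 b_def] by (intro tendsto_sum)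
    then show ?thesis unfolding u_def using dint by simp
  qed
  \<comment> \<open>The condition \<open>m \<le> n\<close> makes the chosen indices tend to
    infinity, hence the levels to 0.\<close>
  then have "\<forall>\<^sub>F n in sequentially. (\<integral>\<omega>. u m n \<omega> \<partial>M) < 1 / real (Suc m) \<and> m \<le> n" for m
    by (intro eventually_conj eventually_ge_at_top order_tendstoD(2)) auto
  then have "\<exists>n. (\<integral>\<omega>. u m n \<omega> \<partial>M) < 1 / real (Suc m) \<and> m \<le> n" for m
    by (blast dest: eventually_happens'[OF sequentially_bot])
  then obtain N where N: "\<And>m. (\<integral>\<omega>. u m (N m) \<omega> \<partial>M) < 1 / real (Suc m)" "\<And>m. m \<le> N m" by metis
  have u0: "u m n \<omega> \<ge> 0" for m n \<omega> by (simp add: u_def d0 sum_nonneg)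
  have "(\<lambda>m. \<integral>\<omega>. norm (u m (N m) \<omega>) \<partial>M) \<longlonglongrightarrow> 0"
  proof (rule tendsto_sandwich[of "\<lambda>_. 0" _ _ "\<lambda>m. 1 / real (Suc m)"])
    show "(\<lambda>m. 1 / real (Suc m)) \<longlonglongrightarrow> 0" by (rule LIMSEQ_Suc[OF lim_1_over_n])
  qed (use N(1) u0 in \<open>auto intro!: always_eventually less_imp_le\<close>)
  with uint obtain r where r: "strict_mono r" "AE \<omega> in M. (\<lambda>i. u (r i) (N (r i)) \<omega>) \<longlonglongrightarrow> 0"
    using tendsto_L1_AE_subseq[of M "\<lambda>m. u m (N m)"] by blast
  show ?thesis
  proof (rule that)
    show "b (N (r i)) > 0" for i by (rule b)
    have "i \<le> N (r i)" for i using seq_suble[OF r(1), of i] N(2)[of "r i"] by linarith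
    then have "filterlim (\<lambda>i. N (r i)) sequentially sequentially"
      by (intro filterlim_at_top_mono[OF filterlim_ident]) auto
    with b0 show "(\<lambda>i. b (N (r i))) \<longlonglongrightarrow> 0" by (rule filterlim_compose)
    show "AE \<omega> in M. \<forall>q. q \<in> \<rat> \<and> 0 \<le> q \<longrightarrow>
        (\<lambda>i. b (N (r i)) powr (1 / \<beta> - 1) * V (b (N (r i))) q \<omega>) \<longlonglongrightarrow> C * q"
      using r(2)
    proof eventually_elim
      case (elim \<omega>)
      show ?case
      proof (intro allI impI)
        fix q :: real assume "q \<in> \<rat> \<and> 0 \<le> q"
        then obtain j where j: "q = qs j" using qs by blast
        have "d (N (r i)) j \<omega> \<le> u (r i) (N (r i)) \<omega>" if "i \<ge> Suc j" for i
        proof -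
          have "j < r i" using seq_suble[OF r(1), of i] that by linarith
          then show ?thesis unfolding u_def using d0 by (intro member_le_sum) auto
        qed
        then have "\<forall>\<^sub>F i in sequentially. d (N (r i)) j \<omega> \<le> u (r i) (N (r i)) \<omega>"
          by (intro eventually_sequentiallyI)
        then have d: "(\<lambda>i. d (N (r i)) j \<omega>) \<longlonglongrightarrow> 0"
          using d0 by (intro tendsto_sandwich[OF _ _ tendsto_const elim]) auto
        show "(\<lambda>i. b (N (r i)) powr (1 / \<beta> - 1) * V (b (N (r i))) q \<omega>) \<longlonglongrightarrow> C * q"
        proof (rule tendstoI)
          fix e :: real assume "e > 0"
          \<comment> \<open>Below 1 the cap in \<open>d\<close> is inactive.\<close>
          then have "\<forall>\<^sub>F i in sequentially. d (N (r i)) j \<omega> < min 1 e"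
            using d by (intro order_tendstoD) auto
          then show "\<forall>\<^sub>F i in sequentially. dist (b (N (r i)) powr (1 / \<beta> - 1) * V (b (N (r i))) q \<omega>) (C * q) < e"
            by eventually_elim (auto simp: d_def j dist_real_def)
        qed
      qed
    qed
  qed
qed

end

text \<open>The exceptional event in \<open>has_local_time\<close> may depend on \<open>t\<close>.
  Occupation measures increase with time, so integer times suffice and give one null set.\<close>

lemma (in cadlag_process) AE_occupation_absolutely_continuous:
  assumes "has_local_time M X"
  shows "AE \<omega> in M. \<forall>t\<ge>0. absolutely_continuous lborel (occupation_measure X t \<omega>)"
proof -
  have "AE \<omega> in M. \<forall>n::nat. absolutely_continuous lborel (occupation_measure X (real n) \<omega>)"
    using assms unfolding has_local_time_def AE_all_countable by simp
  then show ?thesis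
    using AE_space
  proof eventually_elim
    case (elim \<omega>)
    have xm: "(\<lambda>s. X s \<omega>) \<in> borel_measurable (restrict_space lborel {0..t})" for t
    proof -
      have "(\<lambda>u. X (max 0 u) \<omega>) \<in> borel_measurable (restrict_space lborel {0..t})"
        using cadlag_borel_measurable[OF cadlag[OF elim(2)]] by (intro measurable_restrict_space1) simp
      then show ?thesis
        by (rule measurable_cong[THEN iffD1, rotated]) (auto simp: space_restrict_space)
    qed
    show ?case
    proof (intro allI impI)
      fix t :: real assume "t \<ge> 0"
      obtain n :: nat where n: "t < real n" using reals_Archimedean2 by blast
      show "absolutely_continuous lborel (occupation_measure X t \<omega>)"
        unfolding absolutely_continuous_def
      proof
        fix \<Gamma> assume \<Gamma>: "\<Gamma> \<in> null_sets (lborel :: real measure)"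
        then have \<Gamma>b: "\<Gamma> \<in> sets borel" by auto
        have "\<Gamma> \<in> null_sets (occupation_measure X (real n) \<omega>)"
          using \<Gamma> elim(1) by (auto simp: absolutely_continuous_def)
        then have "emeasure (occupation_measure X (real n) \<omega>) \<Gamma> = 0" by auto
        moreover have "emeasure (occupation_measure X t \<omega>) \<Gamma> \<le> emeasure (occupation_measure X (real n) \<omega>) \<Gamma>"
          unfolding emeasure_occupation_measure[where X=X and \<omega>=\<omega>, OF xm \<Gamma>b] using n
          by (intro nn_integral_mono) (auto simp: indicator_def)
        ultimately show "\<Gamma> \<in> null_sets (occupation_measure X t \<omega>)"
          using \<Gamma>b by (auto simp: null_sets_def occupation_measure_def)
      qed
    qed
  qed
qed

theorem corollary2p7:
  fixes M :: "'w measure" and X :: "real \<Rightarrow> 'w \<Rightarrow> real" and \<beta> c\<^sub>0 :: real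
  assumes "prob_space M"
    and "\<And>t. t \<ge> 0 \<Longrightarrow> X t \<in> borel_measurable M"
    and "\<beta> > 0" and "self_similar M X \<beta>"
    and "stationary_increments M X"
    and "\<And>\<omega>. \<omega> \<in> space M \<Longrightarrow> cadlag (\<lambda>t. X t \<omega>)"
    and "c\<^sub>0 > 0" and "(\<integral>\<^sup>+\<omega>. truncated_variation c\<^sub>0 (\<lambda>t. X t \<omega>) 0 1 \<partial>M) < \<infinity>"
    and "\<And>k::nat. k \<ge> 1 \<Longrightarrow>
      ergodic_sequence M borel
        (\<lambda>i \<omega>. truncated_variation 1 (\<lambda>t. X t \<omega>) (real (i * k)) (real ((i + 1) * k)))"
    and "has_local_time M X"
  shows "\<exists>C::real. C \<ge> 0 \<and>
    (\<lambda>n. (\<integral>\<^sup>+\<omega>. truncated_variation 1 (\<lambda>t. X t \<omega>) 0 (real n) \<partial>M) / of_nat n)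
      \<longlonglongrightarrow> ennreal C \<and>
    (\<exists>(c :: nat \<Rightarrow> real) \<Omega>\<^sub>X. (\<forall>n. c n > 0) \<and> c \<longlonglongrightarrow> 0 \<and>
      \<Omega>\<^sub>X \<in> sets M \<and> emeasure M \<Omega>\<^sub>X = 1 \<and>
      (\<forall>\<omega>\<in>\<Omega>\<^sub>X. \<forall>t\<ge>0.
        absolutely_continuous lborel (occupation_measure X t \<omega>) \<and>
        weakly_converges
          (\<lambda>n. density lborel (\<lambda>y.
             ennreal (c n powr (1 / \<beta> - 1) * real (crossings y (c n) (\<lambda>s. X s \<omega>) 0 t))))
          (density lborel (\<lambda>y. ennreal C * local_time X t \<omega> y))))"
proof -
  interpret prob_space M by fact
  interpret self_similar_process M X \<beta> c\<^sub>0
    by unfold_locales (use assms in auto)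
  obtain C where C: "C \<ge> 0" "AE \<omega> in M. ((\<lambda>T. V 1 T \<omega> / T) \<longlongrightarrow> C) at_top"
    "(\<lambda>n. expectation (V 1 (real n)) / real n) \<longlonglongrightarrow> C"
    by (rule growth_rate)
  obtain c :: "nat \<Rightarrow> real" where c: "\<And>n. c n > 0" "c \<longlonglongrightarrow> 0"
    "AE \<omega> in M. \<forall>q. q \<in> \<rat> \<and> 0 \<le> q \<longrightarrow> (\<lambda>n. c n powr (1 / \<beta> - 1) * V (c n) q \<omega>) \<longlonglongrightarrow> C * q"
    using almost_sure_subsequence[OF C(2)] by blast
  have "(\<integral>\<^sup>+\<omega>. TV 1 0 (real n) \<omega> \<partial>M) / of_nat n = ennreal (expectation (V 1 (real n)) / real n)"
    if "n \<ge> 1" for n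
  proof -
    have "(\<integral>\<^sup>+\<omega>. TV 1 0 (real n) \<omega> \<partial>M) = ennreal (expectation (V 1 (real n)))"
      using nn_integral_V[of 1 "real n"] nn_integral_eq_integral[OF integrable_V, of "real n"]
      by (simp add: real_tv_nonneg)
    then show ?thesis
      using that by (simp add: divide_ennreal ennreal_of_nat_eq_real_of_nat real_tv_nonneg)
  qed
  then have "\<forall>\<^sub>F n in sequentially. ennreal (expectation (V 1 (real n)) / real n)
      = (\<integral>\<^sup>+\<omega>. TV 1 0 (real n) \<omega> \<partial>M) / of_nat n"
    by (intro eventually_sequentiallyI[of 1]) simp
  with tendsto_ennrealI[OF C(3)]
  have rate: "(\<lambda>n. (\<integral>\<^sup>+\<omega>. TV 1 0 (real n) \<omega> \<partial>M) / of_nat n) \<longlonglongrightarrow> ennreal C"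
    by (rule Lim_transform_eventually)
  let ?good = "\<lambda>\<omega>. \<forall>t\<ge>0. absolutely_continuous lborel (occupation_measure X t \<omega>) \<and>
        weakly_converges
          (\<lambda>n. density lborel (\<lambda>y.
             ennreal (c n powr (1 / \<beta> - 1) * real (crossings y (c n) (\<lambda>s. X s \<omega>) 0 t))))
          (density lborel (\<lambda>y. ennreal C * local_time X t \<omega> y))"
  have "AE \<omega> in M. ?good \<omega>"
    using c(3) AE_occupation_absolutely_continuous[OF assms(10)] AE_space
  proof eventually_elim
    case (elim \<omega>)
    have x: "cadlag (\<lambda>t. X t \<omega>)" using elim by (intro cadlag)
    have "(\<lambda>n. c n powr (1 / \<beta> - 1) * enn2real (TV (c n) s t \<omega>)) \<longlonglongrightarrow> C * (t - s)"
      if "0 \<le> s" "s \<le> t" for s t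
      using real_tv_increments_tendsto[OF x c(1,2) \<beta> C(1) _ that] elim(1) unfolding real_tv_def by blast
    then show ?case
      using elim(2) c(1) C(1) unfolding local_time_def occupation_measure_def
      by (intro allI impI conjI crossings_weakly_converge[OF x]) auto
  qed
  \<comment> \<open>No measurability of the set of good outcomes is established; the event is the
    complement of a measurable null set that covers the bad ones.\<close>
  then obtain N where N: "{\<omega> \<in> space M. \<not> ?good \<omega>} \<subseteq> N" "emeasure M N = 0" "N \<in> sets M"
    by (rule AE_E)
  have "emeasure M (space M - N) = 1"
    using N by (simp add: emeasure_compl emeasure_space_1)
  moreover have "\<forall>\<omega>\<in>space M - N. ?good \<omega>" using N(1) by blast
  moreover have "space M - N \<in> sets M" using N(3) by simp
  ultimately show ?thesis
    using C(1) rate c(1,2) by blast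
qed

end
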